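(* Let $x^A=x_1^{\alpha_1}\cdots x_N^{\alpha_N}$ with $\alpha_i\ge0$, $\mathbb{R}^N_*=\{x\in\mathbb{R}^N:x_i>0\text{ whenever }\alpha_i>0\}$, and $d\mu_A=\frac{x^Ae^{-|x|^2/2}}{\int_{\mathbb{R}^N_*}x^Ae^{-|x|^2/2}dx}\,dx$ on $\mathbb{R}^N_*$. For all $u\in X_A$, $$\int_{\mathbb{R}^N_*}|\nabla u|^2d\mu_A-\int_{\mathbb{R}^N_*}\left|u-\int_{\mathbb{R}^N_*}u\,d\mu_A\right|^2d\mu_A\ge\frac12\int_{\mathbb{R}^N_*}\left|\nabla\left[u-\left(\int_{\mathbb{R}^N_*}\Big(u-\int_{\mathbb{R}^N_*}u\,d\mu_A\Big)x\,d\mu_A\right)\cdot x\right]\right|^2d\mu_A,$$ where $\int(\cdot)x\,d\mu_A\in\mathbb{R}^N$ denotes the vector of integrals against the coordinates. If $x^A$ is partial, then equality is attained by some non-linear function $u\in X_A$.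
   Context: $N_*$ is the set of $u\in C_0^\infty(\overline{\mathbb{R}^N_*})$ with $\nabla u\cdot\vec\eta=0$ on $\partial\mathbb{R}^N_*$ ($\vec\eta$ the outer normal). $X_A$ is the completion of $N_*$ under the norm $\left(\int|u|^2d\mu_A\right)^{1/2}+\left(\int|\nabla u|^2d\mu_A\right)^{1/2}$. The monomial weight $x^A$ is called full if $\alpha_i>0$ for all $i$, and partial otherwise. *)

theory Defs
  imports "HOL-Analysis.Analysis"
begin

definition partial :: "'n::finite \<Rightarrow> (real^'n \<Rightarrow> real) \<Rightarrow> real^'n \<Rightarrow> real" where
  "partial i f x = frechet_derivative f (at x) (axis i 1)"

definition grad :: "(real^'n::finite \<Rightarrow> real) \<Rightarrow> real^'n \<Rightarrow> real^'n" where
  "grad f x = (\<chi> i. partial i f x)"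

fun Ck :: "nat \<Rightarrow> (real^'n::finite \<Rightarrow> real) \<Rightarrow> bool" where
  "Ck 0 f = continuous_on UNIV f"
| "Ck (Suc k) f = ((\<forall>x. f differentiable (at x)) \<and> (\<forall>i. Ck k (partial i f)))"

definition smooth :: "(real^'n::finite \<Rightarrow> real) \<Rightarrow> bool" where
  "smooth f \<longleftrightarrow> (\<forall>k. Ck k f)"

definition RNstar :: "('n::finite \<Rightarrow> real) \<Rightarrow> (real^'n) set" where
  "RNstar \<alpha> = {x. \<forall>i. \<alpha> i > 0 \<longrightarrow> x $ i > 0}"

definition monomial :: "('n::finite \<Rightarrow> real) \<Rightarrow> real^'n \<Rightarrow> real" where
  "monomial \<alpha> x = (\<Prod>i\<in>UNIV. if \<alpha> i = 0 then 1 else (x $ i) powr (\<alpha> i))"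

definition gauss_w :: "('n::finite \<Rightarrow> real) \<Rightarrow> real^'n \<Rightarrow> real" where
  "gauss_w \<alpha> x = monomial \<alpha> x * exp (- (norm x)\<^sup>2 / 2)"

definition norm_const :: "('n::finite \<Rightarrow> real) \<Rightarrow> real" where
  "norm_const \<alpha> = (\<integral>x\<in>RNstar \<alpha>. gauss_w \<alpha> x \<partial>lborel)"

definition muA :: "('n::finite \<Rightarrow> real) \<Rightarrow> (real^'n) measure" where
  "muA \<alpha> = density (restrict_space lborel (RNstar \<alpha>))
              (\<lambda>x. ennreal (gauss_w \<alpha> x / norm_const \<alpha>))"

text \<open>The class N_*: restrictions to the closure of R^N_* of smooth compactly
  supported functions with vanishing normal derivative on the boundary.
  The boundary of R^N_* consists of the faces {x_i = 0} (alpha_i > 0) of the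
  closure, with outer normal -e_i; the condition is d_i u = 0 there.\<close>
definition Nstar :: "('n::finite \<Rightarrow> real) \<Rightarrow> (real^'n \<Rightarrow> real) set" where
  "Nstar \<alpha> = {u. smooth u \<and> bounded {x. u x \<noteq> 0} \<and>
      (\<forall>i x. \<alpha> i > 0 \<longrightarrow> x \<in> closure (RNstar \<alpha>) \<longrightarrow> x $ i = 0 \<longrightarrow> partial i u x = 0)}"

text \<open>The space X_A, the completion of N_* under the norm
  ||u||_{L^2(mu)} + ||grad u||_{L^2(mu)}, realised concretely: an element is a
  pair (u, g) of a square integrable function u and a square integrable vector
  field g (its generalised gradient) such that some sequence in N_* converges
  to u in L^2(mu) with gradients converging to g in L^2(mu).\<close>
definition XA :: "('n::finite \<Rightarrow> real) \<Rightarrow> ((real^'n \<Rightarrow> real) \<times> (real^'n \<Rightarrow> real^'n)) set" where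
  "XA \<alpha> = {(u, g).
      u \<in> borel_measurable (muA \<alpha>) \<and> g \<in> borel_measurable (muA \<alpha>) \<and>
      integrable (muA \<alpha>) (\<lambda>x. (u x)\<^sup>2) \<and> integrable (muA \<alpha>) (\<lambda>x. (norm (g x))\<^sup>2) \<and>
      (\<exists>\<phi>. (\<forall>k. \<phi> k \<in> Nstar \<alpha>) \<and>
         (\<lambda>k. \<integral>x. (\<phi> k x - u x)\<^sup>2 \<partial>muA \<alpha>) \<longlonglongrightarrow> 0 \<and>
         (\<lambda>k. \<integral>x. (norm (grad (\<phi> k) x - g x))\<^sup>2 \<partial>muA \<alpha>) \<longlonglongrightarrow> 0)}"

definition meanA :: "('n::finite \<Rightarrow> real) \<Rightarrow> (real^'n \<Rightarrow> real) \<Rightarrow> real" where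
  "meanA \<alpha> u = (\<integral>x. u x \<partial>muA \<alpha>)"

definition momA :: "('n::finite \<Rightarrow> real) \<Rightarrow> (real^'n \<Rightarrow> real) \<Rightarrow> real^'n" where
  "momA \<alpha> u = (\<chi> j. \<integral>x. (u x - meanA \<alpha> u) * x $ j \<partial>muA \<alpha>)"

text \<open>Deficit: LHS minus RHS of the inequality, for (u,g) in X_A. The gradient of
  u - c.x is g - c.\<close>
definition lhsA :: "('n::finite \<Rightarrow> real) \<Rightarrow> (real^'n \<Rightarrow> real) \<Rightarrow> (real^'n \<Rightarrow> real^'n) \<Rightarrow> real" where
  "lhsA \<alpha> u g = (\<integral>x. (norm (g x))\<^sup>2 \<partial>muA \<alpha>) - (\<integral>x. (u x - meanA \<alpha> u)\<^sup>2 \<partial>muA \<alpha>)"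

definition rhsA :: "('n::finite \<Rightarrow> real) \<Rightarrow> (real^'n \<Rightarrow> real) \<Rightarrow> (real^'n \<Rightarrow> real^'n) \<Rightarrow> real" where
  "rhsA \<alpha> u g = (1/2) * (\<integral>x. (norm (g x - momA \<alpha> u))\<^sup>2 \<partial>muA \<alpha>)"

end

theory Submission
  imports Defs "HOL-Probability.Distributions" "HOL-Real_Asymp.Real_Asymp"
begin

text \<open>The measure is a product of one-dimensional measures with densities proportional to
  \<open>t\<^sup>a exp (- t\<^sup>2 / 2)\<close>. In a coordinate with \<open>a > 0\<close> the Poincare inequality holds with
  spectral gap 2 and no boundary condition is needed; in a Gaussian coordinate (\<open>a = 0\<close>) the gap 2
  holds on the orthogonal complement of the affine functions. Splitting with respect to the commuting
  projections onto the eigenvalues 0, 1 and \<open>\<ge> 2\<close> of the individual coordinates gives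
  \<open>E |\<nabla>w|\<^sup>2 \<ge> 2 Var w - \<Sum> (E x\<^sub>i w)\<^sup>2\<close>, the sum ranging over the Gaussian coordinates, since an
  eigenvalue of the product is a sum of eigenvalues of the factors. Applied to
  \<open>w = \<phi> + \<Sum> c\<^sub>i x\<^sub>i\<close>, where \<open>c\<close> is the moment vector of \<open>\<phi>\<close> and \<open>i\<close> ranges over the
  coordinates with \<open>\<alpha>\<^sub>i > 0\<close>, this is the claim for \<open>\<phi>\<close> up to nonnegative terms. Both sides are
  continuous for the norm of the completion. Equality holds for \<open>x\<^sub>i\<^sup>2\<close> in a Gaussian
  coordinate, because it has eigenvalue exactly 2.\<close>

subsection \<open>One-dimensional weights and primitives\<close>

text \<open>Doubling the inequality and expanding |g - c|^2 turns it into E|g|^2 + 2 b.c - |c|^2 >=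
  2 Var u, where b is the mean of g and c the moment vector; the factor 1/2 is thus what a spectral
  gap of 2 can pay for. The obstacle is a coordinate with \<alpha> i > 0: moving the derivative onto
  the weight leaves a factor t - a/t instead of t, so no identity ties b_i to c_i. A linear
  perturbation may be added there because the half-line operator f'' + (a/t - t) f' has the
  eigenvalues 0, 2, 4, ..., with t^2 - (1 + a) at level 2, so that nothing is lost at level 1. In a
  Gaussian coordinate level 1 is occupied by t itself, and b_i = c_i makes the loss c_i^2 come out
  even. Only the projections onto levels 0 and 1 are built, as integrals over one coordinate. The
  remainder is controlled by one-dimensional inequalities proved through explicit primitives, so no
  Hermite or Laguerre expansion enters.\<close>

text \<open>For \<open>a > 0\<close> the weight is extended by zero to \<open>t \<le> 0\<close>, so that all one-dimensional
  integrals are taken over the whole line.\<close>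

definition wt :: "real \<Rightarrow> real \<Rightarrow> real" where
  "wt a t = (if a = 0 then exp (- t\<^sup>2 / 2) else if t \<le> 0 then 0 else t powr a * exp (- t\<^sup>2 / 2))"

lemma wt_nonneg: "0 \<le> wt a t"
  by (simp add: wt_def)

lemma wt_zero: "wt 0 t = exp (- t\<^sup>2 / 2)"
  by (simp add: wt_def)

lemma continuous_wt: "0 \<le> a \<Longrightarrow> continuous_on UNIV (wt a)"
proof -
  assume "0 \<le> a"
  have "wt a = (\<lambda>t. max t 0 powr a * exp (- t\<^sup>2 / 2))" if "a > 0"
    using that by (auto simp: wt_def fun_eq_iff max_def)
  moreover have "continuous_on UNIV (\<lambda>t::real. max t 0 powr a * exp (- t\<^sup>2 / 2))" if "a > 0"
    using that by (intro continuous_intros continuous_on_powr') auto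
  moreover have "continuous_on UNIV (wt 0)"
    unfolding wt_zero[abs_def] by (intro continuous_intros) auto
  ultimately show ?thesis using \<open>0 \<le> a\<close> by (cases "a = 0") auto
qed

lemma wt_measurable [measurable]: "wt a \<in> borel_measurable borel"
  unfolding wt_def by measurable

text \<open>Rounding the exponent up to an integer for t > 1, and bounding t^a by 1 on (0, 1], makes
  the Gaussian absolute moments available for every real a.\<close>

lemma wt_le: "0 \<le> a \<Longrightarrow> wt a t \<le> (1 + \<bar>t\<bar> ^ nat \<lceil>a\<rceil>) * exp (- t\<^sup>2 / 2)"
proof -
  assume a: "0 \<le> a"
  have "t powr a \<le> 1 + \<bar>t\<bar> ^ nat \<lceil>a\<rceil>" if "t > 0"
  proof (cases "t \<le> 1")
    case True
    then have "t powr a \<le> 1" using that a by (simp add: powr_le1)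
    then show ?thesis by (simp add: add_increasing2)
  next
    case False
    then have "t powr a \<le> t powr real (nat \<lceil>a\<rceil>)" using a by (intro powr_mono) linarith+
    then show ?thesis using that by (simp add: powr_realpow)
  qed
  then show ?thesis unfolding wt_def by (auto intro!: mult_right_mono)
qed

lemma integrable_gauss_abs_power: "integrable lborel (\<lambda>t::real. exp (- t\<^sup>2 / 2) * \<bar>t\<bar> ^ k)"
proof -
  have "integrable lborel (\<lambda>t::real. sqrt (2 * pi) * (std_normal_density t * \<bar>t\<bar> ^ k))"
    by (intro integrable_mult_right integrable_std_normal_moment_abs)
  then show ?thesis by (simp add: std_normal_density_def)
qed

lemma integrable_wt_abs_power:
  assumes "0 \<le> a" shows "integrable lborel (\<lambda>t. wt a t * \<bar>t\<bar> ^ k)"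
proof (rule Bochner_Integration.integrable_bound)
  show "integrable lborel (\<lambda>t::real. exp (- t\<^sup>2 / 2) * \<bar>t\<bar> ^ k + exp (- t\<^sup>2 / 2) * \<bar>t\<bar> ^ (nat \<lceil>a\<rceil> + k))"
    by (intro Bochner_Integration.integrable_add integrable_gauss_abs_power)
  show "AE t in lborel. norm (wt a t * \<bar>t\<bar> ^ k) \<le> norm (exp (- t\<^sup>2 / 2) * \<bar>t\<bar> ^ k + exp (- t\<^sup>2 / 2) * \<bar>t\<bar> ^ (nat \<lceil>a\<rceil> + k))"
  proof (rule AE_I2)
    fix t :: real
    have "wt a t * \<bar>t\<bar> ^ k \<le> (1 + \<bar>t\<bar> ^ nat \<lceil>a\<rceil>) * exp (- t\<^sup>2 / 2) * \<bar>t\<bar> ^ k"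
      by (intro mult_right_mono wt_le assms) auto
    then show "norm (wt a t * \<bar>t\<bar> ^ k) \<le> norm (exp (- t\<^sup>2 / 2) * \<bar>t\<bar> ^ k + exp (- t\<^sup>2 / 2) * \<bar>t\<bar> ^ (nat \<lceil>a\<rceil> + k))"
      by (simp add: wt_nonneg abs_mult algebra_simps power_add)
  qed
qed measurable

text \<open>Growth is measured by powers of 1 + |t| because such bounds multiply; the binomial
  theorem reduces them to absolute moments.\<close>

lemma integrable_wt_growth:
  assumes a: "0 \<le> a" and f [measurable]: "f \<in> borel_measurable borel"
    and b: "\<And>t. \<bar>f t\<bar> \<le> C * (1 + \<bar>t\<bar>) ^ k"
  shows "integrable lborel (\<lambda>t. wt a t * f t)"
proof (rule Bochner_Integration.integrable_bound)
  show "integrable lborel (\<lambda>t. C * (\<Sum>j\<le>k. real (k choose j) * (wt a t * \<bar>t\<bar> ^ j)))"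
    by (intro integrable_mult_right Bochner_Integration.integrable_sum integrable_wt_abs_power a)
  show "AE t in lborel. norm (wt a t * f t) \<le> norm (C * (\<Sum>j\<le>k. real (k choose j) * (wt a t * \<bar>t\<bar> ^ j)))"
  proof (rule AE_I2)
    fix t :: real
    have "(1 + \<bar>t\<bar>) ^ k = (\<Sum>j\<le>k. real (k choose j) * \<bar>t\<bar> ^ j)"
      by (subst add.commute) (simp add: binomial_ring)
    then have "C * (\<Sum>j\<le>k. real (k choose j) * (wt a t * \<bar>t\<bar> ^ j)) = wt a t * (C * (1 + \<bar>t\<bar>) ^ k)"
      by (simp add: sum_distrib_left mult_ac)
    moreover have "\<bar>wt a t * f t\<bar> \<le> wt a t * (C * (1 + \<bar>t\<bar>) ^ k)"
      unfolding abs_mult abs_of_nonneg[OF wt_nonneg] by (intro mult_left_mono b wt_nonneg)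
    ultimately show "norm (wt a t * f t) \<le> norm (C * (\<Sum>j\<le>k. real (k choose j) * (wt a t * \<bar>t\<bar> ^ j)))"
      unfolding real_norm_def by linarith
  qed
qed measurable

text \<open>W is minus the integral of f over the half-line to the left of x. It tends to 0 on the
  left by integrability, and on the right because the total integral is 0.\<close>

lemma exists_vanishing_primitive:
  fixes f :: "real \<Rightarrow> real"
  assumes cont: "continuous_on UNIV f" and int: "integrable lborel f" and zero: "(\<integral>t. f t \<partial>lborel) = 0"
  obtains W where "\<And>x. (W has_real_derivative - f x) (at x)" "(W \<longlongrightarrow> 0) at_top" "(W \<longlongrightarrow> 0) at_bot"
proof -
  obtain F where F: "\<And>x. (F has_real_derivative f x) (at x)"
    using einterval_antiderivative[of "-\<infinity>" \<infinity> f] cont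
    by (auto simp: continuous_on_eq_continuous_at has_real_derivative_iff_has_vector_derivative)
  define I where "I y = (\<integral>t. indicator {..y} t *\<^sub>R f t \<partial>lborel)" for y
  have le: "I y - I x = F y - F x" if "x \<le> y" for x y
  proof -
    have "I y - I x = (\<integral>t. indicator {..y} t *\<^sub>R f t - indicator {..x} t *\<^sub>R f t \<partial>lborel)"
      unfolding I_def by (subst Bochner_Integration.integral_diff)
        (auto intro!: integrable_mult_indicator int simp del: real_scaleR_def)
    also have "\<dots> = (\<integral>t. f t * indicator {x..y} t \<partial>lborel)"
    proof (rule integral_cong_AE)
      show "AE t in lborel. indicator {..y} t *\<^sub>R f t - indicator {..x} t *\<^sub>R f t = f t * indicator {x..y} t"
        using AE_lborel_singleton[of x] by eventually_elim (use that in \<open>auto simp: indicator_def\<close>)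
    qed (use int in measurable)
    also have "\<dots> = F y - F x"
      by (rule integral_FTC_Icc_real[OF that F]) (use cont in \<open>auto simp: continuous_on_eq_continuous_at\<close>)
    finally show ?thesis .
  qed
  have eq: "I y = I 0 - F 0 + F y" for y
    using le[of 0 y] le[of y 0] by (cases "0 \<le> y") auto
  have top: "(I \<longlongrightarrow> 0) at_top"
    using tendsto_integral_at_top[OF _ int] unfolding I_def[abs_def] zero by simp
  \<comment> \<open>The limit at -infinity is read off from the reflected function at +infinity;
    mean zero turns its partial integral into \<open>- I (- y)\<close>.\<close>
  have "((\<lambda>y. \<integral>t. indicator {..y} t *\<^sub>R f (- t) \<partial>lborel) \<longlongrightarrow> (\<integral>t. f (- t) \<partial>lborel)) at_top"
    by (rule tendsto_integral_at_top) (use lborel_integrable_real_affine[OF int, of "-1" 0] in simp_all)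
  moreover have "(\<integral>t. f (- t) \<partial>lborel) = 0"
    using lborel_integral_real_affine[of "-1" f 0] zero by simp
  moreover have "(\<integral>t. indicator {..y} t *\<^sub>R f (- t) \<partial>lborel) = - I (- y)" for y
  proof -
    have "(\<integral>t. indicator {..y} t *\<^sub>R f (- t) \<partial>lborel) = (\<integral>t. indicator {-y..} t *\<^sub>R f t \<partial>lborel)"
      by (subst lborel_integral_real_affine[of "-1" _ 0]) (auto simp: indicator_def intro!: Bochner_Integration.integral_cong)
    also have "\<dots> = (\<integral>t. f t - indicator {..-y} t *\<^sub>R f t \<partial>lborel)"
    proof (rule integral_cong_AE)
      show "AE t in lborel. indicator {-y..} t *\<^sub>R f t = f t - indicator {..-y} t *\<^sub>R f t"
        using AE_lborel_singleton[of "-y"] by eventually_elim (auto simp: indicator_def)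
    qed (use int in measurable)
    also have "\<dots> = - I (- y)"
      unfolding I_def by (subst Bochner_Integration.integral_diff)
        (auto intro!: integrable_mult_indicator int simp: zero simp del: real_scaleR_def)
    finally show ?thesis .
  qed
  ultimately have "((\<lambda>y. - (- I (- y))) \<longlongrightarrow> - 0) at_top"
    by (intro tendsto_minus) simp
  then have bot: "(I \<longlongrightarrow> 0) at_bot"
    by (simp add: filterlim_at_bot_mirror)
  show ?thesis
  proof (rule that[of "\<lambda>y. - I y"])
    show "((\<lambda>y. - I y) has_real_derivative - f x) (at x)" for x
      by (subst eq[abs_def]) (auto intro!: derivative_eq_intros F)
  qed (use tendsto_minus[OF top] tendsto_minus[OF bot] in simp_all)
qed

section \<open>Comparison and limit arguments on unbounded intervals\<close>

lemma nonneg_if_deriv_nonpos_tendsto_0: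
  fixes D :: "real \<Rightarrow> real"
  assumes "\<And>x. x \<ge> a \<Longrightarrow> (D has_real_derivative D' x) (at x)" "\<And>x. x \<ge> a \<Longrightarrow> D' x \<le> 0"
    and "(D \<longlongrightarrow> 0) at_top" and "x \<ge> a"
  shows "0 \<le> D x"
proof (rule tendsto_upperbound[OF assms(3)])
  show "\<forall>\<^sub>F y in at_top. D y \<le> D x"
    using eventually_ge_at_top[of x]
  proof eventually_elim
    case (elim y)
    have "\<exists>d. (D has_real_derivative d) (at z) \<and> d \<le> 0" if "x \<le> z" for z
      using assms(1,2)[of z] \<open>x \<ge> a\<close> that by auto
    then show ?case
      by (rule DERIV_nonpos_imp_nonincreasing[OF elim])
  qed
qed simp

text \<open>Both B - W and B + W are nonincreasing with limit 0, hence nonnegative: the bound on the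
  derivatives is integrated from infinity.\<close>

lemma abs_le_if_deriv_dominated_at_top:
  fixes W B :: "real \<Rightarrow> real"
  assumes W: "\<And>x. x \<ge> a \<Longrightarrow> (W has_real_derivative W' x) (at x)" and "(W \<longlongrightarrow> 0) at_top"
    and B: "\<And>x. x \<ge> a \<Longrightarrow> (B has_real_derivative B' x) (at x)" and "(B \<longlongrightarrow> 0) at_top"
    and le: "\<And>x. x \<ge> a \<Longrightarrow> \<bar>W' x\<bar> \<le> - B' x" and x: "x \<ge> a"
  shows "\<bar>W x\<bar> \<le> B x"
proof -
  have "0 \<le> B x - W x"
  proof (rule nonneg_if_deriv_nonpos_tendsto_0[where a=a and x=x and D="\<lambda>x. B x - W x" and D'="\<lambda>x. B' x - W' x"])
    show "((\<lambda>x. B x - W x) \<longlongrightarrow> 0) at_top" using tendsto_diff[OF assms(4,2)] by simp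
    show "B' y - W' y \<le> 0" if "y \<ge> a" for y using le[OF that] by linarith
  qed (auto intro!: derivative_eq_intros W B x)
  moreover have "0 \<le> B x + W x"
  proof (rule nonneg_if_deriv_nonpos_tendsto_0[where a=a and x=x and D="\<lambda>x. B x + W x" and D'="\<lambda>x. B' x + W' x"])
    show "((\<lambda>x. B x + W x) \<longlongrightarrow> 0) at_top" using tendsto_add[OF assms(4,2)] by simp
    show "B' y + W' y \<le> 0" if "y \<ge> a" for y using le[OF that] by linarith
  qed (auto intro!: derivative_eq_intros W B x)
  ultimately show ?thesis by linarith
qed

text \<open>Up to sign, C |x| exp(-x^2/2) is the derivative of C exp(-x^2/2), so integrating from
  infinity gains one power of x. Hence a primitive of a function of linear growth times the Gaussian
  stays bounded after division by the Gaussian. The left tail follows by reflection.\<close>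

lemma gauss_decay:
  fixes W :: "real \<Rightarrow> real"
  assumes W: "\<And>x. (W has_real_derivative W' x) (at x)" and "(W \<longlongrightarrow> 0) at_top" "(W \<longlongrightarrow> 0) at_bot"
    and le: "\<And>x. \<bar>x\<bar> \<ge> 1 \<Longrightarrow> \<bar>W' x\<bar> \<le> C * \<bar>x\<bar> * exp (- x\<^sup>2 / 2)" and x: "\<bar>x\<bar> \<ge> 1"
  shows "\<bar>W x\<bar> \<le> C * exp (- x\<^sup>2 / 2)"
proof -
  have B: "((\<lambda>x. C * exp (- x\<^sup>2 / 2)) has_real_derivative - (C * y * exp (- y\<^sup>2 / 2))) (at y)" for y
    by (auto intro!: derivative_eq_intros)
  have lim: "((\<lambda>x. C * exp (- x\<^sup>2 / 2)) \<longlongrightarrow> 0) at_top" by real_asymp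
  show ?thesis
  proof (cases "x \<ge> 1")
    case True
    have "\<bar>W' y\<bar> \<le> - (- (C * y * exp (- y\<^sup>2 / 2)))" if "y \<ge> 1" for y
      using le[of y] that by simp
    then show ?thesis
      by (rule abs_le_if_deriv_dominated_at_top[OF W assms(2) B lim _ True])
  next
    case False
    then have x1: "- x \<ge> 1" using x by linarith
    have W2: "((\<lambda>x. W (- x)) has_real_derivative - W' (- y)) (at y)" for y
      using W[of "- y"] by (simp add: DERIV_mirror)
    have lim2: "((\<lambda>x. W (- x)) \<longlongrightarrow> 0) at_top" using assms(3) by (simp add: filterlim_at_bot_mirror)
    have le2: "\<bar>- W' (- y)\<bar> \<le> - (- (C * y * exp (- y\<^sup>2 / 2)))" if "y \<ge> 1" for y
      using le[of "- y"] that by simp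
    have "\<bar>W (- (- x))\<bar> \<le> C * exp (- (- x)\<^sup>2 / 2)"
      using le2 by (rule abs_le_if_deriv_dominated_at_top[OF W2 lim2 B lim _ x1])
    then show ?thesis by simp
  qed
qed

text \<open>On each compact interval the gauge integral gives the fundamental theorem for the bare
  derivative K', and the Lebesgue integral of h dominates it. The limit is then taken in h and in
  the boundary values of K only.\<close>

lemma set_integral_nonneg_if_ge_deriv:
  fixes K h :: "real \<Rightarrow> real"
  assumes lu: "\<And>n. l n \<le> u n" "decseq l" "incseq u"
    and K: "\<And>n x. x \<in> {l n..u n} \<Longrightarrow> (K has_real_derivative K' x) (at x)"
    and le: "\<And>n x. x \<in> {l n..u n} \<Longrightarrow> K' x \<le> h x"
    and lim: "(\<lambda>n. K (l n)) \<longlonglongrightarrow> 0" "(\<lambda>n. K (u n)) \<longlonglongrightarrow> 0"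
    and int: "set_integrable lborel (\<Union>n. {l n..u n}) h"
  shows "0 \<le> (LINT x:(\<Union>n. {l n..u n})|lborel. h x)"
proof -
  have "incseq (\<lambda>n. {l n..u n})"
    using lu(2,3) unfolding incseq_def decseq_def by fastforce
  then have L: "(\<lambda>n. LINT x:{l n..u n}|lborel. h x) \<longlonglongrightarrow> (LINT x:(\<Union>n. {l n..u n})|lborel. h x)"
    by (intro set_integral_cont_up int) auto
  have "K (u n) - K (l n) \<le> (LINT x:{l n..u n}|lborel. h x)" for n
  proof -
    have i: "set_integrable lborel {l n..u n} h"
      by (rule set_integrable_subset[OF int]) auto
    have 1: "(K' has_integral (K (u n) - K (l n))) {l n..u n}"
      by (rule fundamental_theorem_of_calculus)
        (use lu(1) K[of _ n] in \<open>auto simp: has_real_derivative_iff_has_vector_derivative intro: has_vector_derivative_at_within\<close>)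
    have 2: "(h has_integral (LINT x:{l n..u n}|lborel. h x)) {l n..u n}"
      using set_borel_integral_eq_integral[OF i] by (simp add: integrable_integral)
    show ?thesis using has_integral_le[OF 1 2] le by auto
  qed
  then show ?thesis
    using tendsto_diff[OF lim(2,1)] L by (intro LIMSEQ_le[of "\<lambda>n. K (u n) - K (l n)" "0"]) auto
qed

subsection \<open>The spectral gap in one dimension\<close>

text \<open>Duality argument: let \<open>W' = - v w\<close> vanish at both ends and put \<open>G = W / w\<close>. Then
  \<open>\<integral> v\<^sup>2 w = \<integral> v' G w\<close>, while expanding \<open>v\<close> in terms of \<open>G\<close> and \<open>G'\<close> gives
  \<open>\<integral> v\<^sup>2 w \<ge> 2 \<integral> G\<^sup>2 w\<close>. Both steps are combined into one pointwise inequality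
  \<open>K' \<le> (v'\<^sup>2 - 2 v\<^sup>2) w\<close>, in which \<open>K\<close> collects the boundary terms and the difference of the two
  sides is a sum of squares. In the Gaussian case the second step uses the same device once more, with
  \<open>U' = - W\<close> and \<open>H = U / w\<close>, which is where orthogonality of \<open>v\<close> to \<open>t\<close> enters.\<close>

lemma gauss_poincare_orthogonal:
  fixes v v' :: "real \<Rightarrow> real"
  assumes v: "\<And>t. (v has_real_derivative v' t) (at t)" and cv': "continuous_on UNIV v'"
    and bv': "\<And>t. \<bar>v' t\<bar> \<le> C" and bv: "\<And>t. \<bar>v t\<bar> \<le> C * (1 + \<bar>t\<bar>)"
    and m0: "(\<integral>t. wt 0 t * v t \<partial>lborel) = 0" and m1: "(\<integral>t. wt 0 t * (t * v t) \<partial>lborel) = 0"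
  shows "2 * (\<integral>t. wt 0 t * (v t)\<^sup>2 \<partial>lborel) \<le> (\<integral>t. wt 0 t * (v' t)\<^sup>2 \<partial>lborel)"
proof -
  let ?e = "\<lambda>t::real. exp (- t\<^sup>2 / 2)"
  have cv: "continuous_on UNIV v" using v by (meson DERIV_isCont continuous_at_imp_continuous_on)
  have [measurable]: "v \<in> borel_measurable borel" "v' \<in> borel_measurable borel"
    using cv cv' by (auto intro: borel_measurable_continuous_onI)
  have C0: "0 \<le> C" using bv'[of 0] by linarith
  have i0: "integrable lborel (\<lambda>t. wt 0 t * v t)"
    by (rule integrable_wt_growth[where C=C and k=1]) (use bv in auto)
  have i1: "integrable lborel (\<lambda>t. wt 0 t * (t * v t))"
  proof (rule integrable_wt_growth[where C=C and k=2])
    fix t :: real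
    have "\<bar>t\<bar> * \<bar>v t\<bar> \<le> (1 + \<bar>t\<bar>) * (C * (1 + \<bar>t\<bar>))" by (intro mult_mono bv) auto
    then show "\<bar>t * v t\<bar> \<le> C * (1 + \<bar>t\<bar>)\<^sup>2" by (simp add: abs_mult power2_eq_square mult_ac)
  qed auto
  have i2: "integrable lborel (\<lambda>t. wt 0 t * (v t)\<^sup>2)"
  proof (rule integrable_wt_growth[where C="C\<^sup>2" and k=2])
    fix t :: real
    have "\<bar>v t\<bar>\<^sup>2 \<le> (C * (1 + \<bar>t\<bar>))\<^sup>2" by (intro power_mono bv) auto
    then show "\<bar>(v t)\<^sup>2\<bar> \<le> C\<^sup>2 * (1 + \<bar>t\<bar>)\<^sup>2" by (simp add: power_mult_distrib)
  qed auto
  have i3: "integrable lborel (\<lambda>t. wt 0 t * (v' t)\<^sup>2)"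
  proof (rule integrable_wt_growth[where C="C\<^sup>2" and k=0])
    fix t :: real
    have "\<bar>v' t\<bar>\<^sup>2 \<le> C\<^sup>2" by (intro power_mono bv') auto
    then show "\<bar>(v' t)\<^sup>2\<bar> \<le> C\<^sup>2 * (1 + \<bar>t\<bar>) ^ 0" by simp
  qed auto
  obtain W where W: "\<And>x. (W has_real_derivative - (?e x * v x)) (at x)"
    and Wlim: "(W \<longlongrightarrow> 0) at_top" "(W \<longlongrightarrow> 0) at_bot"
    by (rule exists_vanishing_primitive[OF _ i0 m0])
       (use cv in \<open>auto simp: wt_zero intro!: continuous_intros\<close>)
  obtain Y where Y: "\<And>x. (Y has_real_derivative - (?e x * (x * v x))) (at x)"
    and Ylim: "(Y \<longlongrightarrow> 0) at_top" "(Y \<longlongrightarrow> 0) at_bot"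
    by (rule exists_vanishing_primitive[OF _ i1 m1])
       (use cv in \<open>auto simp: wt_zero intro!: continuous_intros\<close>)
  \<comment> \<open>A primitive of - W, obtained by parts from Y. In this form the vanishing at both
    ends is visible: Y vanishes there because of \<open>m1\<close>, and x W because of the Gaussian
    decay of W.\<close>
  define U where "U x = Y x - x * W x" for x
  have U: "(U has_real_derivative - W x) (at x)" for x
    unfolding U_def by (auto intro!: derivative_eq_intros Y W simp: algebra_simps)
  have Wb: "\<bar>W x\<bar> \<le> 2 * C * ?e x" if "\<bar>x\<bar> \<ge> 1" for x
  proof (rule gauss_decay[OF W Wlim _ that])
    fix y :: real assume "1 \<le> \<bar>y\<bar>"
    then have "C * (1 + \<bar>y\<bar>) \<le> C * (2 * \<bar>y\<bar>)" using C0 by (intro mult_left_mono) auto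
    then have "\<bar>v y\<bar> \<le> 2 * C * \<bar>y\<bar>" using bv[of y] by linarith
    then show "\<bar>- (?e y * v y)\<bar> \<le> 2 * C * \<bar>y\<bar> * ?e y" by (simp add: abs_mult)
  qed
  have xWb: "\<bar>x * W x\<bar> \<le> 2 * C * (\<bar>x\<bar> * ?e x)" if "\<bar>x\<bar> \<ge> 1" for x
    using mult_left_mono[OF Wb[OF that], of "\<bar>x\<bar>"] by (simp add: abs_mult mult_ac)
  have ev_top: "\<forall>\<^sub>F x::real in at_top. \<bar>x\<bar> \<ge> 1" using eventually_ge_at_top[of 1] by eventually_elim auto
  have ev_bot: "\<forall>\<^sub>F x::real in at_bot. \<bar>x\<bar> \<ge> 1" using eventually_le_at_bot[of "-1"] by eventually_elim auto
  have "((\<lambda>x. x * W x) \<longlongrightarrow> 0) at_top"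
    by (rule Lim_null_comparison[where g="\<lambda>x. 2 * C * (\<bar>x\<bar> * ?e x)"])
       (rule eventually_mono[OF ev_top], simp only: real_norm_def, erule xWb, real_asymp)
  then have Utop: "(U \<longlongrightarrow> 0) at_top" unfolding U_def[abs_def] using tendsto_diff[OF Ylim(1)] by fastforce
  have "((\<lambda>x. x * W x) \<longlongrightarrow> 0) at_bot"
    by (rule Lim_null_comparison[where g="\<lambda>x. 2 * C * (\<bar>x\<bar> * ?e x)"])
       (rule eventually_mono[OF ev_bot], simp only: real_norm_def, erule xWb, real_asymp)
  then have Ubot: "(U \<longlongrightarrow> 0) at_bot" unfolding U_def[abs_def] using tendsto_diff[OF Ylim(2)] by fastforce
  have Ub: "\<bar>U x\<bar> \<le> 2 * C * ?e x" if "\<bar>x\<bar> \<ge> 1" for x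
  proof (rule gauss_decay[OF U Utop Ubot _ that])
    fix y :: real assume y: "1 \<le> \<bar>y\<bar>"
    have "2 * C * ?e y * 1 \<le> 2 * C * ?e y * \<bar>y\<bar>" using C0 y by (intro mult_left_mono) auto
    then show "\<bar>- W y\<bar> \<le> 2 * C * \<bar>y\<bar> * ?e y" using Wb[OF y] by (simp add: mult_ac)
  qed
  define G where "G x = W x / ?e x" for x
  define H where "H x = U x / ?e x" for x
  have G: "(G has_real_derivative x * G x - v x) (at x)" for x
    unfolding G_def by (auto intro!: derivative_eq_intros W simp: field_simps)
  have H: "(H has_real_derivative x * H x - G x) (at x)" for x
    unfolding H_def G_def by (auto intro!: derivative_eq_intros U simp: field_simps)
  have We: "W x = G x * ?e x" and Ue: "U x = H x * ?e x" for x by (simp_all add: G_def H_def)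
  have Gb: "\<bar>G x\<bar> \<le> 2 * C" and Hb: "\<bar>H x\<bar> \<le> 2 * C" if "\<bar>x\<bar> \<ge> 1" for x
    using Wb[OF that] Ub[OF that] unfolding We Ue by (simp_all add: abs_mult)
  \<comment> \<open>Each term is the boundary term of one identity for integrals against
    exp(-x^2/2). The term 4 v G belongs to \<integral> v' G = \<integral> v^2, and 4 G H to
    \<integral> G' H = \<integral> G^2. The terms - 2 x G^2 and - 2 x H^2 belong to \<integral> v^2
    = \<integral> G'^2 + \<integral> G^2 and \<integral> G^2 = \<integral> H'^2 + \<integral> H^2.
    The squares left over are those of v' - 2 G, G' - H and H'; all of them vanish for v = x^2 - 1,
    G = x, H = 1, which fixes the coefficients.\<close>
  define K where "K x = (4 * v x * G x + 4 * G x * H x - 2 * x * (H x)\<^sup>2 - 2 * x * (G x)\<^sup>2) * ?e x" for x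
  define K' where "K' x = (4 * v' x * G x + 4 * v x * (x * G x - v x)
      + 4 * (x * G x - v x) * H x + 4 * G x * (x * H x - G x)
      - 2 * (H x)\<^sup>2 - 4 * x * H x * (x * H x - G x) - 2 * (G x)\<^sup>2 - 4 * x * G x * (x * G x - v x)) * ?e x
      + (4 * v x * G x + 4 * G x * H x - 2 * x * (H x)\<^sup>2 - 2 * x * (G x)\<^sup>2) * (- x * ?e x)" for x
  have K: "(K has_real_derivative K' x) (at x)" for x
    unfolding K_def K'_def
    by (auto intro!: derivative_eq_intros v G H simp: algebra_simps power2_eq_square)
  have slack: "?e x * (v' x)\<^sup>2 - 2 * (?e x * (v x)\<^sup>2) - K' x
      = ?e x * ((v' x - 2 * G x)\<^sup>2 + 2 * (x * G x - v x - H x)\<^sup>2 + 2 * (x * H x - G x)\<^sup>2)" for x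
    unfolding K'_def by (simp add: algebra_simps power2_eq_square)
  have K'le: "K' x \<le> ?e x * (v' x)\<^sup>2 - 2 * (?e x * (v x)\<^sup>2)" for x
  proof -
    have "0 \<le> ?e x * ((v' x - 2 * G x)\<^sup>2 + 2 * (x * G x - v x - H x)\<^sup>2 + 2 * (x * H x - G x)\<^sup>2)"
      by (intro mult_nonneg_nonneg) auto
    then show ?thesis using slack[of x] by linarith
  qed
  \<comment> \<open>The four terms add up to 24 C^2 (1 + |x|); 100 is a generous round constant,
    since only the decay of K matters.\<close>
  have Kb: "\<bar>K x\<bar> \<le> 100 * C\<^sup>2 * (1 + \<bar>x\<bar>) * ?e x" if "\<bar>x\<bar> \<ge> 1" for x
  proof -
    have g: "\<bar>G x\<bar> \<le> 2 * C" and h: "\<bar>H x\<bar> \<le> 2 * C" using Gb Hb that by auto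
    have "\<bar>v x * G x\<bar> \<le> C * (1 + \<bar>x\<bar>) * (2 * C)"
      unfolding abs_mult by (intro mult_mono bv g) (use C0 in auto)
    moreover have "\<bar>G x * H x\<bar> \<le> 2 * C * (2 * C)"
      unfolding abs_mult by (intro mult_mono h g) (use C0 in auto)
    moreover have "(H x)\<^sup>2 \<le> (2 * C)\<^sup>2" "(G x)\<^sup>2 \<le> (2 * C)\<^sup>2"
      using h g C0 by (intro abs_le_square_iff[THEN iffD1]; simp)+
    then have "\<bar>x * (H x)\<^sup>2\<bar> \<le> \<bar>x\<bar> * (2 * C)\<^sup>2" "\<bar>x * (G x)\<^sup>2\<bar> \<le> \<bar>x\<bar> * (2 * C)\<^sup>2"
      unfolding abs_mult by (intro mult_left_mono; simp)+
    ultimately have "\<bar>4 * v x * G x + 4 * G x * H x - 2 * x * (H x)\<^sup>2 - 2 * x * (G x)\<^sup>2\<bar>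
       \<le> 4 * (C * (1 + \<bar>x\<bar>) * (2 * C)) + 4 * (2 * C * (2 * C)) + 2 * (\<bar>x\<bar> * (2 * C)\<^sup>2) + 2 * (\<bar>x\<bar> * (2 * C)\<^sup>2)"
      by linarith
    also have "\<dots> \<le> 100 * C\<^sup>2 * (1 + \<bar>x\<bar>)"
      by (simp add: power2_eq_square algebra_simps) (use C0 mult_nonneg_nonneg[of "C * C" "\<bar>x\<bar>"] in simp)
    finally show ?thesis unfolding K_def abs_mult by (simp add: mult_right_mono)
  qed
  have Ktop: "(K \<longlongrightarrow> 0) at_top"
    by (rule Lim_null_comparison[where g="\<lambda>x. 100 * C\<^sup>2 * (1 + \<bar>x\<bar>) * ?e x"])
       (rule eventually_mono[OF ev_top], simp only: real_norm_def, erule Kb, real_asymp)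
  have Kbot: "(K \<longlongrightarrow> 0) at_bot"
    by (rule Lim_null_comparison[where g="\<lambda>x. 100 * C\<^sup>2 * (1 + \<bar>x\<bar>) * ?e x"])
       (rule eventually_mono[OF ev_bot], simp only: real_norm_def, erule Kb, real_asymp)
  have ints: "integrable lborel (\<lambda>x. ?e x * (v' x)\<^sup>2 - 2 * (?e x * (v x)\<^sup>2))"
    using i2 i3 by (simp add: wt_zero)
  have U_eq: "(\<Union>n. {- real n..real n}) = UNIV"
  proof -
    have "\<exists>n. - real n \<le> x \<and> x \<le> real n" for x
      using real_arch_simple[of "\<bar>x\<bar>"] by (metis abs_le_iff minus_le_iff)
    then show ?thesis by auto
  qed
  have "0 \<le> (LINT x:(\<Union>n. {- real n..real n})|lborel. ?e x * (v' x)\<^sup>2 - 2 * (?e x * (v x)\<^sup>2))"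
  proof (rule set_integral_nonneg_if_ge_deriv[OF _ _ _ K K'le])
    show "(\<lambda>n. K (- real n)) \<longlonglongrightarrow> 0"
      by (rule filterlim_compose[OF Kbot]) real_asymp
    show "(\<lambda>n. K (real n)) \<longlonglongrightarrow> 0"
      by (rule filterlim_compose[OF Ktop]) real_asymp
  qed (use ints in \<open>auto simp: U_eq set_integrable_def decseq_def incseq_def\<close>)
  also have "\<dots> = (\<integral>x. wt 0 x * (v' x)\<^sup>2 \<partial>lborel) - 2 * (\<integral>x. wt 0 x * (v x)\<^sup>2 \<partial>lborel)"
    using i2 i3 by (simp add: U_eq set_lebesgue_integral_def wt_zero)
  finally show ?thesis by simp
qed

text \<open>Since t exp(-t^2/2) is minus the derivative of exp(-t^2/2), the difference of the two
  integrands is the derivative of v exp(-t^2/2), which vanishes at both ends by the growth bound on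
  v.\<close>

lemma gauss_integral_by_parts:
  fixes v v' :: "real \<Rightarrow> real"
  assumes v: "\<And>t. (v has_real_derivative v' t) (at t)" and cv': "continuous_on UNIV v'"
    and bv': "\<And>t. \<bar>v' t\<bar> \<le> C" and bv: "\<And>t. \<bar>v t\<bar> \<le> C * (1 + \<bar>t\<bar>)"
  shows "(\<integral>t. wt 0 t * v' t \<partial>lborel) = (\<integral>t. wt 0 t * (t * v t) \<partial>lborel)"
proof -
  let ?e = "\<lambda>t::real. exp (- t\<^sup>2 / 2)"
  have cv: "continuous_on UNIV v" using v by (meson DERIV_isCont continuous_at_imp_continuous_on)
  have [measurable]: "v \<in> borel_measurable borel" "v' \<in> borel_measurable borel"
    using cv cv' by (auto intro: borel_measurable_continuous_onI)
  have i1: "integrable lborel (\<lambda>t. wt 0 t * (t * v t))"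
  proof (rule integrable_wt_growth[where C=C and k=2])
    fix t :: real
    have "\<bar>t\<bar> * \<bar>v t\<bar> \<le> (1 + \<bar>t\<bar>) * (C * (1 + \<bar>t\<bar>))" by (intro mult_mono bv) auto
    then show "\<bar>t * v t\<bar> \<le> C * (1 + \<bar>t\<bar>)\<^sup>2" by (simp add: abs_mult power2_eq_square mult_ac)
  qed auto
  have i3: "integrable lborel (\<lambda>t. wt 0 t * v' t)"
    by (rule integrable_wt_growth[where C=C and k=0]) (use bv' in auto)
  define K' where "K' t = v' t * ?e t - v t * (t * ?e t)" for t
  have K: "((\<lambda>t. v t * ?e t) has_real_derivative K' t) (at t)" for t
    unfolding K'_def by (auto intro!: derivative_eq_intros v simp: algebra_simps power2_eq_square)
  have Kb: "norm (v x * ?e x) \<le> C * (1 + \<bar>x\<bar>) * ?e x" for x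
    unfolding norm_mult using bv[of x] by (auto intro!: mult_right_mono)
  have Ktop: "((\<lambda>t. v t * ?e t) \<longlongrightarrow> 0) at_top"
    by (rule Lim_null_comparison[OF always_eventually[OF allI[OF Kb]]]) real_asymp
  have Kbot: "((\<lambda>t. v t * ?e t) \<longlongrightarrow> 0) at_bot"
    by (rule Lim_null_comparison[OF always_eventually[OF allI[OF Kb]]]) real_asymp
  have int: "integrable lborel K'"
    using i1 i3 unfolding K'_def[abs_def] by (simp add: wt_zero mult_ac)
  have "(LBINT x=-\<infinity>..\<infinity>. K' x) = 0 - 0"
  proof (rule interval_integral_FTC_integrable[where F="\<lambda>t. v t * ?e t"])
    show "set_integrable lborel (einterval (-\<infinity>) \<infinity>) K'"
      using int by (simp add: set_integrable_def)
    show "(((\<lambda>t. v t * ?e t) \<circ> real_of_ereal) \<longlongrightarrow> 0) (at_right (- \<infinity>))"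
      using Kbot by (simp add: ereal_tendsto_simps)
    show "(((\<lambda>t. v t * ?e t) \<circ> real_of_ereal) \<longlongrightarrow> 0) (at_left \<infinity>)"
      using Ktop by (simp add: ereal_tendsto_simps)
    show "isCont K' x" for x
      unfolding K'_def[abs_def] using cv cv' by (intro continuous_intros) (auto simp: continuous_on_eq_continuous_at)
  qed (use K in \<open>auto simp: has_real_derivative_iff_has_vector_derivative\<close>)
  then have "(\<integral>t. K' t \<partial>lborel) = 0"
    by (simp add: interval_lebesgue_integral_def set_lebesgue_integral_def)
  then have "(\<integral>t. wt 0 t * v' t - wt 0 t * (t * v t) \<partial>lborel) = 0"
    by (simp add: K'_def[abs_def] wt_zero mult_ac)
  then show ?thesis using i1 i3 by simp
qed

lemma wt_pos: "0 < a \<Longrightarrow> 0 < t \<Longrightarrow> wt a t = t powr a * exp (- t\<^sup>2 / 2)"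
  by (simp add: wt_def)

lemma DERIV_wt:
  assumes "0 < a" "0 < t"
  shows "(wt a has_real_derivative (a / t - t) * wt a t) (at t)"
proof -
  have "((\<lambda>t. t powr a * exp (- t\<^sup>2 / 2)) has_real_derivative (a / t - t) * wt a t) (at t)"
    using assms by (auto intro!: derivative_eq_intros simp: wt_pos powr_diff algebra_simps)
  moreover have "\<forall>\<^sub>F s in nhds t. wt a s = s powr a * exp (- s\<^sup>2 / 2)"
    using eventually_nhds_in_open[of "{0<..}" t] assms by (auto elim!: eventually_mono simp: wt_pos)
  ultimately show ?thesis by (subst DERIV_cong_ev[OF refl _ refl]) auto
qed

text \<open>Here G / x plays the part that H has in the Gaussian case, so one primitive suffices and
  only the mean of v has to vanish. The extremal is v = x^2 - (1 + a) with G = x, for which v' = 2 G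
  and G' = G / x.\<close>

lemma halfline_poincare_centered:
  fixes v v' :: "real \<Rightarrow> real"
  assumes a: "0 < a"
    and v: "\<And>t. (v has_real_derivative v' t) (at t)" and cv': "continuous_on UNIV v'"
    and bv': "\<And>t. \<bar>v' t\<bar> \<le> C" and bv: "\<And>t. \<bar>v t\<bar> \<le> C * (1 + \<bar>t\<bar>)"
    and m0: "(\<integral>t. wt a t * v t \<partial>lborel) = 0"
  shows "2 * (\<integral>t. wt a t * (v t)\<^sup>2 \<partial>lborel) \<le> (\<integral>t. wt a t * (v' t)\<^sup>2 \<partial>lborel)"
proof -
  let ?w = "wt a"
  have cv: "continuous_on UNIV v" using v by (meson DERIV_isCont continuous_at_imp_continuous_on)
  have [measurable]: "v \<in> borel_measurable borel" "v' \<in> borel_measurable borel"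
    using cv cv' by (auto intro: borel_measurable_continuous_onI)
  have C0: "0 \<le> C" using bv'[of 0] by linarith
  have i0: "integrable lborel (\<lambda>t. ?w t * v t)"
    by (rule integrable_wt_growth[where C=C and k=1]) (use bv a in auto)
  have i2: "integrable lborel (\<lambda>t. ?w t * (v t)\<^sup>2)"
  proof (rule integrable_wt_growth[where C="C\<^sup>2" and k=2])
    fix t :: real
    have "\<bar>v t\<bar>\<^sup>2 \<le> (C * (1 + \<bar>t\<bar>))\<^sup>2" by (intro power_mono bv) auto
    then show "\<bar>(v t)\<^sup>2\<bar> \<le> C\<^sup>2 * (1 + \<bar>t\<bar>)\<^sup>2" by (simp add: power_mult_distrib)
  qed (use a in auto)
  have i3: "integrable lborel (\<lambda>t. ?w t * (v' t)\<^sup>2)"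
  proof (rule integrable_wt_growth[where C="C\<^sup>2" and k=0])
    fix t :: real
    have "\<bar>v' t\<bar>\<^sup>2 \<le> C\<^sup>2" by (intro power_mono bv') auto
    then show "\<bar>(v' t)\<^sup>2\<bar> \<le> C\<^sup>2 * (1 + \<bar>t\<bar>) ^ 0" by simp
  qed (use a in auto)
  obtain W where W: "\<And>x. (W has_real_derivative - (?w x * v x)) (at x)"
    and Wlim: "(W \<longlongrightarrow> 0) at_top" "(W \<longlongrightarrow> 0) at_bot"
    by (rule exists_vanishing_primitive[OF _ i0 m0])
       (use cv continuous_wt[of a] a in \<open>auto intro!: continuous_intros\<close>)
  \<comment> \<open>The weight is 0 to the left of the origin, so W is constant there and equal to
    its limit at -infinity. This starts the estimate of W near 0.\<close>
  have W0: "W 0 = 0"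
  proof -
    have c: "W x = W 0" if "x \<le> 0" for x
    proof (cases "x = 0")
      case False
      then have "x < 0" using that by simp
      then show ?thesis
      proof (rule DERIV_isconst_end[symmetric])
        show "continuous_on {x..0} W"
          using W by (meson DERIV_isCont continuous_at_imp_continuous_on)
        show "(W has_real_derivative 0) (at y)" if "x < y" "y < 0" for y
          using W[of y] that a by (simp add: wt_def)
      qed
    qed simp
    have "(W \<longlongrightarrow> W 0) at_bot"
      by (rule tendsto_eventually, rule eventually_mono[OF eventually_le_at_bot[of 0]]) (rule c)
    then show ?thesis using tendsto_unique[OF _ _ Wlim(2)] trivial_limit_at_bot_linorder by blast
  qed
  \<comment> \<open>Beyond R one has a / x \<le> x / 2, so minus the logarithmic derivative x - a /
    x of the weight is at least x / 2 and the weight can serve as its own comparison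
    function.\<close>
  define R where "R = 1 + 2 * a"
  have R: "x \<ge> 1" "x * (x / 2) \<le> x * (x - a / x)" if "x \<ge> R" for x
  proof -
    show x1: "x \<ge> 1" using that a by (simp add: R_def)
    have "2 * a * 1 \<le> x * x" using that a x1 by (intro mult_mono) (auto simp: R_def)
    then show "x * (x / 2) \<le> x * (x - a / x)" using x1 by (simp add: algebra_simps)
  qed
  have lim0: "((\<lambda>x::real. x powr a * exp (- x\<^sup>2 / 2)) \<longlongrightarrow> 0) at_top"
    and lim1: "((\<lambda>x::real. x * (x powr a * exp (- x\<^sup>2 / 2))) \<longlongrightarrow> 0) at_top"
    using a by real_asymp+
  have wlim: "((\<lambda>x. 4 * C * ?w x) \<longlongrightarrow> 0) at_top"
  proof -
    have "((\<lambda>x. 4 * C * (x powr a * exp (- x\<^sup>2 / 2))) \<longlongrightarrow> 0) at_top"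
      by (rule tendsto_mult_right_zero[OF lim0])
    moreover have "\<forall>\<^sub>F x in at_top. 4 * C * ?w x = 4 * C * (x powr a * exp (- x\<^sup>2 / 2))"
      using eventually_gt_at_top[of 0] by eventually_elim (simp add: wt_pos a)
    ultimately show ?thesis by (subst tendsto_cong)
  qed
  have Wb: "\<bar>W x\<bar> \<le> 4 * C * ?w x" if "x \<ge> R" for x
  proof (rule abs_le_if_deriv_dominated_at_top[OF W Wlim(1) _ wlim _ that])
    fix y assume y: "y \<ge> R"
    note y1 = R[OF y]
    show "((\<lambda>x. 4 * C * ?w x) has_real_derivative 4 * C * ((a / y - y) * ?w y)) (at y)"
      using y1 a by (intro DERIV_cmult DERIV_wt) auto
    have "\<bar>v y\<bar> \<le> C * (2 * y)"
      using bv[of y] mult_left_mono[OF _ C0, of "1 + \<bar>y\<bar>" "2 * y"] y1 by simp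
    also have "2 * y \<le> 4 * (y - a / y)"
      using y1 by (simp add: mult_le_cancel_left)
    then have "C * (2 * y) \<le> C * (4 * (y - a / y))" using C0 by (rule mult_left_mono)
    finally have "?w y * \<bar>v y\<bar> \<le> ?w y * (C * (4 * (y - a / y)))" by (rule mult_left_mono[OF _ wt_nonneg])
    then show "\<bar>- (?w y * v y)\<bar> \<le> - (4 * C * ((a / y - y) * ?w y))"
      by (simp add: abs_mult wt_nonneg algebra_simps)
  qed
  \<comment> \<open>One power of x better than the weight, which gives G = O(x) at 0. This is what
    kills the singular boundary term (1 + a) G^2 / x in K.\<close>
  have W0b: "\<bar>W x\<bar> \<le> 2 * C * x powr (a + 1)" if x: "0 < x" "x \<le> 1" for x
  proof -
    have fb: "\<bar>- (?w y * v y)\<bar> \<le> 2 * C * x powr a" if "0 < y" "y \<le> x" for y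
    proof -
      have "?w y \<le> x powr a * 1"
        unfolding wt_pos[OF a that(1)] using that a by (intro mult_mono powr_mono2) auto
      moreover have "\<bar>v y\<bar> \<le> C * 2"
        using bv[of y] mult_left_mono[OF _ C0, of "1 + \<bar>y\<bar>" "2"] that x by simp
      ultimately have "?w y * \<bar>v y\<bar> \<le> x powr a * (C * 2)" by (intro mult_mono) auto
      then show ?thesis by (simp add: abs_mult wt_nonneg mult_ac)
    qed
    obtain z where "0 < z" "z < x" "W x - W 0 = (x - 0) * (- (?w z * v z))"
      using MVT2[OF x(1) W] by blast
    then have "\<bar>W x\<bar> \<le> x * (2 * C * x powr a)"
      using fb[of z] x by (simp add: W0 abs_mult del: abs_minus)
    then show ?thesis using x by (simp add: powr_add mult_ac)
  qed
  define G where "G x = W x / ?w x" for x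
  have wp: "0 < ?w x" if "x > 0" for x using that a by (simp add: wt_pos)
  have G: "(G has_real_derivative (x - a / x) * G x - v x) (at x)" if "x > 0" for x
    unfolding G_def using wp[OF that] that
    by (auto intro!: derivative_eq_intros W DERIV_wt a simp: field_simps)
  have We: "W x = G x * ?w x" if "x > 0" for x using wp[OF that] by (simp add: G_def)
  \<comment> \<open>The second term merges two boundary terms: - 2 (x - a / x) G^2 from \<integral>
    v^2 = \<integral> G'^2 + \<integral> (1 + a / x^2) G^2, and 2 G^2 / x from integrating G G' / x
    by parts, all against the weight.\<close>
  define K where "K x = (4 * v x * G x + 2 * (G x)\<^sup>2 * ((1 + a) / x - x)) * ?w x" for x
  define K' where "K' x = (4 * v' x * G x + 4 * v x * ((x - a / x) * G x - v x)
      + 4 * G x * ((x - a / x) * G x - v x) * ((1 + a) / x - x) + 2 * (G x)\<^sup>2 * (- (1 + a) / x\<^sup>2 - 1)) * ?w x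
      + (4 * v x * G x + 2 * (G x)\<^sup>2 * ((1 + a) / x - x)) * ((a / x - x) * ?w x)" for x
  have K: "(K has_real_derivative K' x) (at x)" if "x > 0" for x
  proof -
    have q: "((\<lambda>x. (1 + a) / x - x) has_real_derivative - (1 + a) / x\<^sup>2 - 1) (at x)"
      using that by (auto intro!: derivative_eq_intros simp: power2_eq_square)
    show ?thesis
      unfolding K_def K'_def
      by (rule DERIV_cong, (rule derivative_eq_intros v G[OF that] DERIV_wt[OF a that] q refl)+)
         (simp add: algebra_simps power2_eq_square)
  qed
  have slack: "?w x * (v' x)\<^sup>2 - 2 * (?w x * (v x)\<^sup>2) - K' x
      = ?w x * ((v' x - 2 * G x)\<^sup>2 + 2 * ((x - a / x) * G x - v x - G x / x)\<^sup>2)" if "x > 0" for x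
  proof -
    \<comment> \<open>With y for 1 / x the identity is polynomial modulo x y = 1.\<close>
    define y where "y = 1 / x"
    have xy: "x * y = 1" using that by (simp add: y_def)
    have "?w x * (v' x)\<^sup>2 - 2 * (?w x * (v x)\<^sup>2) - ((4 * v' x * G x + 4 * v x * ((x - a * y) * G x - v x)
      + 4 * G x * ((x - a * y) * G x - v x) * ((1 + a) * y - x) + 2 * (G x)\<^sup>2 * (- (1 + a) * y\<^sup>2 - 1)) * ?w x
      + (4 * v x * G x + 2 * (G x)\<^sup>2 * ((1 + a) * y - x)) * ((a * y - x) * ?w x))
      = ?w x * ((v' x - 2 * G x)\<^sup>2 + 2 * ((x - a * y) * G x - v x - G x * y)\<^sup>2)"
      using xy by algebra
    then show ?thesis using that unfolding K'_def y_def
      by (simp add: power_divide)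
  qed
  have K'le: "K' x \<le> ?w x * (v' x)\<^sup>2 - 2 * (?w x * (v x)\<^sup>2)" if "x > 0" for x
  proof -
    have "0 \<le> ?w x * ((v' x - 2 * G x)\<^sup>2 + 2 * ((x - a / x) * G x - v x - G x / x)\<^sup>2)"
      by (intro mult_nonneg_nonneg wt_nonneg) auto
    then show ?thesis using slack[OF that] by linarith
  qed
  have Ktop: "(K \<longlongrightarrow> 0) at_top"
  proof (rule Lim_null_comparison)
    show "\<forall>\<^sub>F x in at_top. norm (K x) \<le> (16 * C * (C * (1 + x)) + 32 * C\<^sup>2 * (1 + a + x)) * (x powr a * exp (- x\<^sup>2 / 2))"
      using eventually_ge_at_top[of R]
    proof eventually_elim
      fix x assume x: "x \<ge> R"
      note x1 = R(1)[OF x]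
      have g: "\<bar>G x\<bar> \<le> 4 * C" using Wb[OF x] wp[of x] x1 We[of x] by (simp add: abs_mult)
      have vG: "\<bar>v x * G x\<bar> \<le> C * (1 + x) * (4 * C)"
        unfolding abs_mult by (intro mult_mono g) (use C0 x1 bv[of x] in auto)
      have "(G x)\<^sup>2 \<le> (4 * C)\<^sup>2"
        using g C0 by (intro abs_le_square_iff[THEN iffD1]) simp
      then have G2: "\<bar>(G x)\<^sup>2 * ((1 + a) / x - x)\<bar> \<le> (4 * C)\<^sup>2 * (1 + a + x)"
        unfolding abs_mult using x1 a mult_left_mono[of 1 x "1 + a"]
        by (intro mult_mono order_trans[OF abs_triangle_ineq4] add_mono) (auto simp: divide_le_eq)
      have "\<bar>4 * v x * G x + 2 * (G x)\<^sup>2 * ((1 + a) / x - x)\<bar> \<le> 16 * C * (C * (1 + x)) + 32 * C\<^sup>2 * (1 + a + x)"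
      proof -
        have "16 * C * (C * (1 + x)) + 32 * C\<^sup>2 * (1 + a + x) = 4 * (C * (1 + x) * (4 * C)) + 2 * ((4 * C)\<^sup>2 * (1 + a + x))"
          by (simp add: power2_eq_square algebra_simps)
        moreover have "4 * v x * G x = 4 * (v x * G x)" "2 * (G x)\<^sup>2 * ((1 + a) / x - x) = 2 * ((G x)\<^sup>2 * ((1 + a) / x - x))"
          by simp_all
        ultimately show ?thesis using vG G2 by linarith
      qed
      then show "norm (K x) \<le> (16 * C * (C * (1 + x)) + 32 * C\<^sup>2 * (1 + a + x)) * (x powr a * exp (- x\<^sup>2 / 2))"
        unfolding K_def real_norm_def abs_mult abs_of_nonneg[OF wt_nonneg] 
        using wt_pos[OF a, of x] x1 wt_nonneg[of a x] by (simp add: mult_right_mono)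
    qed
    show "((\<lambda>x. (16 * C * (C * (1 + x)) + 32 * C\<^sup>2 * (1 + a + x)) * (x powr a * exp (- x\<^sup>2 / 2))) \<longlongrightarrow> 0) at_top"
      (is "(?f \<longlongrightarrow> 0) at_top")
    proof -
      have "?f = (\<lambda>x. (16 * C\<^sup>2 + 32 * C\<^sup>2 * (1 + a)) * (x powr a * exp (- x\<^sup>2 / 2)) + 48 * C\<^sup>2 * (x * (x powr a * exp (- x\<^sup>2 / 2))))"
        by (auto simp: fun_eq_iff power2_eq_square algebra_simps)
      then show ?thesis
        using tendsto_add[OF tendsto_mult_right_zero[OF lim0] tendsto_mult_right_zero[OF lim1]] by simp
    qed
  qed
  \<comment> \<open>On (0, 1) the factor exp(-x^2/2) is at least exp(-1/2); dividing the bound on W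
    by the weight therefore gives |G| \<le> D x.\<close>
  define D where "D = 2 * C * exp (1 / 2)"
  have D0: "D \<ge> 0" using C0 by (simp add: D_def)
  have Kzero: "(K \<longlongrightarrow> 0) (at_right 0)"
  proof (rule Lim_null_comparison)
    show "\<forall>\<^sub>F x in at_right 0. norm (K x) \<le> 8 * C * D * x + 2 * D\<^sup>2 * (2 + a) * x"
      unfolding eventually_at_right_field
    proof (intro exI[of _ 1] conjI allI impI)
      fix x :: real assume x: "0 < x" "x < 1"
      have w1: "?w x \<le> 1" using x a by (simp add: wt_pos powr_le1 mult_le_one)
      have "exp (- 1 / 2) \<le> exp (- x\<^sup>2 / 2)" using x by (simp add: power_le_one)
      then have "x powr a * exp (- 1 / 2) \<le> ?w x" using x a by (simp add: wt_pos)
      then have "D * x * (x powr a * exp (- 1 / 2)) \<le> D * x * ?w x" using D0 x by (intro mult_left_mono) auto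
      moreover have "D * x * (x powr a * exp (- 1 / 2)) = 2 * C * x powr (a + 1)"
        using x by (simp add: D_def powr_add mult_exp_exp mult_ac flip: exp_add)
      ultimately have "\<bar>W x\<bar> \<le> D * x * ?w x" using W0b[of x] x by linarith
      then have g: "\<bar>G x\<bar> \<le> D * x" using wp[of x] x We[of x] by (simp add: abs_mult)
      have "\<bar>v x\<bar> \<le> C * 2" using bv[of x] mult_left_mono[OF _ C0, of "1 + \<bar>x\<bar>" 2] x by simp
      then have 1: "\<bar>v x * G x\<bar> \<le> C * 2 * (D * x)"
        unfolding abs_mult by (intro mult_mono g) (use C0 D0 x in auto)
      have "(G x)\<^sup>2 \<le> (D * x)\<^sup>2"
        using g D0 x by (intro abs_le_square_iff[THEN iffD1]) simp
      then have "\<bar>(G x)\<^sup>2 * ((1 + a) / x - x)\<bar> \<le> (D * x)\<^sup>2 * ((1 + a) / x + 1)"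
        unfolding abs_mult using x a
        by (intro mult_mono order_trans[OF abs_triangle_ineq4] add_mono) auto
      also have "\<dots> = D\<^sup>2 * x * (1 + a + x)" using x by (simp add: power2_eq_square field_simps)
      also have "\<dots> \<le> D\<^sup>2 * x * (2 + a)" using x by (intro mult_left_mono) auto
      finally have "\<bar>4 * v x * G x + 2 * (G x)\<^sup>2 * ((1 + a) / x - x)\<bar> \<le> 8 * C * D * x + 2 * D\<^sup>2 * (2 + a) * x"
        using 1 by (simp add: mult_ac)
      then have "\<bar>4 * v x * G x + 2 * (G x)\<^sup>2 * ((1 + a) / x - x)\<bar> * ?w x \<le> (8 * C * D * x + 2 * D\<^sup>2 * (2 + a) * x) * 1"
        by (intro mult_mono w1 wt_nonneg) auto
      then show "norm (K x) \<le> 8 * C * D * x + 2 * D\<^sup>2 * (2 + a) * x"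
        unfolding K_def real_norm_def abs_mult abs_of_nonneg[OF wt_nonneg] by simp
    qed simp
    show "((\<lambda>x. 8 * C * D * x + 2 * D\<^sup>2 * (2 + a) * x) \<longlongrightarrow> 0) (at_right 0)"
      by (auto intro!: tendsto_eq_intros)
  qed
  have ints: "integrable lborel (\<lambda>x. ?w x * (v' x)\<^sup>2 - 2 * (?w x * (v x)\<^sup>2))"
    using i2 i3 by simp
  let ?l = "\<lambda>n. 1 / (real n + 1)" and ?u = "\<lambda>n. real n + 1"
  have U_eq: "(\<Union>n. {?l n..?u n}) = {0<..}"
  proof safe
    fix x :: real assume x: "0 < x"
    obtain n where n: "max x (1 / x) \<le> real n" using real_arch_simple by blast
    then have "1 / x \<le> real n + 1" "x \<le> real n + 1" by auto
    then have "1 / (real n + 1) \<le> x" using x by (simp add: field_simps)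
    then show "x \<in> (\<Union>n. {?l n..?u n})" using \<open>x \<le> real n + 1\<close> by auto
  next
    fix x n assume "x \<in> {?l n..?u n}"
    then show "x > 0" by (auto intro: less_le_trans[rotated])
  qed
  have "0 \<le> (LINT x:(\<Union>n. {?l n..?u n})|lborel. ?w x * (v' x)\<^sup>2 - 2 * (?w x * (v x)\<^sup>2))"
  proof (rule set_integral_nonneg_if_ge_deriv)
    show "(\<lambda>n. K (?l n)) \<longlonglongrightarrow> 0"
      by (rule filterlim_compose[OF Kzero]) real_asymp
    show "(\<lambda>n. K (?u n)) \<longlonglongrightarrow> 0"
      by (rule filterlim_compose[OF Ktop]) real_asymp
    fix n x assume "x \<in> {?l n..?u n}"
    then have "x > 0" using U_eq by blast
    then show "(K has_real_derivative K' x) (at x)" "K' x \<le> ?w x * (v' x)\<^sup>2 - 2 * (?w x * (v x)\<^sup>2)"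
      using K K'le by auto
  next
    show "set_integrable lborel (\<Union>n. {?l n..?u n}) (\<lambda>x. ?w x * (v' x)\<^sup>2 - 2 * (?w x * (v x)\<^sup>2))"
      unfolding U_eq set_integrable_def by (rule integrable_mult_indicator[OF _ ints]) simp
    show "?l n \<le> ?u n" for n
      by (rule order_trans[of _ 1]) auto
  qed (auto simp: decseq_def incseq_def frac_le)
  \<comment> \<open>The integral extends from (0, \<infinity>) to the whole line because the weight
    is 0 on the rest.\<close>
  also have "\<dots> = (\<integral>x. ?w x * (v' x)\<^sup>2 - 2 * (?w x * (v x)\<^sup>2) \<partial>lborel)"
    unfolding U_eq set_lebesgue_integral_def
    by (rule Bochner_Integration.integral_cong) (use a in \<open>auto simp: indicator_def wt_def\<close>)
  also have "\<dots> = (\<integral>x. ?w x * (v' x)\<^sup>2 \<partial>lborel) - 2 * (\<integral>x. ?w x * (v x)\<^sup>2 \<partial>lborel)"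
    using i2 i3 by simp
  finally show ?thesis by simp
qed

subsection \<open>The normalised factors\<close>

definition wt_mass :: "real \<Rightarrow> real" where
  "wt_mass a = (\<integral>t. wt a t \<partial>lborel)"

definition nu :: "real \<Rightarrow> real measure" where
  "nu a = density lborel (\<lambda>t. ennreal (wt a t / wt_mass a))"

lemma integrable_wt: "0 \<le> a \<Longrightarrow> integrable lborel (wt a)"
  using integrable_wt_abs_power[of a 0] by simp

lemma wt_mass_pos:
  assumes "0 \<le> a" shows "0 < wt_mass a"
proof -
  have "wt_mass a \<noteq> 0"
  proof
    assume "wt_mass a = 0"
    then have "AE t in lborel. wt a t = 0"
      unfolding wt_mass_def
      by (subst (asm) integral_nonneg_eq_0_iff_AE) (auto simp: integrable_wt assms wt_nonneg)
    then have "AE t in lborel. t \<notin> {0<..<1::real}"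
      by eventually_elim (auto simp: wt_def split: if_splits)
    then have "emeasure lborel {0<..<1::real} = 0"
      by (subst (asm) AE_iff_measurable[OF _ refl]) (auto simp: greaterThanLessThan_def Int_def)
    then show False by simp
  qed
  then show ?thesis
    unfolding wt_mass_def using Bochner_Integration.integral_nonneg[of lborel "wt a"] wt_nonneg[of a] by fastforce
qed

lemma sets_nu [simp, measurable_cong]: "sets (nu a) = sets borel"
  by (simp add: nu_def)

lemma space_nu [simp]: "space (nu a) = UNIV"
  by (simp add: nu_def)

lemma prob_space_nu:
  assumes "0 \<le> a" shows "prob_space (nu a)"
proof (rule prob_spaceI)
  have "emeasure (nu a) (space (nu a)) = (\<integral>\<^sup>+ t. ennreal (wt a t / wt_mass a) \<partial>lborel)"
    by (simp add: nu_def emeasure_density)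
  also have "\<dots> = ennreal (\<integral>t. wt a t / wt_mass a \<partial>lborel)"
    using assms by (intro nn_integral_eq_integral) (auto simp: wt_nonneg integrable_wt less_imp_le[OF wt_mass_pos])
  also have "\<dots> = 1"
    using wt_mass_pos[OF assms] by (simp add: wt_mass_def)
  finally show "emeasure (nu a) (space (nu a)) = 1" .
qed

lemma integral_nu:
  assumes "0 \<le> a" and [measurable]: "f \<in> borel_measurable borel"
  shows "(\<integral>t. f t \<partial>nu a) = (\<integral>t. wt a t * f t \<partial>lborel) / wt_mass a"
  unfolding nu_def
  by (subst integral_density) (auto simp: wt_nonneg less_imp_le[OF wt_mass_pos[OF assms(1)]])

lemma integrable_nu:
  fixes f :: "real \<Rightarrow> real"
  assumes "0 \<le> a" and [measurable]: "f \<in> borel_measurable borel"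
    and "\<And>t. \<bar>f t\<bar> \<le> C * (1 + \<bar>t\<bar>) ^ k"
  shows "integrable (nu a) f"
  unfolding nu_def
  using integrable_wt_growth[OF assms]
  by (subst integrable_density) (auto simp: wt_nonneg less_imp_le[OF wt_mass_pos[OF assms(1)]])

lemma wt_mass_0: "wt_mass 0 = sqrt (2 * pi)"
proof -
  have "(\<integral>t. std_normal_density t \<partial>lborel) = wt_mass 0 / sqrt (2 * pi)"
    unfolding wt_mass_def wt_zero std_normal_density_def by simp
  then show ?thesis by (simp add: integral_normal_density field_simps)
qed

lemma integral_nu_0:
  assumes [measurable]: "f \<in> borel_measurable borel"
  shows "(\<integral>t. f t \<partial>nu 0) = (\<integral>t. std_normal_density t * f t \<partial>lborel)"
  by (subst integral_nu) (auto simp: wt_mass_0 wt_zero std_normal_density_def)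

lemma nu_0_moments:
  "(\<integral>t. t \<partial>nu 0) = 0" "(\<integral>t. t\<^sup>2 \<partial>nu 0) = 1" "(\<integral>t. t ^ 3 \<partial>nu 0) = 0" "(\<integral>t. t ^ 4 \<partial>nu 0) = 3"
  using integral_std_normal_moment_odd[of 0] integral_std_normal_moment_even[of 1]
    integral_std_normal_moment_odd[of 1] integral_std_normal_moment_even[of 2]
  by (simp_all add: integral_nu_0 eval_nat_numeral)

lemma integrable_nu_power: "0 \<le> a \<Longrightarrow> integrable (nu a) (\<lambda>t. t ^ k)"
  by (rule integrable_nu[where C=1 and k=k]) (auto simp: power_abs intro: power_mono)

text \<open>The mean m, and for a = 0 the linear part c t, are subtracted so that the centred
  inequalities apply. This lowers the squared norm by m^2 + c^2 and the energy by c^2, so that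
  doubling the norm leaves the correction 2 m^2 + c^2.\<close>

lemma nu_spectral_gap:
  fixes f f' :: "real \<Rightarrow> real"
  assumes a: "0 \<le> a"
    and f: "\<And>t. (f has_real_derivative f' t) (at t)" and cf': "continuous_on UNIV f'"
    and bf': "\<And>t. \<bar>f' t\<bar> \<le> C" and bf: "\<And>t. \<bar>f t\<bar> \<le> C * (1 + \<bar>t\<bar>)"
  shows "2 * (\<integral>t. (f t)\<^sup>2 \<partial>nu a) - 2 * (\<integral>t. f t \<partial>nu a)\<^sup>2 - (if a = 0 then (\<integral>t. t * f t \<partial>nu a)\<^sup>2 else 0)
    \<le> (\<integral>t. (f' t)\<^sup>2 \<partial>nu a)"
proof -
  interpret prob_space "nu a" by (rule prob_space_nu[OF a])
  have cf: "continuous_on UNIV f" using f by (meson DERIV_isCont continuous_at_imp_continuous_on)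
  have [measurable]: "f \<in> borel_measurable borel" "f' \<in> borel_measurable borel"
    using cf cf' by (auto intro: borel_measurable_continuous_onI)
  have C0: "0 \<le> C" using bf'[of 0] by linarith
  have i1: "integrable (nu a) f"
    by (rule integrable_nu[where C=C and k=1]) (use bf a in auto)
  have it: "integrable (nu a) (\<lambda>t. t)" "integrable (nu a) (\<lambda>t. t\<^sup>2)"
    using integrable_nu_power[OF a, of 1] integrable_nu_power[OF a, of 2] by simp_all
  have itf: "integrable (nu a) (\<lambda>t. t * f t)"
  proof (rule integrable_nu[where C=C and k=2])
    fix t :: real
    have "\<bar>t\<bar> * \<bar>f t\<bar> \<le> (1 + \<bar>t\<bar>) * (C * (1 + \<bar>t\<bar>))" by (intro mult_mono bf) auto
    then show "\<bar>t * f t\<bar> \<le> C * (1 + \<bar>t\<bar>)\<^sup>2" by (simp add: abs_mult power2_eq_square mult_ac)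
  qed (use a in auto)
  have i2: "integrable (nu a) (\<lambda>t. (f t)\<^sup>2)"
  proof (rule integrable_nu[where C="C\<^sup>2" and k=2])
    fix t :: real
    have "\<bar>f t\<bar>\<^sup>2 \<le> (C * (1 + \<bar>t\<bar>))\<^sup>2" by (intro power_mono bf) auto
    then show "\<bar>(f t)\<^sup>2\<bar> \<le> C\<^sup>2 * (1 + \<bar>t\<bar>)\<^sup>2" by (simp add: power_mult_distrib)
  qed (use a in auto)
  have i': "integrable (nu a) f'"
    by (rule integrable_nu[where C=C and k=0]) (use bf' a in auto)
  have i'2: "integrable (nu a) (\<lambda>t. (f' t)\<^sup>2)"
  proof (rule integrable_nu[where C="C\<^sup>2" and k=0])
    fix t :: real
    have "\<bar>f' t\<bar>\<^sup>2 \<le> C\<^sup>2" by (intro power_mono bf') auto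
    then show "\<bar>(f' t)\<^sup>2\<bar> \<le> C\<^sup>2 * (1 + \<bar>t\<bar>) ^ 0" by simp
  qed (use a in auto)
  define m where "m = (\<integral>t. f t \<partial>nu a)"
  \<comment> \<open>Setting c to 0 for a > 0 treats both cases at once: either c or the mean of t is
    0, so the cross terms c times \<integral> t always vanish.\<close>
  define c where "c = (if a = 0 then \<integral>t. t * f t \<partial>nu a else 0)"
  define D where "D = C + \<bar>m\<bar> + \<bar>c\<bar>"
  define v where "v t = f t - m - c * t" for t
  define v' where "v' t = f' t - c" for t
  have mv: "v \<in> borel_measurable borel" "v' \<in> borel_measurable borel"
    unfolding v_def[abs_def] v'_def[abs_def] by measurable
  have v: "(v has_real_derivative v' t) (at t)" for t
    unfolding v_def v'_def by (auto intro!: derivative_eq_intros f)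
  have cv': "continuous_on UNIV v'" unfolding v'_def by (intro continuous_intros cf')
  have bv': "\<bar>v' t\<bar> \<le> D" for t using bf'[of t] unfolding v'_def D_def by linarith
  have bv: "\<bar>v t\<bar> \<le> D * (1 + \<bar>t\<bar>)" for t
  proof -
    have "\<bar>v t\<bar> \<le> \<bar>f t\<bar> + \<bar>m\<bar> + \<bar>c\<bar> * \<bar>t\<bar>" unfolding v_def abs_mult[symmetric] by linarith
    also have "\<dots> \<le> C * (1 + \<bar>t\<bar>) + \<bar>m\<bar> * (1 + \<bar>t\<bar>) + \<bar>c\<bar> * (1 + \<bar>t\<bar>)"
      by (intro add_mono bf) (auto simp: algebra_simps)
    also have "\<dots> = D * (1 + \<bar>t\<bar>)" by (simp add: D_def algebra_simps)
    finally show ?thesis .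
  qed
  have mean: "(\<integral>t. v t \<partial>nu a) = 0"
  proof -
    have "c * (\<integral>t. t \<partial>nu a) = 0" by (simp add: c_def nu_0_moments(1))
    then show ?thesis
      using i1 it by (simp add: v_def prob_space[simplified] m_def)
  qed
  then have m0: "(\<integral>t. wt a t * v t \<partial>lborel) = 0"
    using integral_nu[OF a mv(1)] wt_mass_pos[OF a] by simp
  have "2 * (\<integral>t. wt a t * (v t)\<^sup>2 \<partial>lborel) \<le> (\<integral>t. wt a t * (v' t)\<^sup>2 \<partial>lborel)"
  proof (cases "a = 0")
    case True
    have "(\<integral>t. t * v t \<partial>nu a) = (\<integral>t. t * f t - m * t - c * t\<^sup>2 \<partial>nu a)"
      by (simp add: v_def algebra_simps power2_eq_square)
    also have "\<dots> = 0"
      using itf it nu_0_moments(1,2) True by (simp add: c_def)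
    finally have "(\<integral>t. wt 0 t * (t * v t) \<partial>lborel) = 0"
      using integral_nu[OF a, of "\<lambda>t. t * v t"] mv wt_mass_pos[OF a] True by simp
    then show ?thesis
      using gauss_poincare_orthogonal[OF v cv' bv' bv] m0 True by simp
  next
    case False
    then show ?thesis using halfline_poincare_centered[OF _ v cv' bv' bv m0] a by simp
  qed
  then have "2 * (\<integral>t. wt a t * (v t)\<^sup>2 \<partial>lborel) / wt_mass a \<le> (\<integral>t. wt a t * (v' t)\<^sup>2 \<partial>lborel) / wt_mass a"
    using wt_mass_pos[OF a] by (intro divide_right_mono) auto
  then have main: "2 * (\<integral>t. (v t)\<^sup>2 \<partial>nu a) \<le> (\<integral>t. (v' t)\<^sup>2 \<partial>nu a)"
    using mv by (simp add: integral_nu[OF a])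
  have L: "(\<integral>t. (v t)\<^sup>2 \<partial>nu a) = (\<integral>t. (f t)\<^sup>2 \<partial>nu a) - m\<^sup>2 - c\<^sup>2"
  proof -
    have "(\<integral>t. (v t)\<^sup>2 \<partial>nu a) = (\<integral>t. (f t)\<^sup>2 - 2 * m * f t - 2 * c * (t * f t) + m\<^sup>2 + 2 * m * c * t + c\<^sup>2 * t\<^sup>2 \<partial>nu a)"
      by (simp add: v_def algebra_simps power2_eq_square)
    also have "\<dots> = (\<integral>t. (f t)\<^sup>2 \<partial>nu a) - 2 * m * m - 2 * c * (\<integral>t. t * f t \<partial>nu a) + m\<^sup>2 + 2 * m * c * (\<integral>t. t \<partial>nu a) + c\<^sup>2 * (\<integral>t. t\<^sup>2 \<partial>nu a)"
      using i1 i2 it itf by (simp add: prob_space[simplified] m_def)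
    also have "\<dots> = (\<integral>t. (f t)\<^sup>2 \<partial>nu a) - m\<^sup>2 - c\<^sup>2"
      using nu_0_moments(1,2) by (simp add: c_def power2_eq_square)
    finally show ?thesis .
  qed
  have R: "(\<integral>t. (v' t)\<^sup>2 \<partial>nu a) = (\<integral>t. (f' t)\<^sup>2 \<partial>nu a) - c\<^sup>2"
  proof -
    have "(\<integral>t. (v' t)\<^sup>2 \<partial>nu a) = (\<integral>t. (f' t)\<^sup>2 - 2 * c * f' t + c\<^sup>2 \<partial>nu a)"
      by (simp add: v'_def algebra_simps power2_eq_square)
    also have "\<dots> = (\<integral>t. (f' t)\<^sup>2 \<partial>nu a) - 2 * c * (\<integral>t. f' t \<partial>nu a) + c\<^sup>2"
      using i' i'2 by (simp add: prob_space[simplified])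
    also have "\<dots> = (\<integral>t. (f' t)\<^sup>2 \<partial>nu a) - c\<^sup>2"
    proof (cases "a = 0")
      case True
      have "(\<integral>t. f' t \<partial>nu a) = c"
        using gauss_integral_by_parts[OF f cf' bf' bf] True by (simp add: c_def integral_nu)
      then show ?thesis by (simp add: power2_eq_square)
    qed (simp add: c_def)
    finally show ?thesis .
  qed
  show ?thesis using main unfolding L R by (auto simp: c_def m_def)
qed

lemma nu_0_integral_by_parts:
  fixes f f' :: "real \<Rightarrow> real"
  assumes f: "\<And>t. (f has_real_derivative f' t) (at t)" and cf': "continuous_on UNIV f'"
    and bf': "\<And>t. \<bar>f' t\<bar> \<le> C" and bf: "\<And>t. \<bar>f t\<bar> \<le> C * (1 + \<bar>t\<bar>)"
  shows "(\<integral>t. f' t \<partial>nu 0) = (\<integral>t. t * f t \<partial>nu 0)"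
proof -
  have cf: "continuous_on UNIV f" using f by (meson DERIV_isCont continuous_at_imp_continuous_on)
  have [measurable]: "f \<in> borel_measurable borel" "f' \<in> borel_measurable borel"
    using cf cf' by (auto intro: borel_measurable_continuous_onI)
  show ?thesis using gauss_integral_by_parts[OF assms] by (simp add: integral_nu)
qed

subsection \<open>Product structure of the measure\<close>

text \<open>A version of the measure on all Borel sets of the whole space, where single coordinates
  can be integrated out without regard to the domain. The image under the vector constructor makes
  the product structure usable for \<open>real^'n\<close>.\<close>

definition mu :: "('n::finite \<Rightarrow> real) \<Rightarrow> (real^'n) measure" where
  "mu \<alpha> = distr (\<Pi>\<^sub>M i\<in>UNIV. nu (\<alpha> i)) borel (\<lambda>f. \<chi> i. f i)"

definition upd :: "real^'n::finite \<Rightarrow> 'n \<Rightarrow> real \<Rightarrow> real^'n" where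
  "upd x i t = (\<chi> j. if j = i then t else x $ j)"

lemma upd_nth [simp]: "upd x i t $ j = (if j = i then t else x $ j)"
  by (simp add: upd_def)

lemma upd_upd [simp]: "upd (upd x i s) i t = upd x i t"
  by (simp add: vec_eq_iff)

lemma upd_commute: "i \<noteq> j \<Longrightarrow> upd (upd x i s) j t = upd (upd x j t) i s"
  by (simp add: vec_eq_iff)

lemma measurable_vec_lambda:
  assumes "\<And>i. (\<lambda>x. f x i) \<in> borel_measurable M"
  shows "(\<lambda>x. (\<chi> i. f x i) :: real^'n::finite) \<in> borel_measurable M"
proof (subst borel_measurable_euclidean_space, intro ballI)
  fix b :: "real^'n" assume "b \<in> Basis"
  then obtain i where "b = axis i 1" by (auto simp: Basis_vec_def)
  then show "(\<lambda>x. (\<chi> i. f x i) \<bullet> b) \<in> borel_measurable M"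
    using assms by (simp add: inner_axis)
qed

lemma measurable_vec_nth [measurable]: "(\<lambda>x::real^'n::finite. x $ i) \<in> borel_measurable borel"
  by (intro borel_measurable_continuous_onI continuous_intros)

lemma measurable_upd [measurable]:
  "(\<lambda>p. upd (fst p) i (snd p)) \<in> borel \<Otimes>\<^sub>M borel \<rightarrow>\<^sub>M (borel :: (real^'n::finite) measure)"
  unfolding upd_def by (rule measurable_vec_lambda) measurable

lemma sets_mu [simp, measurable_cong]: "sets (mu \<alpha>) = sets borel"
  by (simp add: mu_def)

lemma space_mu [simp]: "space (mu \<alpha>) = UNIV"
  by (simp add: mu_def)

lemma product_sigma_finite_nu: "\<forall>i. 0 \<le> \<alpha> i \<Longrightarrow> product_sigma_finite (\<lambda>i. nu (\<alpha> i))"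
  by (intro product_sigma_finite.intro prob_space_imp_sigma_finite prob_space_nu) auto

lemma measurable_vec_of_PiM:
  "(\<lambda>f. \<chi> i. f i) \<in> (\<Pi>\<^sub>M i\<in>UNIV. nu (\<alpha> i)) \<rightarrow>\<^sub>M (borel :: (real^'n::finite) measure)"
  by (rule measurable_vec_lambda) measurable

lemma rect_measurable:
  assumes "\<And>i. A i \<in> sets borel"
  shows "{x :: real^'n::finite. \<forall>i. x $ i \<in> A i} \<in> sets borel"
proof -
  have "{x :: real^'n. \<forall>i. x $ i \<in> A i} = (\<Inter>i. (\<lambda>x. x $ i) -` A i \<inter> space borel)" by auto
  also have "\<dots> \<in> sets borel"
    using assms by (intro sets.countable_INT') (auto intro!: measurable_sets_borel[OF measurable_vec_nth])
  finally show ?thesis .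
qed

lemma emeasure_mu_rect:
  assumes \<alpha>: "\<forall>i. 0 \<le> \<alpha> i" and A: "\<And>i. A i \<in> sets borel"
  shows "emeasure (mu \<alpha>) {x. \<forall>i. x $ i \<in> A i} = (\<Prod>i\<in>UNIV. emeasure (nu (\<alpha> i)) (A i))"
proof -
  interpret product_sigma_finite "\<lambda>i. nu (\<alpha> i)" by (rule product_sigma_finite_nu[OF \<alpha>])
  have "(\<lambda>f. \<chi> i. f i) -` {x. \<forall>i. x $ i \<in> A i} \<inter> space (\<Pi>\<^sub>M i\<in>UNIV. nu (\<alpha> i)) = Pi\<^sub>E UNIV A"
    by (auto simp: space_PiM)
  then show ?thesis
    unfolding mu_def using A
    by (subst emeasure_distr[OF measurable_vec_of_PiM rect_measurable]) (auto simp: emeasure_PiM)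
qed

text \<open>The coordinate map carries P to the product space, where measures agreeing on boxes
  coincide; the inverse map brings the equality back.\<close>

lemma mu_eqI:
  fixes P :: "(real^'n::finite) measure"
  assumes \<alpha>: "\<forall>i. 0 \<le> \<alpha> i" and P: "sets P = sets borel"
    and eq: "\<And>A. (\<And>i. A i \<in> sets borel) \<Longrightarrow> emeasure P {x. \<forall>i. x $ i \<in> A i} = (\<Prod>i\<in>UNIV. emeasure (nu (\<alpha> i)) (A i))"
  shows "P = mu \<alpha>"
proof -
  interpret product_sigma_finite "\<lambda>i. nu (\<alpha> i)" by (rule product_sigma_finite_nu[OF \<alpha>])
  note [measurable_cong] = P
  have sp: "space P = UNIV" using sets_eq_imp_space_eq[OF P] by simp
  let ?M = "\<Pi>\<^sub>M i\<in>UNIV. nu (\<alpha> i)"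
  have m: "(\<lambda>x i. x $ i) \<in> P \<rightarrow>\<^sub>M ?M"
    by (rule measurable_PiM_single') auto
  have "distr P ?M (\<lambda>x i. x $ i) = ?M"
  proof (rule PiM_eqI)
    fix A assume A: "\<And>i. i \<in> UNIV \<Longrightarrow> A i \<in> sets (nu (\<alpha> i))"
    have "(\<lambda>x i. x $ i) -` Pi\<^sub>E UNIV A \<inter> space P = {x. \<forall>i. x $ i \<in> A i}"
      by (auto simp: sp)
    moreover have "Pi\<^sub>E UNIV A \<in> sets ?M"
      using A by (intro sets_PiM_I_finite) auto
    ultimately show "emeasure (distr P ?M (\<lambda>x i. x $ i)) (Pi\<^sub>E UNIV A) = (\<Prod>i\<in>UNIV. emeasure (nu (\<alpha> i)) (A i))"
      using eq[of A] A m by (simp add: emeasure_distr)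
  qed auto
  then have "mu \<alpha> = distr (distr P ?M (\<lambda>x i. x $ i)) borel (\<lambda>f. \<chi> i. f i)"
    by (simp add: mu_def)
  also have "\<dots> = distr P borel ((\<lambda>f. \<chi> i. f i) \<circ> (\<lambda>x i. x $ i))"
    by (rule distr_distr[OF measurable_vec_of_PiM m])
  also have "\<dots> = distr P P (\<lambda>x. x)"
    by (intro distr_cong) (auto simp: P comp_def)
  also have "\<dots> = P" by (rule distr_id)
  finally show ?thesis by simp
qed

lemma prob_space_mu: "\<forall>i. 0 \<le> \<alpha> i \<Longrightarrow> prob_space (mu \<alpha>)"
  using emeasure_mu_rect[of \<alpha> "\<lambda>_. UNIV"] prob_space.emeasure_space_1[OF prob_space_nu]
  by (intro prob_spaceI) simp

text \<open>Resampling one coordinate independently leaves the law unchanged. Integration over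
  coordinate i thus becomes an integral over the full product with one extra real variable, with no
  splitting of the index set.\<close>

lemma distr_upd:
  assumes \<alpha>: "\<forall>i. 0 \<le> \<alpha> i"
  shows "distr (mu \<alpha> \<Otimes>\<^sub>M nu (\<alpha> i)) borel (\<lambda>p. upd (fst p) i (snd p)) = mu \<alpha>"
proof (rule mu_eqI[OF \<alpha>])
  fix A :: "'a \<Rightarrow> real set" assume A: "\<And>i. A i \<in> sets borel"
  interpret N: prob_space "nu (\<alpha> i)" using \<alpha> by (simp add: prob_space_nu)
  \<comment> \<open>Coordinate i of the base point is overwritten, so it is left free there and the
    constraint falls on the new variable.\<close>
  let ?A = "A(i := UNIV)"
  have A': "?A j \<in> sets borel" for j using A by simp
  have "(\<lambda>p. upd (fst p) i (snd p)) -` {x. \<forall>i. x $ i \<in> A i} \<inter> space (mu \<alpha> \<Otimes>\<^sub>M nu (\<alpha> i))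
      = {x. \<forall>j. x $ j \<in> ?A j} \<times> A i"
    by (auto simp: space_pair_measure split: if_splits)
  then have "emeasure (distr (mu \<alpha> \<Otimes>\<^sub>M nu (\<alpha> i)) borel (\<lambda>p. upd (fst p) i (snd p))) {x. \<forall>i. x $ i \<in> A i}
      = emeasure (mu \<alpha>) {x. \<forall>j. x $ j \<in> ?A j} * emeasure (nu (\<alpha> i)) (A i)"
    using A A' by (subst emeasure_distr) (auto intro!: rect_measurable N.emeasure_pair_measure_Times)
  also have "\<dots> = (\<Prod>j\<in>UNIV. emeasure (nu (\<alpha> j)) (?A j)) * emeasure (nu (\<alpha> i)) (A i)"
    by (subst emeasure_mu_rect[OF \<alpha> A']) simp
  also have "\<dots> = (\<Prod>j\<in>UNIV. emeasure (nu (\<alpha> j)) (A j))"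
    using N.emeasure_space_1
    by (auto simp: prod.remove[of UNIV i] mult.commute intro!: arg_cong2[where f="(*)"] prod.cong)
  finally show "emeasure (distr (mu \<alpha> \<Otimes>\<^sub>M nu (\<alpha> i)) borel (\<lambda>p. upd (fst p) i (snd p))) {x. \<forall>i. x $ i \<in> A i}
      = (\<Prod>i\<in>UNIV. emeasure (nu (\<alpha> i)) (A i))" .
qed simp

lemma measurable_upd_comp [measurable]:
  assumes [measurable]: "f \<in> borel_measurable borel"
  shows "(\<lambda>t. f (upd x i t)) \<in> borel_measurable borel"
proof -
  have "(\<lambda>t. upd x i t) \<in> borel \<rightarrow>\<^sub>M borel"
    unfolding upd_def by (rule measurable_vec_lambda) measurable
  then show ?thesis by measurable
qed

lemma borel_measurable_integral_upd:
  fixes f :: "real^'n::finite \<Rightarrow> real"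
  assumes \<alpha>: "\<forall>i. 0 \<le> \<alpha> i" and [measurable]: "f \<in> borel_measurable borel"
  shows "(\<lambda>x. \<integral>t. f (upd x i t) \<partial>nu (\<alpha> i)) \<in> borel_measurable borel"
proof -
  interpret N: prob_space "nu (\<alpha> i)" using \<alpha> by (simp add: prob_space_nu)
  have "(\<lambda>p. f (upd (fst p) i (snd p))) \<in> borel_measurable (borel \<Otimes>\<^sub>M nu (\<alpha> i))"
    by measurable
  then show ?thesis
    by (intro N.borel_measurable_lebesgue_integral) (simp add: split_beta')
qed

lemma mu_fubini:
  fixes f :: "real^'n::finite \<Rightarrow> real"
  assumes \<alpha>: "\<forall>i. 0 \<le> \<alpha> i" and f: "integrable (mu \<alpha>) f"
  shows "(\<integral>x. (\<integral>t. f (upd x i t) \<partial>nu (\<alpha> i)) \<partial>mu \<alpha>) = (\<integral>x. f x \<partial>mu \<alpha>)"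
    and "integrable (mu \<alpha>) (\<lambda>x. \<integral>t. f (upd x i t) \<partial>nu (\<alpha> i))"
proof -
  interpret N: prob_space "nu (\<alpha> i)" using \<alpha> by (simp add: prob_space_nu)
  interpret M: prob_space "mu \<alpha>" by (rule prob_space_mu[OF \<alpha>])
  interpret pair_sigma_finite "mu \<alpha>" "nu (\<alpha> i)" ..
  have m: "(\<lambda>p. upd (fst p) i (snd p)) \<in> mu \<alpha> \<Otimes>\<^sub>M nu (\<alpha> i) \<rightarrow>\<^sub>M borel" by measurable
  have [measurable]: "f \<in> borel_measurable borel" using f by auto
  have i: "integrable (mu \<alpha> \<Otimes>\<^sub>M nu (\<alpha> i)) (\<lambda>p. f (upd (fst p) i (snd p)))"
    using f by (subst (asm) distr_upd[OF \<alpha>, of i, symmetric]) (simp add: integrable_distr_eq)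
  have "(\<integral>x. f x \<partial>mu \<alpha>) = (\<integral>p. f (upd (fst p) i (snd p)) \<partial>(mu \<alpha> \<Otimes>\<^sub>M nu (\<alpha> i)))"
    by (subst distr_upd[OF \<alpha>, of i, symmetric]) (rule integral_distr, auto)
  then show "(\<integral>x. (\<integral>t. f (upd x i t) \<partial>nu (\<alpha> i)) \<partial>mu \<alpha>) = (\<integral>x. f x \<partial>mu \<alpha>)"
    using integral_fst'[OF i] by simp
  show "integrable (mu \<alpha>) (\<lambda>x. \<integral>t. f (upd x i t) \<partial>nu (\<alpha> i))"
    using integrable_fst'[OF i] by simp
qed

lemma distr_mu_nth:
  assumes \<alpha>: "\<forall>i. 0 \<le> \<alpha> i"
  shows "distr (mu \<alpha>) borel (\<lambda>x. x $ i) = nu (\<alpha> i)"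
proof (rule measure_eqI)
  fix B assume "B \<in> sets (distr (mu \<alpha>) borel (\<lambda>x. x $ i))"
  then have B: "B \<in> sets borel" by simp
  let ?A = "(\<lambda>_. UNIV)(i := B)"
  have A': "?A j \<in> sets borel" for j using B by simp
  have "emeasure (distr (mu \<alpha>) borel (\<lambda>x. x $ i)) B = emeasure (mu \<alpha>) {x. \<forall>j. x $ j \<in> ?A j}"
    using B by (subst emeasure_distr) (auto intro!: arg_cong2[where f=emeasure])
  also have "\<dots> = (\<Prod>j\<in>UNIV. emeasure (nu (\<alpha> j)) (?A j))"
    by (rule emeasure_mu_rect[OF \<alpha> A'])
  also have "\<dots> = emeasure (nu (\<alpha> i)) B"
  proof -
    have "(\<Prod>j\<in>UNIV - {i}. emeasure (nu (\<alpha> j)) (?A j)) = 1"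
      using prob_space.emeasure_space_1[OF prob_space_nu] \<alpha> by (intro prod.neutral) auto
    then show ?thesis by (simp add: prod.remove[of UNIV i])
  qed
  finally show "emeasure (distr (mu \<alpha>) borel (\<lambda>x. x $ i)) B = emeasure (nu (\<alpha> i)) B" .
qed simp

lemma integral_mu_nth:
  assumes \<alpha>: "\<forall>i. 0 \<le> \<alpha> i" and [measurable]: "h \<in> borel_measurable borel"
  shows "(\<integral>x. h (x $ i) \<partial>mu \<alpha>) = (\<integral>t. (h t :: real) \<partial>nu (\<alpha> i))"
  by (subst distr_mu_nth[OF \<alpha>, symmetric], subst integral_distr) auto

lemma integrable_mu_prod:
  fixes h :: "'n::finite \<Rightarrow> real \<Rightarrow> real"
  assumes \<alpha>: "\<forall>i. 0 \<le> \<alpha> i" and h: "\<And>i. integrable (nu (\<alpha> i)) (h i)"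
  shows "integrable (mu \<alpha>) (\<lambda>x. \<Prod>i\<in>UNIV. h i (x $ i))"
proof -
  interpret product_sigma_finite "\<lambda>i. nu (\<alpha> i)" by (rule product_sigma_finite_nu[OF \<alpha>])
  have [measurable]: "h i \<in> borel_measurable borel" for i using borel_measurable_integrable[OF h, of i] by simp
  show ?thesis
    unfolding mu_def using product_integrable_prod[OF finite h]
    by (subst integrable_distr_eq[OF measurable_vec_of_PiM]) auto
qed

section \<open>Identification of the weighted measure on the cone with the product measure\<close>

lemma lborel_vec: "distr (\<Pi>\<^sub>M i\<in>UNIV. lborel) borel (\<lambda>f. \<chi> i. f i) = (lborel :: (real^'n::finite) measure)"
proof (rule lborel_eqI[symmetric])
  interpret product_sigma_finite "\<lambda>i::'n. lborel :: real measure" ..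
  fix l u :: "real^'n" assume le: "\<And>b. b \<in> Basis \<Longrightarrow> l \<bullet> b \<le> u \<bullet> b"
  have le': "l $ i \<le> u $ i" for i using le[of "axis i 1"] by (simp add: inner_axis)
  have m: "(\<lambda>f. \<chi> i. f i) \<in> (\<Pi>\<^sub>M i\<in>UNIV. lborel) \<rightarrow>\<^sub>M (borel :: (real^'n) measure)"
    by (rule measurable_vec_lambda) measurable
  have "(\<lambda>f. \<chi> i. f i) -` box l u \<inter> space (\<Pi>\<^sub>M i\<in>(UNIV::'n set). lborel) = Pi\<^sub>E UNIV (\<lambda>i. {l $ i<..<u $ i})"
    by (auto simp: space_PiM mem_box_cart PiE_iff)
  then have "emeasure (distr (\<Pi>\<^sub>M i\<in>UNIV. lborel) borel (\<lambda>f. \<chi> i. f i)) (box l u) = (\<Prod>i\<in>UNIV. ennreal (u $ i - l $ i))"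
    using le' by (simp add: emeasure_distr[OF m] emeasure_PiM)
  also have "\<dots> = ennreal (\<Prod>i\<in>UNIV. u $ i - l $ i)"
    using le' by (simp add: prod_ennreal)
  also have "(\<Prod>i\<in>UNIV. u $ i - l $ i) = (\<Prod>b\<in>Basis. (u - l) \<bullet> b)"
  proof -
    have B: "(Basis :: (real^'n) set) = (\<lambda>i. axis i 1) ` UNIV" by (auto simp: Basis_vec_def)
    show ?thesis unfolding B
      by (subst prod.reindex) (auto simp: inj_on_def axis_eq_axis inner_axis)
  qed
  finally show "emeasure (distr (\<Pi>\<^sub>M i\<in>UNIV. lborel) borel (\<lambda>f. \<chi> i. f i)) (box l u) = (\<Prod>b\<in>Basis. (u - l) \<bullet> b)" .
qed simp

lemma RNstar_measurable [measurable]: "RNstar \<alpha> \<in> sets borel"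
proof -
  have "RNstar \<alpha> = {x. \<forall>i. x $ i \<in> (if \<alpha> i > 0 then {0<..} else UNIV)}"
    by (auto simp: RNstar_def)
  also have "\<dots> \<in> sets borel" by (rule rect_measurable) auto
  finally show ?thesis .
qed

text \<open>Extending the one-dimensional weights by 0 lets the product absorb the indicator of the
  domain: outside it some factor with positive exponent vanishes.\<close>

lemma gauss_w_eq_prod:
  assumes \<alpha>: "\<forall>i. 0 \<le> \<alpha> i"
  shows "indicator (RNstar \<alpha>) x * gauss_w \<alpha> x = (\<Prod>i\<in>UNIV. wt (\<alpha> i) (x $ i))"
proof (cases "x \<in> RNstar \<alpha>")
  case True
  have "exp (- (norm x)\<^sup>2 / 2) = exp (\<Sum>i\<in>UNIV. - (x $ i)\<^sup>2 / 2)"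
    by (simp add: norm_vec_def L2_set_def sum_nonneg sum_divide_distrib sum_negf)
  also have "\<dots> = (\<Prod>i\<in>UNIV. exp (- (x $ i)\<^sup>2 / 2))" by (simp add: exp_sum)
  finally have "gauss_w \<alpha> x = (\<Prod>i\<in>UNIV. (if \<alpha> i = 0 then 1 else (x $ i) powr (\<alpha> i)) * exp (- (x $ i)\<^sup>2 / 2))"
    by (simp add: gauss_w_def monomial_def prod.distrib)
  also have "\<dots> = (\<Prod>i\<in>UNIV. wt (\<alpha> i) (x $ i))"
  proof (rule prod.cong[OF refl])
    fix i
    show "(if \<alpha> i = 0 then 1 else (x $ i) powr (\<alpha> i)) * exp (- (x $ i)\<^sup>2 / 2) = wt (\<alpha> i) (x $ i)"
      using \<alpha>[rule_format, of i] True by (cases "\<alpha> i = 0") (auto simp: wt_def RNstar_def order_le_less)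
  qed
  finally show ?thesis using True by simp
next
  case False
  then obtain i where "\<alpha> i > 0" "x $ i \<le> 0" by (auto simp: RNstar_def not_less)
  then have "wt (\<alpha> i) (x $ i) = 0" by (simp add: wt_def)
  then have "(\<Prod>i\<in>UNIV. wt (\<alpha> i) (x $ i)) = 0" by (intro prod_zero) auto
  then show ?thesis using False by simp
qed

lemma gauss_w_measurable [measurable]: "gauss_w \<alpha> \<in> borel_measurable borel"
  unfolding gauss_w_def[abs_def] monomial_def by measurable

lemma norm_const_eq:
  assumes \<alpha>: "\<forall>i. 0 \<le> \<alpha> i"
  shows "norm_const \<alpha> = (\<Prod>i\<in>UNIV. wt_mass (\<alpha> i))"
proof -
  interpret product_sigma_finite "\<lambda>i::'a. lborel :: real measure" ..
  have "norm_const \<alpha> = (\<integral>x. (\<Prod>i\<in>UNIV. wt (\<alpha> i) (x $ i)) \<partial>lborel)"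
    by (simp add: norm_const_def set_lebesgue_integral_def gauss_w_eq_prod[OF \<alpha>])
  also have "\<dots> = (\<integral>x. (\<Prod>i\<in>UNIV. wt (\<alpha> i) (x i)) \<partial>(\<Pi>\<^sub>M i\<in>UNIV. lborel))"
    by (subst lborel_vec[symmetric], subst integral_distr) (auto intro!: measurable_vec_lambda)
  also have "\<dots> = (\<Prod>i\<in>UNIV. wt_mass (\<alpha> i))"
    unfolding wt_mass_def using \<alpha> by (intro product_integral_prod integrable_wt) auto
  finally show ?thesis .
qed

lemma space_muA: "space (muA \<alpha>) = RNstar \<alpha>"
  by (simp add: muA_def space_restrict_space)

lemma sets_muA: "sets (muA \<alpha>) = sets (restrict_space borel (RNstar \<alpha>))"
  by (simp add: muA_def sets_restrict_space)

lemma measurable_muA_id: "(\<lambda>x. x) \<in> muA \<alpha> \<rightarrow>\<^sub>M borel"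
  by (subst measurable_cong_sets[OF sets_muA refl]) (rule measurable_restrict_space1, simp)

text \<open>The density with its indicator factors over the coordinates, and so does the normalising
  constant; boxes therefore get the product of the one-dimensional masses. Integrals of Borel
  functions may from here on be computed on the whole space.\<close>

lemma distr_muA:
  assumes \<alpha>: "\<forall>i. 0 \<le> \<alpha> i"
  shows "distr (muA \<alpha>) borel (\<lambda>x. x) = mu \<alpha>"
proof (rule mu_eqI[OF \<alpha>])
  interpret product_sigma_finite "\<lambda>i::'a. lborel :: real measure" ..
  fix A :: "'a \<Rightarrow> real set" assume A[measurable]: "\<And>i. A i \<in> sets borel"
  let ?R = "{x. \<forall>i. x $ i \<in> A i}"
  have R[measurable]: "?R \<in> sets borel" by (rule rect_measurable[OF A])
  have "emeasure (distr (muA \<alpha>) borel (\<lambda>x. x)) ?R = emeasure (muA \<alpha>) (?R \<inter> RNstar \<alpha>)"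
    by (subst emeasure_distr[OF measurable_muA_id R]) (simp add: space_muA)
  also have "\<dots> = (\<integral>\<^sup>+ x. ennreal (gauss_w \<alpha> x / norm_const \<alpha>) * indicator (?R \<inter> RNstar \<alpha>) x \<partial>restrict_space lborel (RNstar \<alpha>))"
    unfolding muA_def
    by (rule emeasure_density) (auto intro!: measurable_restrict_space1 simp: sets_restrict_space)
  also have "\<dots> = (\<integral>\<^sup>+ x. ennreal (gauss_w \<alpha> x / norm_const \<alpha>) * indicator (?R \<inter> RNstar \<alpha>) x * indicator (RNstar \<alpha>) x \<partial>lborel)"
    by (subst nn_integral_restrict_space) auto
  also have "\<dots> = (\<integral>\<^sup>+ x. (\<Prod>i\<in>UNIV. ennreal (wt (\<alpha> i) (x $ i) / wt_mass (\<alpha> i)) * indicator (A i) (x $ i)) \<partial>lborel)"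
  proof (rule nn_integral_cong)
    fix x :: "real^'a"
    have ind: "(\<Prod>i\<in>UNIV. indicator (A i) (x $ i) :: ennreal) = indicator ?R x"
    proof (cases "x \<in> ?R")
      case False
      then obtain i where "x $ i \<notin> A i" by auto
      then show ?thesis using False by (auto intro!: prod_zero simp: indicator_def)
    qed simp
    have "(\<Prod>i\<in>UNIV. ennreal (wt (\<alpha> i) (x $ i) / wt_mass (\<alpha> i))) = ennreal (indicator (RNstar \<alpha>) x * gauss_w \<alpha> x / norm_const \<alpha>)"
      using \<alpha> unfolding gauss_w_eq_prod[OF \<alpha>] norm_const_eq[OF \<alpha>]
      by (subst prod_ennreal) (auto simp: wt_nonneg less_imp_le wt_mass_pos prod_dividef)
    then show "ennreal (gauss_w \<alpha> x / norm_const \<alpha>) * indicator (?R \<inter> RNstar \<alpha>) x * indicator (RNstar \<alpha>) x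
        = (\<Prod>i\<in>UNIV. ennreal (wt (\<alpha> i) (x $ i) / wt_mass (\<alpha> i)) * indicator (A i) (x $ i))"
      unfolding prod.distrib ind by (simp add: indicator_def)
  qed
  also have "\<dots> = (\<integral>\<^sup>+ x. (\<Prod>i\<in>UNIV. ennreal (wt (\<alpha> i) (x i) / wt_mass (\<alpha> i)) * indicator (A i) (x i)) \<partial>(\<Pi>\<^sub>M i\<in>UNIV. lborel))"
    by (subst lborel_vec[symmetric], subst nn_integral_distr) (auto intro!: measurable_vec_lambda)
  also have "\<dots> = (\<Prod>i\<in>UNIV. \<integral>\<^sup>+ t. ennreal (wt (\<alpha> i) t / wt_mass (\<alpha> i)) * indicator (A i) t \<partial>lborel)"
    by (rule product_nn_integral_prod) auto
  also have "\<dots> = (\<Prod>i\<in>UNIV. emeasure (nu (\<alpha> i)) (A i))"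
    by (simp add: nu_def emeasure_density)
  finally show "emeasure (distr (muA \<alpha>) borel (\<lambda>x. x)) ?R = (\<Prod>i\<in>UNIV. emeasure (nu (\<alpha> i)) (A i))" .
qed simp

lemma integral_muA:
  fixes f :: "real^'n::finite \<Rightarrow> 'b::{banach, second_countable_topology}"
  assumes \<alpha>: "\<forall>i. 0 \<le> \<alpha> i" and "f \<in> borel_measurable borel"
  shows "(\<integral>x. f x \<partial>muA \<alpha>) = (\<integral>x. f x \<partial>mu \<alpha>)"
  unfolding distr_muA[OF \<alpha>, symmetric] by (rule integral_distr[OF measurable_muA_id assms(2), symmetric])

lemma integrable_muA:
  fixes f :: "real^'n::finite \<Rightarrow> 'b::{banach, second_countable_topology}"
  assumes \<alpha>: "\<forall>i. 0 \<le> \<alpha> i" and "f \<in> borel_measurable borel"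
  shows "integrable (muA \<alpha>) f \<longleftrightarrow> integrable (mu \<alpha>) f"
  unfolding distr_muA[OF \<alpha>, symmetric] by (rule integrable_distr_eq[OF measurable_muA_id assms(2), symmetric])

lemma prob_space_muA:
  assumes \<alpha>: "\<forall>i. 0 \<le> \<alpha> i" shows "prob_space (muA \<alpha>)"
  using prob_space_mu[OF \<alpha>] unfolding distr_muA[OF \<alpha>, symmetric]
  by (rule prob_space_distrD[OF measurable_muA_id])

subsection \<open>Tensorisation\<close>

text \<open>\<open>A i\<close>, \<open>B i\<close>, \<open>C i\<close> model the projections onto the eigenvalues 0, 1 and \<open>\<ge> 2\<close> in
  coordinate \<open>i\<close>, and \<open>N\<close> the squared norm. The lower bound \<open>gap i f\<close> for the energy in coordinate
  \<open>i\<close> is additive along the splitting in any other coordinate; this drives the induction.\<close>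

locale commuting_splits =
  fixes V :: "'v set" and A B C :: "'i \<Rightarrow> 'v \<Rightarrow> 'v" and N :: "'v \<Rightarrow> real"
  assumes closed: "f \<in> V \<Longrightarrow> A i f \<in> V" "f \<in> V \<Longrightarrow> B i f \<in> V" "f \<in> V \<Longrightarrow> C i f \<in> V"
    and nonneg: "f \<in> V \<Longrightarrow> 0 \<le> N f"
    and split: "f \<in> V \<Longrightarrow> N f = N (A i f) + N (B i f) + N (C i f)"
    and commute: "i \<noteq> j \<Longrightarrow> f \<in> V \<Longrightarrow> A j (A i f) = A i (A j f)"
      "i \<noteq> j \<Longrightarrow> f \<in> V \<Longrightarrow> B j (A i f) = A i (B j f)"
      "i \<noteq> j \<Longrightarrow> f \<in> V \<Longrightarrow> B j (B i f) = B i (B j f)"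
      "i \<noteq> j \<Longrightarrow> f \<in> V \<Longrightarrow> C j (A i f) = A i (C j f)"
      "i \<noteq> j \<Longrightarrow> f \<in> V \<Longrightarrow> C j (B i f) = B i (C j f)"
begin

fun proj :: "'i list \<Rightarrow> 'v \<Rightarrow> 'v" where
  "proj [] f = f"
| "proj (j # l) f = proj l (A j f)"

text \<open>The squared norm of the part of f having exactly one coordinate of the list at level 1
  and all others at level 0. The recursion sorts these parts by the position of the coordinate at
  level 1.\<close>

fun first_level :: "'i list \<Rightarrow> 'v \<Rightarrow> real" where
  "first_level [] f = 0"
| "first_level (j # l) f = first_level l (A j f) + N (proj l (B j f))"

text \<open>Equals N (B i f) + 2 N (C i f) on V: levels 0, 1, 2 weighted by 0, 1, 2. In this form it
  is linear in the quantities that the one-dimensional inequality produces, and C does not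
  occur.\<close>

definition gap :: "'i \<Rightarrow> 'v \<Rightarrow> real" where
  "gap i f = 2 * N f - 2 * N (A i f) - N (B i f)"

lemma gap_eq: "f \<in> V \<Longrightarrow> gap i f = N (B i f) + 2 * N (C i f)"
  unfolding gap_def using split[of f i] by linarith

lemma gap_nonneg: "f \<in> V \<Longrightarrow> 0 \<le> gap i f"
  by (simp add: gap_eq nonneg closed)

text \<open>Operators belonging to different coordinates commute, so the splitting along j can be
  applied to A i f and B i f as well as to f.\<close>

lemma gap_split:
  assumes "i \<noteq> j" "f \<in> V"
  shows "gap i f = gap i (A j f) + gap i (B j f) + gap i (C j f)"
proof -
  have "N (A i f) = N (A i (A j f)) + N (A i (B j f)) + N (A i (C j f))"
    using split[of "A i f" j] commute[OF assms] assms closed by simp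
  moreover have "N (B i f) = N (B i (A j f)) + N (B i (B j f)) + N (B i (C j f))"
    using split[of "B i f" j] commute[OF assms] commute(2)[OF assms(1)[symmetric] assms(2)] assms closed by simp
  ultimately show ?thesis
    unfolding gap_def using split[OF assms(2), of j] by linarith
qed

lemma sum_gap_split:
  assumes "j \<notin> S" "f \<in> V"
  shows "(\<Sum>i\<in>S. gap i f) = (\<Sum>i\<in>S. gap i (A j f)) + (\<Sum>i\<in>S. gap i (B j f)) + (\<Sum>i\<in>S. gap i (C j f))"
  unfolding sum.distrib[symmetric] using assms by (intro sum.cong gap_split) auto

text \<open>Along the head coordinate j, the part A j f is left to the induction, while B j f and C
  j f already receive at least their own norm from the gap in j.\<close>

lemma sum_gap_ge_first:
  "distinct l \<Longrightarrow> f \<in> V \<Longrightarrow> N f - N (proj l f) \<le> (\<Sum>i\<in>set l. gap i f)"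
proof (induction l arbitrary: f)
  case (Cons j l)
  have "N (A j f) - N (proj l (A j f)) \<le> (\<Sum>i\<in>set l. gap i (A j f))"
    using Cons closed by auto
  moreover have "0 \<le> (\<Sum>i\<in>set l. gap i (B j f))" "0 \<le> (\<Sum>i\<in>set l. gap i (C j f))"
    using Cons closed by (auto intro!: sum_nonneg gap_nonneg)
  moreover have "0 \<le> N (C j f)" using Cons closed nonneg by auto
  ultimately show ?case
    using Cons.prems sum_gap_split[of j "set l" f] split[of f j] by (simp add: gap_eq)
qed simp

text \<open>On B j f the gap in j contributes 1 and the remaining coordinates contribute another 1,
  except on the component where they are all at level 0; that component is the new summand of
  \<open>first_level\<close>. On C j f the gap in j alone contributes 2.\<close>

lemma sum_gap_ge_second:
  "distinct l \<Longrightarrow> f \<in> V \<Longrightarrow> 2 * N f - 2 * N (proj l f) - first_level l f \<le> (\<Sum>i\<in>set l. gap i f)"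
proof (induction l arbitrary: f)
  case (Cons j l)
  have "2 * N (A j f) - 2 * N (proj l (A j f)) - first_level l (A j f) \<le> (\<Sum>i\<in>set l. gap i (A j f))"
    using Cons closed by auto
  moreover have "N (B j f) - N (proj l (B j f)) \<le> (\<Sum>i\<in>set l. gap i (B j f))"
    using Cons closed by (intro sum_gap_ge_first) auto
  moreover have "0 \<le> (\<Sum>i\<in>set l. gap i (C j f))"
    using Cons closed by (auto intro!: sum_nonneg gap_nonneg)
  ultimately show ?case
    using Cons.prems sum_gap_split[of j "set l" f] split[of f j] by (simp add: gap_eq)
qed simp

end

section \<open>Coordinate projections on functions of linear growth in each variable\<close>

text \<open>The bound is a product over the coordinates because this survives the projections:
  integrating out x_i removes one factor, and multiplying by x_i puts it back. It also contains the
  bounded functions and the coordinates.\<close>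

definition Vlin :: "(real^'n::finite \<Rightarrow> real) set" where
  "Vlin = {f. f \<in> borel_measurable borel \<and> (\<exists>C. \<forall>x. \<bar>f x\<bar> \<le> C * (\<Prod>j\<in>UNIV. 1 + \<bar>x $ j\<bar>))}"

lemma VlinI: "f \<in> borel_measurable borel \<Longrightarrow> (\<And>x. \<bar>f x\<bar> \<le> C * (\<Prod>j\<in>UNIV. 1 + \<bar>x $ j\<bar>)) \<Longrightarrow> f \<in> Vlin"
  unfolding Vlin_def by blast

lemma Vlin_measurable: "f \<in> Vlin \<Longrightarrow> f \<in> borel_measurable borel"
  unfolding Vlin_def by blast

lemma prod_growth_ge1: "1 \<le> (\<Prod>j\<in>S. 1 + \<bar>x $ j\<bar>)" for x :: "real^'n::finite"
  by (rule prod_ge_1) auto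

lemma VlinE:
  assumes "f \<in> Vlin"
  obtains C where "0 \<le> C" "\<And>x. \<bar>f x\<bar> \<le> C * (\<Prod>j\<in>UNIV. 1 + \<bar>x $ j\<bar>)"
proof -
  obtain C where C: "\<And>x. \<bar>f x\<bar> \<le> C * (\<Prod>j\<in>UNIV. 1 + \<bar>x $ j\<bar>)"
    using assms unfolding Vlin_def by blast
  have "\<bar>f x\<bar> \<le> max C 0 * (\<Prod>j\<in>UNIV. 1 + \<bar>x $ j\<bar>)" for x
    by (rule order_trans[OF C mult_right_mono]) (use prod_growth_ge1[of x UNIV] in auto)
  then show ?thesis by (intro that[of "max C 0"]) auto
qed

lemma prod_growth_upd:
  "(\<Prod>j\<in>UNIV. 1 + \<bar>upd x i t $ j\<bar>) = (\<Prod>j\<in>UNIV - {i}. 1 + \<bar>x $ j\<bar>) * (1 + \<bar>t\<bar>)"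
  by (auto simp: prod.remove[of UNIV i] mult.commute intro!: prod.cong arg_cong2[where f="(*)"])

lemma prod_growth_le: "(\<Prod>j\<in>UNIV - {i}. 1 + \<bar>x $ j\<bar>) \<le> (\<Prod>j\<in>UNIV. 1 + \<bar>x $ j\<bar>)" for x :: "real^'n::finite"
proof -
  have "1 * (\<Prod>j\<in>UNIV - {i}. 1 + \<bar>x $ j\<bar>) \<le> (1 + \<bar>x $ i\<bar>) * (\<Prod>j\<in>UNIV - {i}. 1 + \<bar>x $ j\<bar>)"
    using prod_growth_ge1[of x "UNIV - {i}"] by (intro mult_right_mono) auto
  then show ?thesis by (simp add: prod.remove[of UNIV i])
qed

lemma prod_growth_eq: "(1 + \<bar>x $ i\<bar>) * (\<Prod>j\<in>UNIV - {i}. 1 + \<bar>x $ j\<bar>) = (\<Prod>j\<in>UNIV. 1 + \<bar>x $ j\<bar>)" for x :: "real^'n::finite"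
  by (simp add: prod.remove[of UNIV i])

lemma Vlin_diff:
  assumes "f \<in> Vlin" "g \<in> Vlin" shows "(\<lambda>x. f x - g x) \<in> Vlin"
proof -
  obtain C D where C: "\<And>x. \<bar>f x\<bar> \<le> C * (\<Prod>j\<in>UNIV. 1 + \<bar>x $ j\<bar>)" and D: "\<And>x. \<bar>g x\<bar> \<le> D * (\<Prod>j\<in>UNIV. 1 + \<bar>x $ j\<bar>)"
    using VlinE[OF assms(1)] VlinE[OF assms(2)] by metis
  have [measurable]: "f \<in> borel_measurable borel" "g \<in> borel_measurable borel"
    using assms by (auto intro: Vlin_measurable)
  have "\<bar>f x - g x\<bar> \<le> (C + D) * (\<Prod>j\<in>UNIV. 1 + \<bar>x $ j\<bar>)" for x
    using C[of x] D[of x] unfolding distrib_right by linarith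
  then show ?thesis by (intro VlinI) auto
qed

lemma Vlin_const: "(\<lambda>_ :: real^'n::finite. c) \<in> Vlin"
proof (rule VlinI[where C="\<bar>c\<bar>"])
  fix x :: "real^'n"
  show "\<bar>c\<bar> \<le> \<bar>c\<bar> * (\<Prod>j\<in>UNIV. 1 + \<bar>x $ j\<bar>)"
    using mult_left_mono[OF prod_growth_ge1[of x UNIV], of "\<bar>c\<bar>"] by simp
qed simp

lemma Vlin_nth: "(\<lambda>x :: real^'n::finite. x $ i) \<in> Vlin"
proof (rule VlinI[where C=1])
  fix x :: "real^'n"
  have "1 + \<bar>x $ i\<bar> \<le> (1 + \<bar>x $ i\<bar>) * (\<Prod>j\<in>UNIV - {i}. 1 + \<bar>x $ j\<bar>)"
    using mult_left_mono[OF prod_growth_ge1[of x "UNIV - {i}"], of "1 + \<bar>x $ i\<bar>"] by simp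
  then show "\<bar>x $ i\<bar> \<le> 1 * (\<Prod>j\<in>UNIV. 1 + \<bar>x $ j\<bar>)" unfolding prod_growth_eq by linarith
qed simp

lemma Vlin_fibre:
  assumes "f \<in> Vlin"
  obtains C where "0 \<le> C" "\<And>t. \<bar>f (upd x i t)\<bar> \<le> C * (1 + \<bar>t\<bar>)"
proof -
  obtain C where "0 \<le> C" and C: "\<And>x. \<bar>f x\<bar> \<le> C * (\<Prod>j\<in>UNIV. 1 + \<bar>x $ j\<bar>)"
    using VlinE[OF assms] by metis
  have "0 \<le> C * (\<Prod>j\<in>UNIV - {i}. 1 + \<bar>x $ j\<bar>)"
    using \<open>0 \<le> C\<close> prod_growth_ge1[of x "UNIV - {i}"] by simp
  with that show ?thesis
    using C[of "upd x i _"] unfolding prod_growth_upd by (metis mult.assoc)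
qed

locale weight =
  fixes \<alpha> :: "'n::finite \<Rightarrow> real"
  assumes \<alpha>: "\<forall>i. 0 \<le> \<alpha> i"
begin

sublocale M: prob_space "mu \<alpha>"
  by (rule prob_space_mu[OF \<alpha>])

sublocale nu: prob_space "nu (\<alpha> i)" for i
  using \<alpha> by (simp add: prob_space_nu)

lemma \<alpha>': "0 \<le> \<alpha> i"
  using \<alpha> by simp

lemma integrable_fibre:
  assumes f: "f \<in> Vlin" and p: "p \<in> borel_measurable borel" "\<And>t. \<bar>p t\<bar> \<le> 1 + \<bar>t\<bar>"
  shows "integrable (nu (\<alpha> i)) (\<lambda>t. p t * f (upd x i t))"
proof -
  note [measurable] = p(1) Vlin_measurable[OF f]
  obtain C where C: "\<And>t. \<bar>f (upd x i t)\<bar> \<le> C * (1 + \<bar>t\<bar>)" using Vlin_fibre[OF f] by metis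
  have "\<bar>p t * f (upd x i t)\<bar> \<le> C * (1 + \<bar>t\<bar>) ^ 2" for t
  proof -
    have "\<bar>p t\<bar> * \<bar>f (upd x i t)\<bar> \<le> (1 + \<bar>t\<bar>) * (C * (1 + \<bar>t\<bar>))" by (intro mult_mono C p) auto
    then show ?thesis by (simp add: abs_mult power2_eq_square mult_ac)
  qed
  then show ?thesis by (intro integrable_nu[OF \<alpha>']) auto
qed

lemma integrable_fibre_simps:
  assumes f: "f \<in> Vlin"
  shows "integrable (nu (\<alpha> i)) (\<lambda>t. f (upd x i t))" "integrable (nu (\<alpha> i)) (\<lambda>t. t * f (upd x i t))"
    "integrable (nu (\<alpha> i)) (\<lambda>t. (f (upd x i t))\<^sup>2)"
proof -
  note [measurable] = Vlin_measurable[OF f]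
  show "integrable (nu (\<alpha> i)) (\<lambda>t. f (upd x i t))"
    using integrable_fibre[OF f, of "\<lambda>_. 1"] by simp
  show "integrable (nu (\<alpha> i)) (\<lambda>t. t * f (upd x i t))"
    using integrable_fibre[OF f, of "\<lambda>t. t"] by simp
  obtain C where C: "\<And>t. \<bar>f (upd x i t)\<bar> \<le> C * (1 + \<bar>t\<bar>)" using Vlin_fibre[OF f] by metis
  have "\<bar>(f (upd x i t))\<^sup>2\<bar> \<le> C\<^sup>2 * (1 + \<bar>t\<bar>)\<^sup>2" for t
    using power_mono[OF C[of t], of 2] by (simp add: power_mult_distrib)
  then show "integrable (nu (\<alpha> i)) (\<lambda>t. (f (upd x i t))\<^sup>2)"
    by (intro integrable_nu[OF \<alpha>']) auto
qed

lemma integrable_Vlin_mult: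
  assumes f: "f \<in> Vlin" and g: "g \<in> Vlin"
  shows "integrable (mu \<alpha>) (\<lambda>x. f x * g x)"
proof -
  note [measurable] = Vlin_measurable[OF f] Vlin_measurable[OF g]
  obtain C D where C0: "0 \<le> C" and C: "\<And>x. \<bar>f x\<bar> \<le> C * (\<Prod>j\<in>UNIV. 1 + \<bar>x $ j\<bar>)" and D: "\<And>x. \<bar>g x\<bar> \<le> D * (\<Prod>j\<in>UNIV. 1 + \<bar>x $ j\<bar>)"
    using VlinE[OF f] VlinE[OF g] by metis
  have "integrable (mu \<alpha>) (\<lambda>x. \<Prod>j\<in>UNIV. (1 + \<bar>x $ j\<bar>)\<^sup>2)"
    by (intro integrable_mu_prod[OF \<alpha>] integrable_nu[OF \<alpha>', where C=1 and k=2]) auto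
  then have "integrable (mu \<alpha>) (\<lambda>x. C * D * (\<Prod>j\<in>UNIV. (1 + \<bar>x $ j\<bar>)\<^sup>2))" by simp
  then show ?thesis
  proof (rule Bochner_Integration.integrable_bound)
    show "AE x in mu \<alpha>. norm (f x * g x) \<le> norm (C * D * (\<Prod>j\<in>UNIV. (1 + \<bar>x $ j\<bar>)\<^sup>2))"
    proof (rule AE_I2)
      fix x :: "real^'n"
      have "\<bar>f x\<bar> * \<bar>g x\<bar> \<le> (C * (\<Prod>j\<in>UNIV. 1 + \<bar>x $ j\<bar>)) * (D * (\<Prod>j\<in>UNIV. 1 + \<bar>x $ j\<bar>))"
        using C0 prod_growth_ge1[of x UNIV] by (intro mult_mono C D) auto
      also have "\<dots> = C * D * (\<Prod>j\<in>UNIV. (1 + \<bar>x $ j\<bar>)\<^sup>2)"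
        by (simp add: power2_eq_square prod.distrib)
      finally show "norm (f x * g x) \<le> norm (C * D * (\<Prod>j\<in>UNIV. (1 + \<bar>x $ j\<bar>)\<^sup>2))"
        unfolding real_norm_def abs_mult[symmetric] by linarith
    qed
  qed simp
qed

lemma integrable_Vlin:
  assumes f: "f \<in> Vlin"
  shows "integrable (mu \<alpha>) f" "integrable (mu \<alpha>) (\<lambda>x. (f x)\<^sup>2)" "integrable (mu \<alpha>) (\<lambda>x. x $ i * f x)"
  using integrable_Vlin_mult[OF f Vlin_const[of 1]] integrable_Vlin_mult[OF f f] integrable_Vlin_mult[OF Vlin_nth f]
  by (simp_all add: power2_eq_square)

text \<open>For p = 1 this is the conditional expectation given the other coordinates. For p(t) = t
  and a Gaussian coordinate it is the first Hermite coefficient along the line through x.\<close>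

definition fibre :: "'n \<Rightarrow> (real \<Rightarrow> real) \<Rightarrow> (real^'n \<Rightarrow> real) \<Rightarrow> real^'n \<Rightarrow> real" where
  "fibre i p f x = (\<integral>t. p t * f (upd x i t) \<partial>nu (\<alpha> i))"

lemma fibre_indep: "fibre i p f (upd x i t) = fibre i p f x"
  by (simp add: fibre_def)

lemma fibre_measurable:
  assumes "f \<in> borel_measurable borel" "p \<in> borel_measurable borel"
  shows "fibre i p f \<in> borel_measurable borel"
proof -
  note [measurable] = assms
  have "(\<lambda>x. \<integral>t. (\<lambda>y. p (y $ i) * f y) (upd x i t) \<partial>nu (\<alpha> i)) \<in> borel_measurable borel"
    by (rule borel_measurable_integral_upd[OF \<alpha>]) measurable
  then show ?thesis by (simp add: fibre_def[abs_def])
qed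

text \<open>The missing factor at i leaves room for a later multiplication by x_i. The constant is a
  second moment, one power of 1 + |t| coming from f and one from p.\<close>

lemma fibre_bound:
  assumes f: "f \<in> Vlin" and p: "p \<in> borel_measurable borel" "\<And>t. \<bar>p t\<bar> \<le> 1 + \<bar>t\<bar>"
  obtains C where "0 \<le> C" "\<And>x. \<bar>fibre i p f x\<bar> \<le> C * (\<Prod>j\<in>UNIV - {i}. 1 + \<bar>x $ j\<bar>)"
proof -
  note [measurable] = p(1) Vlin_measurable[OF f]
  obtain C where C0: "0 \<le> C" and C: "\<And>x. \<bar>f x\<bar> \<le> C * (\<Prod>j\<in>UNIV. 1 + \<bar>x $ j\<bar>)"
    using VlinE[OF f] by metis
  let ?m = "\<integral>t. (1 + \<bar>t\<bar>)\<^sup>2 \<partial>nu (\<alpha> i)"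
  have im: "integrable (nu (\<alpha> i)) (\<lambda>t. (1 + \<bar>t\<bar>)\<^sup>2)"
    by (rule integrable_nu[OF \<alpha>', where C=1 and k=2]) auto
  have "\<bar>fibre i p f x\<bar> \<le> C * ?m * (\<Prod>j\<in>UNIV - {i}. 1 + \<bar>x $ j\<bar>)" for x
  proof -
    let ?P = "\<Prod>j\<in>UNIV - {i}. 1 + \<bar>x $ j\<bar>"
    have "\<bar>fibre i p f x\<bar> \<le> (\<integral>t. \<bar>p t * f (upd x i t)\<bar> \<partial>nu (\<alpha> i))"
      unfolding fibre_def using integral_norm_bound[of "nu (\<alpha> i)" "\<lambda>t. p t * f (upd x i t)"] by simp
    also have "\<dots> \<le> (\<integral>t. C * ?P * (1 + \<bar>t\<bar>)\<^sup>2 \<partial>nu (\<alpha> i))"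
    proof (rule integral_mono)
      fix t
      have "\<bar>p t\<bar> * \<bar>f (upd x i t)\<bar> \<le> (1 + \<bar>t\<bar>) * (C * (?P * (1 + \<bar>t\<bar>)))"
        using C[of "upd x i t"] unfolding prod_growth_upd by (intro mult_mono p) auto
      then show "\<bar>p t * f (upd x i t)\<bar> \<le> C * ?P * (1 + \<bar>t\<bar>)\<^sup>2"
        by (simp add: abs_mult power2_eq_square mult_ac)
    qed (use integrable_fibre[OF f p] im in auto)
    finally show ?thesis by (simp add: mult_ac)
  qed
  moreover have "0 \<le> ?m" by simp
  ultimately show ?thesis using that[of "C * ?m"] C0 by simp
qed

lemma fibre_Vlin:
  assumes f: "f \<in> Vlin" and p: "p \<in> borel_measurable borel" "\<And>t. \<bar>p t\<bar> \<le> 1 + \<bar>t\<bar>"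
  shows "fibre i p f \<in> Vlin" "(\<lambda>x. x $ i * fibre i p f x) \<in> Vlin"
proof -
  note [measurable] = fibre_measurable[OF Vlin_measurable[OF f] p(1)]
  obtain C where C0: "0 \<le> C" and C: "\<And>x. \<bar>fibre i p f x\<bar> \<le> C * (\<Prod>j\<in>UNIV - {i}. 1 + \<bar>x $ j\<bar>)"
    using fibre_bound[OF f p, where i=i] by blast
  show "fibre i p f \<in> Vlin"
    using order_trans[OF C mult_left_mono[OF prod_growth_le C0]] by (intro VlinI) auto
  show "(\<lambda>x. x $ i * fibre i p f x) \<in> Vlin"
  proof (rule VlinI)
    fix x :: "real^'n"
    have "\<bar>x $ i\<bar> * \<bar>fibre i p f x\<bar> \<le> (1 + \<bar>x $ i\<bar>) * (C * (\<Prod>j\<in>UNIV - {i}. 1 + \<bar>x $ j\<bar>))"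
      by (intro mult_mono C) auto
    also have "\<dots> = C * (\<Prod>j\<in>UNIV. 1 + \<bar>x $ j\<bar>)"
      unfolding prod_growth_eq[of x i, symmetric] by simp
    finally show "\<bar>x $ i * fibre i p f x\<bar> \<le> C * (\<Prod>j\<in>UNIV. 1 + \<bar>x $ j\<bar>)" by (simp add: abs_mult)
  qed measurable
qed

text \<open>Fubini on the two-dimensional section of f spanned by the coordinates i and j.\<close>

lemma fibre_commute:
  assumes ij: "i \<noteq> j" and f: "f \<in> Vlin"
    and p: "p \<in> borel_measurable borel" "\<And>t. \<bar>p t\<bar> \<le> 1 + \<bar>t\<bar>"
    and q: "q \<in> borel_measurable borel" "\<And>t. \<bar>q t\<bar> \<le> 1 + \<bar>t\<bar>"
  shows "fibre j q (fibre i p f) = fibre i p (fibre j q f)"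
proof
  fix x
  interpret pair_sigma_finite "nu (\<alpha> j)" "nu (\<alpha> i)" ..
  note [measurable] = p(1) q(1) Vlin_measurable[OF f]
  let ?F = "\<lambda>st. q (fst st) * (p (snd st) * f (upd (upd x j (fst st)) i (snd st)))"
  have "upd (upd x j s) i t = (\<chi> k. if k = i then t else if k = j then s else x $ k)" for s t
    by (simp add: vec_eq_iff)
  then have up: "(\<lambda>st. upd (upd x j (fst st)) i (snd st)) \<in> borel \<Otimes>\<^sub>M borel \<rightarrow>\<^sub>M borel"
    by (simp, intro measurable_vec_lambda) (simp split: if_splits)
  have F: "?F \<in> borel_measurable (borel \<Otimes>\<^sub>M borel)"
    using up by measurable
  obtain C where C0: "0 \<le> C" and C: "\<And>x. \<bar>fibre i (\<lambda>t. \<bar>p t\<bar>) (\<lambda>x. \<bar>f x\<bar>) x\<bar> \<le> C * (\<Prod>j\<in>UNIV - {i}. 1 + \<bar>x $ j\<bar>)"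
  proof (rule fibre_bound[of "\<lambda>x. \<bar>f x\<bar>" "\<lambda>t. \<bar>p t\<bar>" i])
    show "(\<lambda>x. \<bar>f x\<bar>) \<in> Vlin" using f by (auto simp: Vlin_def)
  qed (use p in auto)
  have int: "integrable (nu (\<alpha> j) \<Otimes>\<^sub>M nu (\<alpha> i)) ?F"
  proof (rule Fubini_integrable)
    show "?F \<in> borel_measurable (nu (\<alpha> j) \<Otimes>\<^sub>M nu (\<alpha> i))" using F by measurable
    have af: "(\<lambda>x. \<bar>f x\<bar>) \<in> Vlin" using f by (auto simp: Vlin_def)
    \<comment> \<open>Absolute integrability comes from the same estimates: the inner integral of
      the absolute value is again a \<open>fibre\<close>, taken of |f| against |p|, hence of linear
      growth.\<close>
    have "fibre i (\<lambda>t. \<bar>p t\<bar>) (\<lambda>x. \<bar>f x\<bar>) \<in> Vlin"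
      by (rule fibre_Vlin[OF af]) (use p in auto)
    from integrable_fibre[OF this, of "\<lambda>t. \<bar>q t\<bar>" j x]
    have "integrable (nu (\<alpha> j)) (\<lambda>s. \<bar>q s\<bar> * fibre i (\<lambda>t. \<bar>p t\<bar>) (\<lambda>x. \<bar>f x\<bar>) (upd x j s))"
      using q by simp
    then show "integrable (nu (\<alpha> j)) (\<lambda>s. \<integral>t. norm (?F (s, t)) \<partial>nu (\<alpha> i))"
      by (simp add: fibre_def abs_mult)
    show "AE s in nu (\<alpha> j). integrable (nu (\<alpha> i)) (\<lambda>t. ?F (s, t))"
      using integrable_fibre[OF f p] by simp
  qed
  have "fibre j q (fibre i p f) x = (\<integral>s. \<integral>t. ?F (s, t) \<partial>nu (\<alpha> i) \<partial>nu (\<alpha> j))"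
    by (simp add: fibre_def)
  also have "\<dots> = (\<integral>t. \<integral>s. ?F (s, t) \<partial>nu (\<alpha> j) \<partial>nu (\<alpha> i))"
    using Fubini_integral[of "\<lambda>s t. ?F (s, t)"] int by (simp add: split_beta')
  also have "\<dots> = fibre i p (fibre j q f) x"
  proof -
    have "?F (s, t) = p t * (q s * f (upd (upd x i t) j s))" for s t
      using upd_commute[OF ij, of x t s] by simp
    then show ?thesis by (simp only: fibre_def integral_mult_right_zero)
  qed
  finally show "fibre j q (fibre i p f) x = fibre i p (fibre j q f) x" .
qed

lemma fibre_mult_nth: "i \<noteq> j \<Longrightarrow> fibre i p (\<lambda>x. x $ j * f x) x = x $ j * fibre i p f x"
  by (simp add: fibre_def mult.left_commute[of _ "x $ j"])

lemma fibre_diff: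
  assumes "f \<in> Vlin" "g \<in> Vlin" and p: "p \<in> borel_measurable borel" "\<And>t. \<bar>p t\<bar> \<le> 1 + \<bar>t\<bar>"
  shows "fibre i p (\<lambda>x. f x - g x) x = fibre i p f x - fibre i p g x"
  unfolding fibre_def right_diff_distrib
  by (intro Bochner_Integration.integral_diff integrable_fibre assms)

definition Aop :: "'n \<Rightarrow> (real^'n \<Rightarrow> real) \<Rightarrow> real^'n \<Rightarrow> real" where
  "Aop i f = fibre i (\<lambda>_. 1) f"

text \<open>Projection onto the span of x_i along the line. For \<alpha> i > 0 the factor has no
  eigenvalue strictly between 0 and 2, so level 1 is empty and the operator is 0.\<close>

definition Bop :: "'n \<Rightarrow> (real^'n \<Rightarrow> real) \<Rightarrow> real^'n \<Rightarrow> real" where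
  "Bop i f x = (if \<alpha> i = 0 then x $ i * fibre i (\<lambda>t. t) f x else 0)"

definition Cop :: "'n \<Rightarrow> (real^'n \<Rightarrow> real) \<Rightarrow> real^'n \<Rightarrow> real" where
  "Cop i f x = (f x - Aop i f x) - Bop i f x"

definition Nsq :: "(real^'n \<Rightarrow> real) \<Rightarrow> real" where
  "Nsq f = (\<integral>x. (f x)\<^sup>2 \<partial>mu \<alpha>)"

lemma Aop_Vlin: "f \<in> Vlin \<Longrightarrow> Aop i f \<in> Vlin"
  unfolding Aop_def by (rule fibre_Vlin) auto

lemma Bop_Vlin: "f \<in> Vlin \<Longrightarrow> Bop i f \<in> Vlin"
  using fibre_Vlin(2)[of f "\<lambda>t. t" i] Vlin_const[of 0] by (cases "\<alpha> i = 0") (simp_all add: Bop_def[abs_def])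

lemma Cop_Vlin: "f \<in> Vlin \<Longrightarrow> Cop i f \<in> Vlin"
  unfolding Cop_def[abs_def] by (intro Vlin_diff Aop_Vlin Bop_Vlin)

lemma Nsq_fubini:
  assumes "f \<in> Vlin"
  shows "Nsq f = (\<integral>x. (\<integral>t. (f (upd x i t))\<^sup>2 \<partial>nu (\<alpha> i)) \<partial>mu \<alpha>)"
    and "integrable (mu \<alpha>) (\<lambda>x. \<integral>t. (f (upd x i t))\<^sup>2 \<partial>nu (\<alpha> i))"
  using mu_fubini[OF \<alpha> integrable_Vlin(2)[OF assms], of i] by (simp_all add: Nsq_def)

lemma Bop_fibre_sq:
  "(\<integral>t. (Bop i f (upd x i t))\<^sup>2 \<partial>nu (\<alpha> i)) = (if \<alpha> i = 0 then (fibre i (\<lambda>t. t) f x)\<^sup>2 else 0)"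
  by (simp add: Bop_def fibre_indep power_mult_distrib nu_0_moments)

lemma Aop_fibre_sq: "(\<integral>t. (Aop i f (upd x i t))\<^sup>2 \<partial>nu (\<alpha> i)) = (Aop i f x)\<^sup>2"
  using nu.prob_space[of i] by (simp add: Aop_def fibre_indep)

text \<open>Pythagoras on a single line: 1 and t are orthonormal for the Gaussian factor, and only 1
  is subtracted for the others.\<close>

lemma Cop_fibre_sq:
  assumes f: "f \<in> Vlin"
  shows "(\<integral>t. (Cop i f (upd x i t))\<^sup>2 \<partial>nu (\<alpha> i)) = (\<integral>t. (f (upd x i t))\<^sup>2 \<partial>nu (\<alpha> i))
    - (Aop i f x)\<^sup>2 - (if \<alpha> i = 0 then (fibre i (\<lambda>t. t) f x)\<^sup>2 else 0)"
proof -
  define m where "m = Aop i f x"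
  define k where "k = (if \<alpha> i = 0 then fibre i (\<lambda>t. t) f x else 0)"
  let ?f = "\<lambda>t. f (upd x i t)"
  note int = integrable_fibre_simps[OF f, of i x]
  have it: "integrable (nu (\<alpha> i)) (\<lambda>t. t)" "integrable (nu (\<alpha> i)) (\<lambda>t. t\<^sup>2)"
    using integrable_nu_power[OF \<alpha>'[of i], of 1] integrable_nu_power[OF \<alpha>'[of i], of 2] by simp_all
  have "(Cop i f (upd x i t))\<^sup>2 = (?f t)\<^sup>2 - 2 * m * ?f t - 2 * k * (t * ?f t) + m\<^sup>2 + 2 * m * k * t + k\<^sup>2 * t\<^sup>2" for t
    unfolding Cop_def Bop_def Aop_def m_def k_def
    by (simp add: fibre_indep power2_eq_square algebra_simps)
  then have "(\<integral>t. (Cop i f (upd x i t))\<^sup>2 \<partial>nu (\<alpha> i))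
     = (\<integral>t. (?f t)\<^sup>2 \<partial>nu (\<alpha> i)) - 2 * m * (\<integral>t. ?f t \<partial>nu (\<alpha> i)) - 2 * k * (\<integral>t. t * ?f t \<partial>nu (\<alpha> i))
      + m\<^sup>2 + 2 * m * k * (\<integral>t. t \<partial>nu (\<alpha> i)) + k\<^sup>2 * (\<integral>t. t\<^sup>2 \<partial>nu (\<alpha> i))"
    using int it nu.prob_space[of i] by simp
  also have "(\<integral>t. ?f t \<partial>nu (\<alpha> i)) = m" by (simp add: m_def Aop_def fibre_def)
  also have "2 * k * (\<integral>t. t * ?f t \<partial>nu (\<alpha> i)) = 2 * k * k" by (simp add: k_def fibre_def)
  also have "2 * m * k * (\<integral>t. t \<partial>nu (\<alpha> i)) = 0" by (simp add: k_def nu_0_moments)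
  also have "k\<^sup>2 * (\<integral>t. t\<^sup>2 \<partial>nu (\<alpha> i)) = k\<^sup>2" by (simp add: k_def nu_0_moments)
  finally show ?thesis unfolding m_def[symmetric] by (simp add: power2_eq_square k_def split: if_splits)
qed

lemma Nsq_split:
  assumes f: "f \<in> Vlin"
  shows "Nsq f = Nsq (Aop i f) + Nsq (Bop i f) + Nsq (Cop i f)"
proof -
  note fub = Nsq_fubini[OF f, of i] Nsq_fubini[OF Aop_Vlin[OF f, of i], of i]
    Nsq_fubini[OF Bop_Vlin[OF f, of i], of i] Nsq_fubini[OF Cop_Vlin[OF f, of i], of i]
  have "(\<integral>t. (f (upd x i t))\<^sup>2 \<partial>nu (\<alpha> i)) = (\<integral>t. (Aop i f (upd x i t))\<^sup>2 \<partial>nu (\<alpha> i))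
      + (\<integral>t. (Bop i f (upd x i t))\<^sup>2 \<partial>nu (\<alpha> i)) + (\<integral>t. (Cop i f (upd x i t))\<^sup>2 \<partial>nu (\<alpha> i))" for x
    by (simp add: Aop_fibre_sq Bop_fibre_sq Cop_fibre_sq[OF f])
  then show ?thesis using fub by simp
qed

lemma Aop_diff: "f \<in> Vlin \<Longrightarrow> g \<in> Vlin \<Longrightarrow> Aop i (\<lambda>x. f x - g x) = (\<lambda>x. Aop i f x - Aop i g x)"
  unfolding Aop_def by (rule ext, rule fibre_diff) auto

lemma Bop_diff: "f \<in> Vlin \<Longrightarrow> g \<in> Vlin \<Longrightarrow> Bop i (\<lambda>x. f x - g x) = (\<lambda>x. Bop i f x - Bop i g x)"
  by (auto simp: Bop_def fun_eq_iff fibre_diff right_diff_distrib)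

lemma Aop_commute: "i \<noteq> j \<Longrightarrow> f \<in> Vlin \<Longrightarrow> Aop j (Aop i f) = Aop i (Aop j f)"
  unfolding Aop_def by (rule fibre_commute) auto

lemma fibre_zero: "fibre i p (\<lambda>x. 0) = (\<lambda>_. 0)"
  by (simp add: fibre_def fun_eq_iff)

lemma Bop_Aop_commute:
  assumes "i \<noteq> j" "f \<in> Vlin" shows "Bop j (Aop i f) = Aop i (Bop j f)"
proof (cases "\<alpha> j = 0")
  case True
  have "Bop j (Aop i f) x = x $ j * fibre j (\<lambda>t. t) (fibre i (\<lambda>_. 1) f) x" for x
    using True by (simp add: Bop_def Aop_def)
  moreover have "Aop i (Bop j f) x = x $ j * fibre i (\<lambda>_. 1) (fibre j (\<lambda>t. t) f) x" for x
    using True assms(1) by (simp add: Bop_def[abs_def] Aop_def fibre_mult_nth)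
  moreover have "fibre j (\<lambda>t. t) (fibre i (\<lambda>_. 1) f) = fibre i (\<lambda>_. 1) (fibre j (\<lambda>t. t) f)"
    by (rule fibre_commute[OF assms]) auto
  ultimately show ?thesis by (simp add: fun_eq_iff)
next
  case False
  then show ?thesis by (simp add: Bop_def[abs_def] Aop_def fun_eq_iff fibre_zero)
qed

lemma Bop_commute:
  assumes "i \<noteq> j" "f \<in> Vlin" shows "Bop j (Bop i f) = Bop i (Bop j f)"
proof (cases "\<alpha> i = 0 \<and> \<alpha> j = 0")
  case True
  have "Bop j (Bop i f) x = x $ j * (x $ i * fibre j (\<lambda>t. t) (fibre i (\<lambda>t. t) f) x)" for x
    using True assms(1)[symmetric] by (simp add: Bop_def[abs_def] fibre_mult_nth)
  moreover have "Bop i (Bop j f) x = x $ i * (x $ j * fibre i (\<lambda>t. t) (fibre j (\<lambda>t. t) f) x)" for x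
    using True assms(1) by (simp add: Bop_def[abs_def] fibre_mult_nth)
  moreover have "fibre j (\<lambda>t. t) (fibre i (\<lambda>t. t) f) = fibre i (\<lambda>t. t) (fibre j (\<lambda>t. t) f)"
    by (rule fibre_commute[OF assms]) auto
  ultimately show ?thesis by (simp add: fun_eq_iff)
next
  case False
  then show ?thesis by (auto simp: Bop_def[abs_def] fun_eq_iff fibre_zero)
qed

sublocale cs: commuting_splits Vlin Aop Bop Cop Nsq
proof
  fix f :: "real^'n \<Rightarrow> real" and i j :: 'n assume f: "f \<in> Vlin"
  show "Aop i f \<in> Vlin" "Bop i f \<in> Vlin" "Cop i f \<in> Vlin"
    using f by (simp_all add: Aop_Vlin Bop_Vlin Cop_Vlin)
  show "0 \<le> Nsq f" by (simp add: Nsq_def)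
  show "Nsq f = Nsq (Aop i f) + Nsq (Bop i f) + Nsq (Cop i f)" by (rule Nsq_split[OF f])
  assume ij: "i \<noteq> j"
  show "Aop j (Aop i f) = Aop i (Aop j f)" "Bop j (Aop i f) = Aop i (Bop j f)" "Bop j (Bop i f) = Bop i (Bop j f)"
    using ij f by (rule Aop_commute Bop_Aop_commute Bop_commute)+
  \<comment> \<open>C is f - A f - B f, so its commutation follows from that of A and B together
    with their linearity.\<close>
  note V = Vlin_diff[OF f Aop_Vlin[OF f]] Bop_Vlin[OF f]
  show "Cop j (Aop i f) = Aop i (Cop j f)"
    unfolding Cop_def[abs_def] Aop_diff[OF V] Aop_diff[OF f Aop_Vlin[OF f]]
      Aop_commute[OF ij f] Bop_Aop_commute[OF ij f] ..
  show "Cop j (Bop i f) = Bop i (Cop j f)"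
    unfolding Cop_def[abs_def] Bop_diff[OF V] Bop_diff[OF f Aop_Vlin[OF f]]
      Bop_commute[OF ij f] Bop_Aop_commute[OF ij[symmetric] f] ..
qed

end

section \<open>The eigenvalue bound for the product measure\<close>

lemma continuous_upd: "continuous_on UNIV (\<lambda>t. upd x i t)"
proof -
  have "continuous_on UNIV (\<lambda>t. if j = i then t else x $ j)" for j by (cases "j = i") auto
  then show ?thesis unfolding upd_def by (intro continuous_on_vec_lambda)
qed

context weight
begin

definition indep_of :: "'n \<Rightarrow> (real^'n \<Rightarrow> real) \<Rightarrow> bool" where
  "indep_of i f \<longleftrightarrow> (\<forall>x t. f (upd x i t) = f x)"

text \<open>The coordinates of y are exchanged for those of x one at a time.\<close>

lemma const_if_indep_of:
  assumes "\<And>i. indep_of i f" shows "f x = f y"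
proof -
  have "f (\<chi> i. if i \<in> S then x $ i else y $ i) = f y" if "finite S" for S
    using that
  proof (induction S rule: finite_induct)
    case (insert j S)
    have "(\<chi> i. if i \<in> insert j S then x $ i else y $ i) = upd (\<chi> i. if i \<in> S then x $ i else y $ i) j (x $ j)"
      by (simp add: vec_eq_iff)
    then show ?case using assms[of j] insert.IH by (simp add: indep_of_def)
  qed simp
  from this[of UNIV] show ?thesis by simp
qed

lemma indep_of_fibre: "indep_of i f \<or> i = j \<Longrightarrow> indep_of i (fibre j p f)"
  by (cases "i = j") (auto simp: indep_of_def fibre_indep, simp add: fibre_def upd_commute[of i j])

lemma indep_of_proj: "indep_of i f \<or> i \<in> set l \<Longrightarrow> indep_of i (cs.proj l f)"
proof (induction l arbitrary: f)
  case (Cons j l)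
  then have "indep_of i (Aop j f) \<or> i \<in> set l"
    using indep_of_fibre[of i f j] by (auto simp: Aop_def)
  then show ?case using Cons.IH by simp
qed simp

lemma integral_Aop: "f \<in> Vlin \<Longrightarrow> (\<integral>x. Aop i f x \<partial>mu \<alpha>) = (\<integral>x. f x \<partial>mu \<alpha>)"
  using mu_fubini(1)[OF \<alpha> integrable_Vlin(1)] by (simp add: Aop_def fibre_def)

lemma integral_proj: "f \<in> Vlin \<Longrightarrow> (\<integral>x. cs.proj l f x \<partial>mu \<alpha>) = (\<integral>x. f x \<partial>mu \<alpha>)"
  by (induction l arbitrary: f) (auto simp: Aop_Vlin integral_Aop)

text \<open>After averaging over l the function depends on no coordinate; being constant, it equals
  its integral, which averaging has preserved.\<close>

lemma proj_eq_mean: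
  assumes "f \<in> Vlin" "\<And>i. i \<notin> set l \<Longrightarrow> indep_of i f"
  shows "cs.proj l f = (\<lambda>_. \<integral>x. f x \<partial>mu \<alpha>)"
proof
  fix y
  have "\<And>i. indep_of i (cs.proj l f)" using assms(2) by (auto intro: indep_of_proj)
  then have "cs.proj l f x = cs.proj l f y" for x by (rule const_if_indep_of)
  then have "(\<integral>x. cs.proj l f x \<partial>mu \<alpha>) = (\<integral>x. cs.proj l f y \<partial>mu \<alpha>)" by (rule arg_cong[where f="integral\<^sup>L (mu \<alpha>)", OF ext])
  then show "cs.proj l f y = (\<integral>x. f x \<partial>mu \<alpha>)"
    using integral_proj[OF assms(1), of l] M.prob_space by simp
qed

lemma Aop_mult_nth: "i \<noteq> j \<Longrightarrow> Aop i (\<lambda>x. x $ j * f x) = (\<lambda>x. x $ j * Aop i f x)"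
  by (simp add: Aop_def fun_eq_iff fibre_mult_nth)

lemma proj_mult_nth: "j \<notin> set l \<Longrightarrow> cs.proj l (\<lambda>x. x $ j * f x) = (\<lambda>x. x $ j * cs.proj l f x)"
  by (induction l arbitrary: f) (auto simp: Aop_mult_nth)

lemma Aop_zero: "Aop i (\<lambda>_. 0) = (\<lambda>_. 0)"
  by (simp add: Aop_def fibre_zero)

lemma proj_zero: "cs.proj l (\<lambda>_. 0) = (\<lambda>_. 0)"
  by (induction l) (simp_all add: Aop_zero)

lemma integral_nth_Aop:
  assumes "i \<noteq> j" "f \<in> Vlin"
  shows "(\<integral>x. x $ j * Aop i f x \<partial>mu \<alpha>) = (\<integral>x. x $ j * f x \<partial>mu \<alpha>)"
  using mu_fubini(1)[OF \<alpha> integrable_Vlin(3)[OF assms(2), of j], of i] assms(1)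
  by (simp add: Aop_def fibre_def)

lemma integral_fibre_nth:
  assumes "f \<in> Vlin"
  shows "(\<integral>x. fibre i (\<lambda>t. t) f x \<partial>mu \<alpha>) = (\<integral>x. x $ i * f x \<partial>mu \<alpha>)"
  using mu_fubini(1)[OF \<alpha> integrable_Vlin(3)[OF assms, of i], of i] by (simp add: fibre_def)

text \<open>The abstract level 1 consists of the linear moments. The factor x_j passes through the
  averages over the other coordinates, the remaining coefficient averages to E x_j f, and E x_j^2 =
  1. The independence hypothesis records the coordinates already averaged when the induction reaches
  a sublist.\<close>

lemma first_level_eq:
  assumes "distinct l" "f \<in> Vlin" "\<And>i. i \<notin> set l \<Longrightarrow> indep_of i f"
  shows "cs.first_level l f = (\<Sum>j\<in>set l. if \<alpha> j = 0 then (\<integral>x. x $ j * f x \<partial>mu \<alpha>)\<^sup>2 else 0)"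
  using assms
proof (induction l arbitrary: f)
  case (Cons j l)
  have "cs.first_level l (Aop j f) = (\<Sum>i\<in>set l. if \<alpha> i = 0 then (\<integral>x. x $ i * Aop j f x \<partial>mu \<alpha>)\<^sup>2 else 0)"
  proof (rule Cons.IH)
    show "indep_of i (Aop j f)" if "i \<notin> set l" for i
      unfolding Aop_def using Cons.prems(3)[of i] that by (intro indep_of_fibre) auto
  qed (use Cons.prems in \<open>auto simp: Aop_Vlin\<close>)
  also have "\<dots> = (\<Sum>i\<in>set l. if \<alpha> i = 0 then (\<integral>x. x $ i * f x \<partial>mu \<alpha>)\<^sup>2 else 0)"
  proof (rule sum.cong[OF refl])
    fix i assume "i \<in> set l"
    then have "j \<noteq> i" using Cons.prems(1) by auto
    then show "(if \<alpha> i = 0 then (\<integral>x. x $ i * Aop j f x \<partial>mu \<alpha>)\<^sup>2 else 0) = (if \<alpha> i = 0 then (\<integral>x. x $ i * f x \<partial>mu \<alpha>)\<^sup>2 else 0)"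
      using Cons.prems(2) by (simp add: integral_nth_Aop)
  qed
  finally have IH: "cs.first_level l (Aop j f) = (\<Sum>i\<in>set l. if \<alpha> i = 0 then (\<integral>x. x $ i * f x \<partial>mu \<alpha>)\<^sup>2 else 0)" .
  have "Nsq (cs.proj l (Bop j f)) = (if \<alpha> j = 0 then (\<integral>x. x $ j * f x \<partial>mu \<alpha>)\<^sup>2 else 0)"
  proof (cases "\<alpha> j = 0")
    case True
    let ?h = "fibre j (\<lambda>t. t) f"
    have hV: "?h \<in> Vlin" using Cons.prems(2) by (intro fibre_Vlin) auto
    have "cs.proj l ?h = (\<lambda>_. \<integral>x. ?h x \<partial>mu \<alpha>)"
    proof (rule proj_eq_mean[OF hV])
      show "indep_of i ?h" if "i \<notin> set l" for i
        using Cons.prems(3)[of i] that by (intro indep_of_fibre) auto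
    qed
    then have "cs.proj l (Bop j f) = (\<lambda>x. x $ j * (\<integral>x. x $ j * f x \<partial>mu \<alpha>))"
      using True Cons.prems by (simp add: Bop_def[abs_def] proj_mult_nth integral_fibre_nth)
    then have "Nsq (cs.proj l (Bop j f)) = (\<integral>x. (x $ j)\<^sup>2 \<partial>mu \<alpha>) * (\<integral>x. x $ j * f x \<partial>mu \<alpha>)\<^sup>2"
      by (simp add: Nsq_def power_mult_distrib)
    also have "(\<integral>x. (x $ j)\<^sup>2 \<partial>mu \<alpha>) = 1"
      using True by (simp add: integral_mu_nth[OF \<alpha>, of "\<lambda>t. t\<^sup>2"] nu_0_moments)
    finally show ?thesis using True by simp
  next
    case False
    then show ?thesis by (simp add: Bop_def[abs_def] proj_zero Nsq_def)
  qed
  then show ?case using IH Cons.prems(1) by simp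
qed simp

text \<open>The one-dimensional inequality holds on every line parallel to axis i; integrating it
  over all lines gives the quantities in \<open>cs.gap\<close>.\<close>

lemma gap_le_energy:
  fixes D :: "real^'n \<Rightarrow> real"
  assumes w: "w \<in> Vlin" and D: "continuous_on UNIV D" "\<And>x. \<bar>D x\<bar> \<le> K"
    and deriv: "\<And>x t. ((\<lambda>t. w (upd x i t)) has_real_derivative D (upd x i t)) (at t)"
  shows "cs.gap i w \<le> (\<integral>x. (D x)\<^sup>2 \<partial>mu \<alpha>)"
proof -
  have [measurable]: "D \<in> borel_measurable borel" by (rule borel_measurable_continuous_onI[OF D(1)])
  have "(D x)\<^sup>2 \<le> K\<^sup>2" for x using power_mono[OF D(2)[of x], of 2] by simp
  then have iD: "integrable (mu \<alpha>) (\<lambda>x. (D x)\<^sup>2)"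
    by (intro M.integrable_const_bound[where B="K\<^sup>2"]) auto
  note fub = Nsq_fubini[OF w, of i] Nsq_fubini[OF Aop_Vlin[OF w, of i], of i]
    Nsq_fubini[OF Bop_Vlin[OF w, of i], of i] mu_fubini[OF \<alpha> iD, of i]
  have "2 * (\<integral>t. (w (upd x i t))\<^sup>2 \<partial>nu (\<alpha> i)) - 2 * (\<integral>t. (Aop i w (upd x i t))\<^sup>2 \<partial>nu (\<alpha> i))
     - (\<integral>t. (Bop i w (upd x i t))\<^sup>2 \<partial>nu (\<alpha> i)) \<le> (\<integral>t. (D (upd x i t))\<^sup>2 \<partial>nu (\<alpha> i))" for x
  proof -
    obtain C where C: "\<And>t. \<bar>w (upd x i t)\<bar> \<le> C * (1 + \<bar>t\<bar>)" using Vlin_fibre[OF w] by metis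
    \<comment> \<open>The one-dimensional inequality asks for a common constant for function and
      derivative. It may vary with the line, since it does not enter the conclusion.\<close>
    have C': "\<bar>w (upd x i t)\<bar> \<le> max C K * (1 + \<bar>t\<bar>)" for t
      by (rule order_trans[OF C mult_right_mono]) auto
    have K': "\<bar>D (upd x i t)\<bar> \<le> max C K" for t using D(2)[of "upd x i t"] by simp
    have "continuous_on UNIV (\<lambda>t. D (upd x i t))"
      by (rule continuous_on_compose2[OF D(1) continuous_upd]) simp
    from nu_spectral_gap[OF \<alpha>'[of i] deriv this K' C']
    show ?thesis
      unfolding Aop_fibre_sq Bop_fibre_sq by (cases "\<alpha> i = 0") (simp_all add: Aop_def fibre_def)
  qed
  then have "(\<integral>x. 2 * (\<integral>t. (w (upd x i t))\<^sup>2 \<partial>nu (\<alpha> i)) - 2 * (\<integral>t. (Aop i w (upd x i t))\<^sup>2 \<partial>nu (\<alpha> i))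
     - (\<integral>t. (Bop i w (upd x i t))\<^sup>2 \<partial>nu (\<alpha> i)) \<partial>mu \<alpha>) \<le> (\<integral>x. (\<integral>t. (D (upd x i t))\<^sup>2 \<partial>nu (\<alpha> i)) \<partial>mu \<alpha>)"
    using fub by (intro integral_mono) auto
  then show ?thesis using fub by (simp add: cs.gap_def)
qed

lemma mu_spectral_gap:
  fixes D :: "'n \<Rightarrow> real^'n \<Rightarrow> real"
  assumes w: "w \<in> Vlin" and D: "\<And>i. continuous_on UNIV (D i)" "\<And>i x. \<bar>D i x\<bar> \<le> K"
    and deriv: "\<And>i x t. ((\<lambda>t. w (upd x i t)) has_real_derivative D i (upd x i t)) (at t)"
  shows "2 * (\<integral>x. (w x)\<^sup>2 \<partial>mu \<alpha>) - 2 * (\<integral>x. w x \<partial>mu \<alpha>)\<^sup>2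
      - (\<Sum>i\<in>UNIV. if \<alpha> i = 0 then (\<integral>x. x $ i * w x \<partial>mu \<alpha>)\<^sup>2 else 0)
    \<le> (\<Sum>i\<in>UNIV. \<integral>x. (D i x)\<^sup>2 \<partial>mu \<alpha>)"
proof -
  obtain l where l: "set l = (UNIV :: 'n set)" "distinct l" using finite_distinct_list[OF finite] by auto
  have "cs.proj l w = (\<lambda>_. \<integral>x. w x \<partial>mu \<alpha>)"
    by (rule proj_eq_mean[OF w]) (simp add: l)
  then have "Nsq (cs.proj l w) = (\<integral>x. w x \<partial>mu \<alpha>)\<^sup>2"
    using M.prob_space by (simp add: Nsq_def)
  moreover have "cs.first_level l w = (\<Sum>i\<in>UNIV. if \<alpha> i = 0 then (\<integral>x. x $ i * w x \<partial>mu \<alpha>)\<^sup>2 else 0)"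
    using first_level_eq[OF l(2) w] by (simp add: l)
  moreover have "2 * Nsq w - 2 * Nsq (cs.proj l w) - cs.first_level l w \<le> (\<Sum>i\<in>set l. cs.gap i w)"
    by (rule cs.sum_gap_ge_second[OF l(2) w])
  moreover have "(\<Sum>i\<in>set l. cs.gap i w) \<le> (\<Sum>i\<in>UNIV. \<integral>x. (D i x)\<^sup>2 \<partial>mu \<alpha>)"
    unfolding l(1) by (intro sum_mono gap_le_energy[OF w D deriv])
  ultimately show ?thesis by (simp add: Nsq_def)
qed

lemma integral_deriv_eq_moment:
  fixes D :: "real^'n \<Rightarrow> real"
  assumes i: "\<alpha> i = 0" and w: "w \<in> Vlin" and D: "continuous_on UNIV D" "\<And>x. \<bar>D x\<bar> \<le> K"
    and deriv: "\<And>x t. ((\<lambda>t. w (upd x i t)) has_real_derivative D (upd x i t)) (at t)"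
  shows "(\<integral>x. D x \<partial>mu \<alpha>) = (\<integral>x. x $ i * w x \<partial>mu \<alpha>)"
proof -
  have [measurable]: "D \<in> borel_measurable borel" by (rule borel_measurable_continuous_onI[OF D(1)])
  have iD: "integrable (mu \<alpha>) D"
    using D(2) by (intro M.integrable_const_bound[where B=K]) auto
  have "(\<integral>t. D (upd x i t) \<partial>nu (\<alpha> i)) = fibre i (\<lambda>t. t) w x" for x
  proof -
    obtain C where C: "\<And>t. \<bar>w (upd x i t)\<bar> \<le> C * (1 + \<bar>t\<bar>)" using Vlin_fibre[OF w] by metis
    have C': "\<bar>w (upd x i t)\<bar> \<le> max C K * (1 + \<bar>t\<bar>)" for t
      by (rule order_trans[OF C mult_right_mono]) auto
    have K': "\<bar>D (upd x i t)\<bar> \<le> max C K" for t using D(2)[of "upd x i t"] by simp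
    have "continuous_on UNIV (\<lambda>t. D (upd x i t))"
      by (rule continuous_on_compose2[OF D(1) continuous_upd]) simp
    from nu_0_integral_by_parts[OF deriv this K' C'] show ?thesis by (simp add: i fibre_def)
  qed
  then show ?thesis
    using mu_fubini(1)[OF \<alpha> iD, of i] integral_fibre_nth[OF w, of i] by simp
qed

end

subsection \<open>The inequality\<close>

lemma upd_eq: "upd x i t = x + (t - x $ i) *\<^sub>R axis i 1"
  by (simp add: vec_eq_iff axis_def)

lemma has_real_derivative_upd:
  fixes f :: "real^'n::finite \<Rightarrow> real"
  assumes "f differentiable (at (upd x i t))"
  shows "((\<lambda>t. f (upd x i t)) has_real_derivative partial i f (upd x i t)) (at t)"
proof -
  have f: "(f has_derivative frechet_derivative f (at (upd x i t))) (at (upd x i t))"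
    using assms by (simp add: frechet_derivative_works)
  interpret linear "frechet_derivative f (at (upd x i t))"
    using f by (rule has_derivative_linear)
  have "((\<lambda>t. upd x i t) has_derivative (\<lambda>h. h *\<^sub>R axis i 1)) (at t)"
    unfolding upd_eq by (auto intro!: derivative_eq_intros)
  from has_derivative_compose[OF this f] show ?thesis
    unfolding has_field_derivative_def partial_def by (simp add: scaleR mult.commute[of _ "frechet_derivative _ _ _"] scale)
qed

lemma smooth_differentiable: "smooth f \<Longrightarrow> f differentiable (at x)"
  unfolding smooth_def using Ck.simps(2)[of 0 f] by blast

lemma smooth_continuous: "smooth f \<Longrightarrow> continuous_on UNIV f"
  unfolding smooth_def using Ck.simps(1)[of f] by blast

lemma smooth_partial_continuous: "smooth f \<Longrightarrow> continuous_on UNIV (partial i f)"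
  unfolding smooth_def using Ck.simps(2)[of 0 f] Ck.simps(1)[of "partial i f"] by blast

lemma partial_eq:
  assumes "(f has_derivative f') (at x)" shows "partial i f x = f' (axis i 1)"
  using frechet_derivative_at[OF assms] by (simp add: partial_def)

lemma bounded_if_continuous_compact_support:
  fixes f :: "'a::metric_space \<Rightarrow> real"
  assumes "continuous_on UNIV f" "compact T" "\<And>x. x \<notin> T \<Longrightarrow> f x = 0"
  obtains K where "\<And>x. \<bar>f x\<bar> \<le> K"
proof -
  have "bounded (f ` T)"
    using assms by (intro compact_imp_bounded compact_continuous_image) (auto intro: continuous_on_subset)
  then obtain K where K: "\<And>x. x \<in> T \<Longrightarrow> \<bar>f x\<bar> \<le> K" by (auto simp: bounded_real)
  have "\<bar>f x\<bar> \<le> max K 0" for x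
    using K[of x] assms(3)[of x] by (cases "x \<in> T") auto
  then show ?thesis by (rule that)
qed

lemma Nstar_bounded:
  assumes "\<phi> \<in> Nstar \<alpha>"
  obtains K where "\<And>x. \<bar>\<phi> x\<bar> \<le> K" "\<And>i x. \<bar>partial i \<phi> x\<bar> \<le> K"
proof -
  have s: "smooth \<phi>" and b: "bounded {x. \<phi> x \<noteq> 0}" using assms by (auto simp: Nstar_def)
  define T where "T = closure {x. \<phi> x \<noteq> 0}"
  have T: "compact T" using b by (simp add: T_def compact_closure)
  have 0: "\<phi> x = 0" if "x \<notin> T" for x
    using that closure_subset[of "{x. \<phi> x \<noteq> 0}"] by (auto simp: T_def)
  have 1: "partial i \<phi> x = 0" if "x \<notin> T" for i x
  proof -
    have "((\<lambda>_. 0) has_derivative (\<lambda>_. 0)) (at x)" by (rule has_derivative_const)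
    then have "(\<phi> has_derivative (\<lambda>_. 0)) (at x)"
      by (rule has_derivative_transform_within_open[of _ _ _ _ "- T"]) (use that 0 T compact_imp_closed in \<open>auto simp: open_Compl\<close>)
    then show ?thesis by (rule partial_eq)
  qed
  obtain K0 where K0: "\<And>x. \<bar>\<phi> x\<bar> \<le> K0"
    using bounded_if_continuous_compact_support[OF smooth_continuous[OF s] T 0] by metis
  have "\<exists>K. \<forall>x. \<bar>partial i \<phi> x\<bar> \<le> K" for i
    using bounded_if_continuous_compact_support[OF smooth_partial_continuous[OF s] T 1] by metis
  then obtain K1 where K1: "\<And>i x. \<bar>partial i \<phi> x\<bar> \<le> K1 i" by metis
  have "\<bar>partial i \<phi> x\<bar> \<le> max K0 (Max (range K1))" for i x
    using order_trans[OF K1[of i x] Max_ge[of "range K1" "K1 i"]] by (simp add: le_max_iff_disj)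
  then show ?thesis using that[of "max K0 (Max (range K1))"] K0 by (meson max.coboundedI1)
qed

lemma Vlin_add:
  assumes "f \<in> Vlin" "g \<in> Vlin" shows "(\<lambda>x. f x + g x) \<in> Vlin"
  using Vlin_diff[OF assms(1) Vlin_diff[OF Vlin_const[of 0] assms(2)]] by simp

lemma Vlin_cmult:
  assumes "f \<in> Vlin" shows "(\<lambda>x. c * f x) \<in> Vlin"
proof -
  obtain C where C: "\<And>x. \<bar>f x\<bar> \<le> C * (\<Prod>j\<in>UNIV. 1 + \<bar>x $ j\<bar>)" using VlinE[OF assms] by metis
  note [measurable] = Vlin_measurable[OF assms]
  have "\<bar>c * f x\<bar> \<le> \<bar>c\<bar> * C * (\<Prod>j\<in>UNIV. 1 + \<bar>x $ j\<bar>)" for x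
    unfolding abs_mult mult.assoc by (intro mult_left_mono C) auto
  then show ?thesis by (intro VlinI) auto
qed

lemma Vlin_sum: "finite S \<Longrightarrow> (\<And>i. i \<in> S \<Longrightarrow> f i \<in> Vlin) \<Longrightarrow> (\<lambda>x. \<Sum>i\<in>S. f i x) \<in> Vlin"
  by (induction S rule: finite_induct) (auto simp: Vlin_const Vlin_add)

lemma bounded_Vlin:
  assumes "f \<in> borel_measurable borel" "\<And>x. \<bar>f x\<bar> \<le> K" shows "f \<in> Vlin"
proof (rule VlinI[OF assms(1)])
  fix x :: "real^'a"
  have "0 \<le> K" using assms(2)[of x] by linarith
  then show "\<bar>f x\<bar> \<le> K * (\<Prod>j\<in>UNIV. 1 + \<bar>x $ j\<bar>)"
    using mult_left_mono[OF prod_growth_ge1[of x UNIV], of K] assms(2)[of x] by simp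
qed

text \<open>Twice the difference of the two sides, as a polynomial in numbers: S and V are second
  moments of gradient and function, m and b their means, e the raw moments E x_i u, and \<xi> the
  means of the coordinates. Then e - m \<xi> is the moment vector, and continuity can be checked
  argument by argument.\<close>

definition deficit :: "('n::finite \<Rightarrow> real) \<Rightarrow> real \<Rightarrow> real \<Rightarrow> ('n \<Rightarrow> real) \<Rightarrow> ('n \<Rightarrow> real) \<Rightarrow> ('n \<Rightarrow> real) \<Rightarrow> real" where
  "deficit S V m e b \<xi> = (\<Sum>i\<in>UNIV. S i) - 2 * (V - m\<^sup>2) + (\<Sum>i\<in>UNIV. 2 * (e i - m * \<xi> i) * b i - (e i - m * \<xi> i)\<^sup>2)"

context weight
begin

lemma integral_nth_eq_0: "\<alpha> i = 0 \<Longrightarrow> (\<integral>x. x $ i \<partial>mu \<alpha>) = 0"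
  by (simp add: integral_mu_nth[OF \<alpha>, of "\<lambda>t. t"] nu_0_moments)

lemma integral_nth_mult:
  assumes "i \<noteq> j" and h: "h \<in> borel_measurable borel" and i: "integrable (mu \<alpha>) (\<lambda>x. h (x $ i) * x $ j)"
  shows "(\<integral>x. h (x $ i) * x $ j \<partial>mu \<alpha>) = (\<integral>t. h t \<partial>nu (\<alpha> i)) * (\<integral>x. x $ j \<partial>mu \<alpha>)"
  using mu_fubini(1)[OF \<alpha> i, of i] assms(1) by simp

text \<open>The perturbation \<open>q\<close> completes the square. In a coordinate with \<open>\<alpha>\<^sub>i > 0\<close> the moment \<open>c\<^sub>i\<close> and
  the mean \<open>b\<^sub>i\<close> of the partial derivative are unrelated; in the others integration by parts gives
  \<open>b\<^sub>i = c\<^sub>i\<close> and no perturbation is needed. Since \<open>w\<close> does not satisfy the boundary condition,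
  it matters that the spectral gap does not require it.\<close>

lemma Nstar_deficit_nonneg:
  assumes \<phi>: "\<phi> \<in> Nstar \<alpha>"
  shows "0 \<le> deficit (\<lambda>i. \<integral>x. (partial i \<phi> x)\<^sup>2 \<partial>mu \<alpha>) (\<integral>x. (\<phi> x)\<^sup>2 \<partial>mu \<alpha>) (\<integral>x. \<phi> x \<partial>mu \<alpha>)
    (\<lambda>i. \<integral>x. x $ i * \<phi> x \<partial>mu \<alpha>) (\<lambda>i. \<integral>x. partial i \<phi> x \<partial>mu \<alpha>) (\<lambda>i. \<integral>x. x $ i \<partial>mu \<alpha>)"
proof -
  have s: "smooth \<phi>" using \<phi> by (auto simp: Nstar_def)
  obtain K where K: "\<And>x. \<bar>\<phi> x\<bar> \<le> K" "\<And>i x. \<bar>partial i \<phi> x\<bar> \<le> K"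
    using Nstar_bounded[OF \<phi>] by metis
  note [measurable] = borel_measurable_continuous_onI[OF smooth_continuous[OF s]]
    borel_measurable_continuous_onI[OF smooth_partial_continuous[OF s]]
  have \<phi>V: "\<phi> \<in> Vlin" by (rule bounded_Vlin[OF _ K(1)]) measurable
  have pV: "partial i \<phi> \<in> Vlin" for i by (rule bounded_Vlin[OF _ K(2)]) measurable
  define m where "m = (\<integral>x. \<phi> x \<partial>mu \<alpha>)"
  define c where "c i = (\<integral>x. x $ i * \<phi> x \<partial>mu \<alpha>) - m * (\<integral>x. x $ i \<partial>mu \<alpha>)" for i
  define b where "b i = (\<integral>x. partial i \<phi> x \<partial>mu \<alpha>)" for i
  define d where "d i = (if \<alpha> i = 0 then 0 else c i)" for i
  define q where "q x = (\<Sum>i\<in>UNIV. d i * x $ i)" for x :: "real^'n"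
  define w where "w x = \<phi> x + q x" for x
  define D where "D i x = partial i \<phi> x + d i" for i x
  have qV: "q \<in> Vlin"
    unfolding q_def[abs_def] by (intro Vlin_sum Vlin_cmult Vlin_nth) auto
  have wV: "w \<in> Vlin" unfolding w_def[abs_def] by (rule Vlin_add[OF \<phi>V qV])
  have Dc: "continuous_on UNIV (D i)" for i
    unfolding D_def[abs_def] by (intro continuous_intros smooth_partial_continuous[OF s])
  have Db: "\<bar>D i x\<bar> \<le> K + (\<Sum>j\<in>UNIV. \<bar>d j\<bar>)" for i x
    using K(2)[of i x] member_le_sum[of i UNIV "\<lambda>j. \<bar>d j\<bar>"] unfolding D_def by simp
  have der: "((\<lambda>t. w (upd x i t)) has_real_derivative D i (upd x i t)) (at t)" for i x t
  proof -
    have "q (upd x i t) = d i * t + (\<Sum>j\<in>UNIV - {i}. d j * x $ j)" for t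
      unfolding q_def by (auto simp: sum.remove[of UNIV i] intro!: sum.cong)
    then have "((\<lambda>t. q (upd x i t)) has_real_derivative d i) (at t)"
      by (auto intro!: derivative_eq_intros)
    with has_real_derivative_upd[OF smooth_differentiable[OF s]]
    show ?thesis unfolding w_def D_def by (rule DERIV_add)
  qed
  note gap = mu_spectral_gap[OF wV Dc Db der]
  note int = integrable_Vlin[OF \<phi>V] integrable_Vlin[OF qV] integrable_Vlin_mult[OF \<phi>V qV]
  have x\<phi>: "integrable (mu \<alpha>) (\<lambda>x. \<phi> x * x $ i)" for i
    using integrable_Vlin(3)[OF \<phi>V, of i] by (simp add: mult.commute)
  have Eq: "(\<integral>x. q x \<partial>mu \<alpha>) = (\<Sum>i\<in>UNIV. d i * (\<integral>x. x $ i \<partial>mu \<alpha>))"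
    unfolding q_def using integrable_Vlin(1)[OF Vlin_nth] by simp
  have E\<phi>q: "(\<integral>x. \<phi> x * q x \<partial>mu \<alpha>) = (\<Sum>i\<in>UNIV. d i * (\<integral>x. x $ i * \<phi> x \<partial>mu \<alpha>))"
  proof -
    have "\<phi> x * q x = (\<Sum>i\<in>UNIV. d i * (x $ i * \<phi> x))" for x
      unfolding q_def sum_distrib_left by (simp add: mult_ac)
    then show ?thesis using integrable_Vlin(3)[OF \<phi>V] by simp
  qed
  have Ew: "(\<integral>x. w x \<partial>mu \<alpha>) = m + (\<integral>x. q x \<partial>mu \<alpha>)"
    unfolding w_def m_def using int by simp
  have Ew2: "(\<integral>x. (w x)\<^sup>2 \<partial>mu \<alpha>) = (\<integral>x. (\<phi> x)\<^sup>2 \<partial>mu \<alpha>) + 2 * (\<integral>x. \<phi> x * q x \<partial>mu \<alpha>) + (\<integral>x. (q x)\<^sup>2 \<partial>mu \<alpha>)"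
  proof -
    have "(w x)\<^sup>2 = (\<phi> x)\<^sup>2 + 2 * (\<phi> x * q x) + (q x)\<^sup>2" for x
      unfolding w_def by (simp add: power2_eq_square algebra_simps)
    then show ?thesis using int by simp
  qed
  have var: "0 \<le> (\<integral>x. (q x)\<^sup>2 \<partial>mu \<alpha>) - (\<integral>x. q x \<partial>mu \<alpha>)\<^sup>2"
    using M.variance_eq[OF int(4,5)] M.variance_positive[of q] by simp
  have cov: "(\<integral>x. \<phi> x * q x \<partial>mu \<alpha>) - m * (\<integral>x. q x \<partial>mu \<alpha>) = (\<Sum>i\<in>UNIV. d i * c i)"
    unfolding Eq E\<phi>q c_def by (simp add: sum_distrib_left right_diff_distrib sum_subtractf mult_ac)
  \<comment> \<open>Twice the variance of w, with the covariance with q computed from the moments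
    and the nonnegative variance of q discarded.\<close>
  have L: "2 * (\<integral>x. (w x)\<^sup>2 \<partial>mu \<alpha>) - 2 * (\<integral>x. w x \<partial>mu \<alpha>)\<^sup>2
    \<ge> 2 * ((\<integral>x. (\<phi> x)\<^sup>2 \<partial>mu \<alpha>) - m\<^sup>2) + 4 * (\<Sum>i\<in>UNIV. d i * c i)"
    unfolding Ew Ew2 cov[symmetric] using var by (simp add: power2_eq_square algebra_simps)
  \<comment> \<open>The perturbation is invisible to the moments at level 1: x_i is centred and
    independent of the coordinates that q contains.\<close>
  have Xw: "(\<integral>x. x $ i * w x \<partial>mu \<alpha>) = c i" if i: "\<alpha> i = 0" for i
  proof -
    have dz: "d j * (\<integral>x. x $ i * x $ j \<partial>mu \<alpha>) = 0" for j
    proof (cases "j = i")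
      case False
      have "(\<integral>x. x $ i * x $ j \<partial>mu \<alpha>) = (\<integral>t. t \<partial>nu (\<alpha> i)) * (\<integral>x. x $ j \<partial>mu \<alpha>)"
        using False integral_nth_mult[of i j "\<lambda>t. t"] integrable_Vlin_mult[OF Vlin_nth Vlin_nth] by simp
      then show ?thesis by (simp add: i nu_0_moments)
    qed (simp add: d_def i)
    have "x $ i * q x = (\<Sum>j\<in>UNIV. d j * (x $ i * x $ j))" for x
      unfolding q_def sum_distrib_left by (simp add: mult_ac)
    then have "(\<integral>x. x $ i * q x \<partial>mu \<alpha>) = (\<Sum>j\<in>UNIV. d j * (\<integral>x. x $ i * x $ j \<partial>mu \<alpha>))"
      using integrable_Vlin_mult[OF Vlin_nth[of i] Vlin_nth] by simp
    also have "\<dots> = 0" by (rule sum.neutral) (intro ballI dz)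
    finally show ?thesis
      unfolding w_def using int(3,6)[of i] integral_nth_eq_0[OF i] by (simp add: c_def distrib_left)
  qed
  have R: "(\<integral>x. (D i x)\<^sup>2 \<partial>mu \<alpha>) = (\<integral>x. (partial i \<phi> x)\<^sup>2 \<partial>mu \<alpha>) + 2 * d i * b i + (d i)\<^sup>2" for i
  proof -
    have "(D i x)\<^sup>2 = (partial i \<phi> x)\<^sup>2 + 2 * d i * partial i \<phi> x + (d i)\<^sup>2" for x
      unfolding D_def by (simp add: power2_eq_square algebra_simps)
    then show ?thesis unfolding b_def using integrable_Vlin[OF pV[of i]] M.prob_space by simp
  qed
  have "2 * ((\<integral>x. (\<phi> x)\<^sup>2 \<partial>mu \<alpha>) - m\<^sup>2) + 4 * (\<Sum>i\<in>UNIV. d i * c i) - (\<Sum>i\<in>UNIV. if \<alpha> i = 0 then (c i)\<^sup>2 else 0)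
     \<le> (\<Sum>i\<in>UNIV. (\<integral>x. (partial i \<phi> x)\<^sup>2 \<partial>mu \<alpha>) + 2 * d i * b i + (d i)\<^sup>2)"
    using gap L by (simp add: Xw R cong: if_cong)
  \<comment> \<open>Coordinatewise comparison. With d = c the left side is 2 c b - 3 c^2, leaving 2
    c^2 to spare. With d = 0 and b = c both sides equal c^2.\<close>
  moreover have "(\<Sum>i\<in>UNIV. 2 * d i * b i + (d i)\<^sup>2 - 4 * (d i * c i) + (if \<alpha> i = 0 then (c i)\<^sup>2 else 0))
     \<le> (\<Sum>i\<in>UNIV. 2 * c i * b i - (c i)\<^sup>2)"
  proof (rule sum_mono)
    fix i
    have "b i = c i" if "\<alpha> i = 0"
      using integral_deriv_eq_moment[OF that \<phi>V smooth_partial_continuous[OF s] K(2) has_real_derivative_upd[OF smooth_differentiable[OF s]]]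
        integral_nth_eq_0[OF that] by (simp add: b_def c_def)
    then show "2 * d i * b i + (d i)\<^sup>2 - 4 * (d i * c i) + (if \<alpha> i = 0 then (c i)\<^sup>2 else 0) \<le> 2 * c i * b i - (c i)\<^sup>2"
      by (simp add: d_def power2_eq_square)
  qed
  ultimately show ?thesis
    unfolding deficit_def m_def[symmetric] c_def[symmetric] b_def[symmetric]
    by (simp add: sum.distrib sum_subtractf sum_distrib_left)
qed

end

section \<open>Square-integrable limits and passage to the completion\<close>

lemma integrable_mult_of_squares:
  fixes f h :: "'a \<Rightarrow> real"
  assumes [measurable]: "f \<in> borel_measurable M" "h \<in> borel_measurable M"
    and "integrable M (\<lambda>x. (f x)\<^sup>2)" "integrable M (\<lambda>x. (h x)\<^sup>2)"
  shows "integrable M (\<lambda>x. f x * h x)"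
proof (rule Bochner_Integration.integrable_bound)
  show "integrable M (\<lambda>x. (f x)\<^sup>2 + (h x)\<^sup>2)" using assms by simp
  show "AE x in M. norm (f x * h x) \<le> norm ((f x)\<^sup>2 + (h x)\<^sup>2)"
  proof (rule AE_I2)
    fix x
    have "0 \<le> (\<bar>f x\<bar> - \<bar>h x\<bar>)\<^sup>2" "0 \<le> \<bar>f x\<bar> * \<bar>h x\<bar>" by simp_all
    then have "\<bar>f x\<bar> * \<bar>h x\<bar> \<le> \<bar>f x\<bar>\<^sup>2 + \<bar>h x\<bar>\<^sup>2"
      unfolding power2_diff by linarith
    then show "norm (f x * h x) \<le> norm ((f x)\<^sup>2 + (h x)\<^sup>2)" by (simp add: abs_mult)
  qed
qed measurable

lemma integral_Cauchy_Schwarz: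
  fixes f h :: "'a \<Rightarrow> real"
  assumes [measurable]: "f \<in> borel_measurable M" "h \<in> borel_measurable M"
    and f2: "integrable M (\<lambda>x. (f x)\<^sup>2)" and h2: "integrable M (\<lambda>x. (h x)\<^sup>2)"
  shows "(\<integral>x. f x * h x \<partial>M)\<^sup>2 \<le> (\<integral>x. (f x)\<^sup>2 \<partial>M) * (\<integral>x. (h x)\<^sup>2 \<partial>M)"
proof -
  define a b c where "a = (\<integral>x. (f x)\<^sup>2 \<partial>M)" and "b = (\<integral>x. (h x)\<^sup>2 \<partial>M)" and "c = (\<integral>x. f x * h x \<partial>M)"
  have fh: "integrable M (\<lambda>x. f x * h x)" by (rule integrable_mult_of_squares) fact+
  have b0: "0 \<le> b" by (simp add: b_def)
  show ?thesis
  proof (cases "b = 0")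
    case True
    then have "AE x in M. (h x)\<^sup>2 = 0"
      unfolding b_def by (subst (asm) integral_nonneg_eq_0_iff_AE[OF h2]) auto
    then have "c = (\<integral>x. 0 \<partial>M)"
      unfolding c_def by (intro integral_cong_AE) auto
    then show ?thesis unfolding a_def[symmetric] b_def[symmetric] c_def[symmetric] by (simp add: True)
  next
    case False
    have "(\<integral>x. (b * f x - c * h x)\<^sup>2 \<partial>M) = (\<integral>x. b\<^sup>2 * (f x)\<^sup>2 - 2 * b * c * (f x * h x) + c\<^sup>2 * (h x)\<^sup>2 \<partial>M)"
      by (rule Bochner_Integration.integral_cong) (auto simp: power2_eq_square algebra_simps)
    also have "\<dots> = b\<^sup>2 * a - 2 * b * c * c + c\<^sup>2 * b"
      using f2 h2 fh by (simp add: a_def b_def c_def)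
    also have "\<dots> = b * (a * b - c\<^sup>2)" by (simp add: power2_eq_square algebra_simps)
    finally have "b * (a * b - c\<^sup>2) = (\<integral>x. (b * f x - c * h x)\<^sup>2 \<partial>M)" ..
    then have "0 \<le> b * (a * b - c\<^sup>2)" by simp
    then have "c\<^sup>2 \<le> a * b" using b0 False by (simp add: zero_le_mult_iff)
    then show ?thesis by (simp add: a_def b_def c_def)
  qed
qed

text \<open>Strong convergence implies convergence of inner products by Cauchy-Schwarz. The squared
  norms then follow from |F|^2 = |F - f|^2 + 2 F f - f^2.\<close>

lemma L2_tendsto_mult:
  fixes f :: "'a \<Rightarrow> real"
  assumes [measurable]: "\<And>k. F k \<in> borel_measurable M" "f \<in> borel_measurable M" "h \<in> borel_measurable M"
    and F2: "\<And>k. integrable M (\<lambda>x. (F k x)\<^sup>2)" and f2: "integrable M (\<lambda>x. (f x)\<^sup>2)" and h2: "integrable M (\<lambda>x. (h x)\<^sup>2)"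
    and lim: "(\<lambda>k. \<integral>x. (F k x - f x)\<^sup>2 \<partial>M) \<longlonglongrightarrow> 0"
  shows "(\<lambda>k. \<integral>x. F k x * h x \<partial>M) \<longlonglongrightarrow> (\<integral>x. f x * h x \<partial>M)"
    and "(\<lambda>k. \<integral>x. (F k x)\<^sup>2 \<partial>M) \<longlonglongrightarrow> (\<integral>x. (f x)\<^sup>2 \<partial>M)"
proof -
  have Ff: "integrable M (\<lambda>x. F k x * f x)" for k
    by (intro integrable_mult_of_squares F2 f2) measurable
  have d2: "integrable M (\<lambda>x. (F k x - f x)\<^sup>2)" for k
    unfolding power2_diff using F2[of k] f2 Ff[of k] by (simp add: mult.assoc)
  \<comment> \<open>Proved for an arbitrary multiplier, since the second claim needs it with f
    itself.\<close>
  have *: "(\<lambda>k. \<integral>x. F k x * h x \<partial>M) \<longlonglongrightarrow> (\<integral>x. f x * h x \<partial>M)"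
    if [measurable]: "h \<in> borel_measurable M" and h2: "integrable M (\<lambda>x. (h x)\<^sup>2)" for h :: "'a \<Rightarrow> real"
  proof -
    let ?e = "\<lambda>k. (\<integral>x. F k x * h x \<partial>M) - (\<integral>x. f x * h x \<partial>M)"
    have e: "?e k = (\<integral>x. (F k x - f x) * h x \<partial>M)" for k
    proof -
      have "integrable M (\<lambda>x. F k x * h x)" "integrable M (\<lambda>x. f x * h x)"
        by (intro integrable_mult_of_squares F2 f2 h2; measurable)+
      then show ?thesis by (simp add: left_diff_distrib)
    qed
    have le: "(?e k)\<^sup>2 \<le> (\<integral>x. (F k x - f x)\<^sup>2 \<partial>M) * (\<integral>x. (h x)\<^sup>2 \<partial>M)" for k
      unfolding e by (intro integral_Cauchy_Schwarz d2 h2) measurable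
    have "(\<lambda>k. (?e k)\<^sup>2) \<longlonglongrightarrow> 0"
    proof (rule tendsto_sandwich[OF _ _ tendsto_const tendsto_mult_left_zero[OF lim]])
      show "\<forall>\<^sub>F k in sequentially. 0 \<le> (?e k)\<^sup>2" by (intro always_eventually allI) simp
      show "\<forall>\<^sub>F k in sequentially. (?e k)\<^sup>2 \<le> (\<integral>x. (F k x - f x)\<^sup>2 \<partial>M) * (\<integral>x. (h x)\<^sup>2 \<partial>M)"
        by (intro always_eventually allI le)
    qed
    then have "?e \<longlonglongrightarrow> 0" by (simp add: tendsto_null_power)
    then show ?thesis by (simp add: LIM_zero_iff)
  qed
  show "(\<lambda>k. \<integral>x. F k x * h x \<partial>M) \<longlonglongrightarrow> (\<integral>x. f x * h x \<partial>M)" by (intro * h2) measurable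
  have "(\<integral>x. (F k x)\<^sup>2 \<partial>M) = (\<integral>x. (F k x - f x)\<^sup>2 \<partial>M) + 2 * (\<integral>x. F k x * f x \<partial>M) - (\<integral>x. (f x)\<^sup>2 \<partial>M)" for k
    unfolding power2_diff using F2[of k] f2 Ff[of k] by (simp add: mult.assoc)
  moreover have "(\<lambda>k. (\<integral>x. (F k x - f x)\<^sup>2 \<partial>M) + 2 * (\<integral>x. F k x * f x \<partial>M) - (\<integral>x. (f x)\<^sup>2 \<partial>M))
     \<longlonglongrightarrow> 0 + 2 * (\<integral>x. f x * f x \<partial>M) - (\<integral>x. (f x)\<^sup>2 \<partial>M)"
    by (intro tendsto_intros lim * f2) measurable
  ultimately show "(\<lambda>k. \<integral>x. (F k x)\<^sup>2 \<partial>M) \<longlonglongrightarrow> (\<integral>x. (f x)\<^sup>2 \<partial>M)"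
    by (simp add: power2_eq_square)
qed

lemma power2_norm_vec: "(norm x)\<^sup>2 = (\<Sum>i\<in>UNIV. (x $ i)\<^sup>2)" for x :: "real^'n::finite"
  by (simp add: norm_vec_def L2_set_def sum_nonneg)

context weight
begin

sublocale MA: prob_space "muA \<alpha>"
  by (rule prob_space_muA[OF \<alpha>])

lemma measurable_muA: "f \<in> borel_measurable borel \<Longrightarrow> f \<in> borel_measurable (muA \<alpha>)"
  using measurable_compose[OF measurable_muA_id] by blast

lemma integrable_muA_nth: "integrable (muA \<alpha>) (\<lambda>x. x $ i)" "integrable (muA \<alpha>) (\<lambda>x. (x $ i)\<^sup>2)"
  by (subst integrable_muA[OF \<alpha>]; simp add: integrable_Vlin[OF Vlin_nth])+

text \<open>The factor 2 clears the 1/2 on the right. Expanding the square against the constant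
  vector c leaves |g|^2 - 2 Var u + 2 c.b - |c|^2 after integration.\<close>

lemma lhs_minus_rhs:
  assumes u [measurable]: "u \<in> borel_measurable (muA \<alpha>)" and g [measurable]: "\<And>i. (\<lambda>x. g x $ i) \<in> borel_measurable (muA \<alpha>)"
    and u2: "integrable (muA \<alpha>) (\<lambda>x. (u x)\<^sup>2)" and g2: "\<And>i. integrable (muA \<alpha>) (\<lambda>x. (g x $ i)\<^sup>2)"
  shows "2 * (lhsA \<alpha> u g - rhsA \<alpha> u g) = deficit (\<lambda>i. \<integral>x. (g x $ i)\<^sup>2 \<partial>muA \<alpha>) (\<integral>x. (u x)\<^sup>2 \<partial>muA \<alpha>)
    (\<integral>x. u x \<partial>muA \<alpha>) (\<lambda>i. \<integral>x. x $ i * u x \<partial>muA \<alpha>) (\<lambda>i. \<integral>x. g x $ i \<partial>muA \<alpha>) (\<lambda>i. \<integral>x. x $ i \<partial>muA \<alpha>)"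
proof -
  note [measurable] = measurable_muA[OF measurable_vec_nth]
  have i1: "integrable (muA \<alpha>) (\<lambda>x. u x)"
    using integrable_mult_of_squares[OF u, of "\<lambda>_. 1"] u2 by simp
  have ig: "integrable (muA \<alpha>) (\<lambda>x. g x $ i)" for i
    using integrable_mult_of_squares[OF g[of i], of "\<lambda>_. 1"] g2 by simp
  have ix: "integrable (muA \<alpha>) (\<lambda>x. x $ i * u x)" for i
    by (intro integrable_mult_of_squares integrable_muA_nth u2) measurable
  let ?m = "\<integral>x. u x \<partial>muA \<alpha>"
  have mom: "momA \<alpha> u $ i = (\<integral>x. x $ i * u x \<partial>muA \<alpha>) - ?m * (\<integral>x. x $ i \<partial>muA \<alpha>)" for i
    using ix[of i] integrable_muA_nth[of i]
    by (simp add: momA_def meanA_def left_diff_distrib mult.commute[of "u _"])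
  have var: "(\<integral>x. (u x - ?m)\<^sup>2 \<partial>muA \<alpha>) = (\<integral>x. (u x)\<^sup>2 \<partial>muA \<alpha>) - ?m\<^sup>2"
    by (rule MA.variance_eq[OF i1 u2])
  have G: "(\<integral>x. (norm (g x))\<^sup>2 \<partial>muA \<alpha>) = (\<Sum>i\<in>UNIV. \<integral>x. (g x $ i)\<^sup>2 \<partial>muA \<alpha>)"
    unfolding power2_norm_vec using g2 by simp
  have "(\<integral>x. (norm (g x - momA \<alpha> u))\<^sup>2 \<partial>muA \<alpha>)
     = (\<Sum>i\<in>UNIV. \<integral>x. (g x $ i)\<^sup>2 - 2 * momA \<alpha> u $ i * g x $ i + (momA \<alpha> u $ i)\<^sup>2 \<partial>muA \<alpha>)"
    unfolding power2_norm_vec using g2 ig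
    by (subst Bochner_Integration.integral_sum[symmetric]) (auto simp: power2_diff mult_ac algebra_simps)
  also have "\<dots> = (\<Sum>i\<in>UNIV. (\<integral>x. (g x $ i)\<^sup>2 \<partial>muA \<alpha>) - 2 * momA \<alpha> u $ i * (\<integral>x. g x $ i \<partial>muA \<alpha>) + (momA \<alpha> u $ i)\<^sup>2)"
    using g2 ig MA.prob_space by simp
  finally have G': "(\<integral>x. (norm (g x - momA \<alpha> u))\<^sup>2 \<partial>muA \<alpha>)
     = (\<Sum>i\<in>UNIV. \<integral>x. (g x $ i)\<^sup>2 \<partial>muA \<alpha>) - (\<Sum>i\<in>UNIV. 2 * momA \<alpha> u $ i * (\<integral>x. g x $ i \<partial>muA \<alpha>) - (momA \<alpha> u $ i)\<^sup>2)"
    by (simp add: sum.distrib sum_subtractf)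
  show ?thesis
    unfolding lhsA_def rhsA_def meanA_def var G G' deficit_def mom[symmetric] by (simp add: field_simps)
qed

text \<open>On a probability space with square-integrable coordinates, every argument of
  \<open>deficit\<close> is a squared norm or an inner product with 1 or x_i. All of them converge
  along the approximating sequence, so nonnegativity passes to the limit.\<close>

lemma XA_inequality:
  assumes "(u, g) \<in> XA \<alpha>"
  shows "rhsA \<alpha> u g \<le> lhsA \<alpha> u g"
proof -
  from assms obtain \<phi> where u [measurable]: "u \<in> borel_measurable (muA \<alpha>)" and g [measurable]: "g \<in> borel_measurable (muA \<alpha>)"
    and u2: "integrable (muA \<alpha>) (\<lambda>x. (u x)\<^sup>2)" and g2: "integrable (muA \<alpha>) (\<lambda>x. (norm (g x))\<^sup>2)"
    and \<phi>: "\<And>k. \<phi> k \<in> Nstar \<alpha>"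
    and lim_u: "(\<lambda>k. \<integral>x. (\<phi> k x - u x)\<^sup>2 \<partial>muA \<alpha>) \<longlonglongrightarrow> 0"
    and lim_g: "(\<lambda>k. \<integral>x. (norm (grad (\<phi> k) x - g x))\<^sup>2 \<partial>muA \<alpha>) \<longlonglongrightarrow> 0"
    unfolding XA_def by auto
  note [measurable] = measurable_muA[OF measurable_vec_nth]
  have s: "smooth (\<phi> k)" for k using \<phi>[of k] by (auto simp: Nstar_def)
  have b\<phi> [measurable]: "\<phi> k \<in> borel_measurable borel" and bp [measurable]: "partial i (\<phi> k) \<in> borel_measurable borel" for k i
    by (intro borel_measurable_continuous_onI smooth_continuous smooth_partial_continuous s)+
  note [measurable] = measurable_muA[OF b\<phi>] measurable_muA[OF bp]
  have gi [measurable]: "(\<lambda>x. g x $ i) \<in> borel_measurable (muA \<alpha>)" for i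
    using measurable_compose[OF g measurable_vec_nth] .
  have g2i: "integrable (muA \<alpha>) (\<lambda>x. (g x $ i)\<^sup>2)" for i
  proof (rule Bochner_Integration.integrable_bound[OF g2])
    show "AE x in muA \<alpha>. norm ((g x $ i)\<^sup>2) \<le> norm ((norm (g x))\<^sup>2)"
      using member_le_sum[of i UNIV "\<lambda>i. (g _ $ i)\<^sup>2"] by (intro AE_I2) (simp add: power2_norm_vec sum_nonneg)
  qed measurable
  have \<phi>2: "integrable (muA \<alpha>) (\<lambda>x. (\<phi> k x)\<^sup>2)" and p2: "integrable (muA \<alpha>) (\<lambda>x. (partial i (\<phi> k) x)\<^sup>2)" for k i
  proof -
    obtain K where K: "\<And>x. \<bar>\<phi> k x\<bar> \<le> K" "\<And>i x. \<bar>partial i (\<phi> k) x\<bar> \<le> K"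
      using Nstar_bounded[OF \<phi>[of k]] by metis
    have "(\<phi> k x)\<^sup>2 \<le> K\<^sup>2" "(partial i (\<phi> k) x)\<^sup>2 \<le> K\<^sup>2" for x
      using power_mono[OF K(1)[of x], of 2] power_mono[OF K(2)[of i x], of 2] by simp_all
    then show "integrable (muA \<alpha>) (\<lambda>x. (\<phi> k x)\<^sup>2)" "integrable (muA \<alpha>) (\<lambda>x. (partial i (\<phi> k) x)\<^sup>2)"
      by (auto intro!: MA.integrable_const_bound[where B="K\<^sup>2"])
  qed
  have lim_gi: "(\<lambda>k. \<integral>x. (partial i (\<phi> k) x - g x $ i)\<^sup>2 \<partial>muA \<alpha>) \<longlonglongrightarrow> 0" for i
  proof (rule tendsto_sandwich[OF _ _ tendsto_const lim_g])
    have d: "integrable (muA \<alpha>) (\<lambda>x. (partial j (\<phi> k) x - g x $ j)\<^sup>2)" for j k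
      unfolding power2_diff using p2[of j k] g2i[of j] integrable_mult_of_squares[of "partial j (\<phi> k)" "muA \<alpha>" "\<lambda>x. g x $ j"]
      by (simp add: mult.assoc)
    show "\<forall>\<^sub>F k in sequentially. (\<integral>x. (partial i (\<phi> k) x - g x $ i)\<^sup>2 \<partial>muA \<alpha>) \<le> (\<integral>x. (norm (grad (\<phi> k) x - g x))\<^sup>2 \<partial>muA \<alpha>)"
    proof (rule always_eventually, rule allI, rule integral_mono)
      fix k
      show "integrable (muA \<alpha>) (\<lambda>x. (norm (grad (\<phi> k) x - g x))\<^sup>2)"
        unfolding power2_norm_vec using d by (simp add: grad_def)
      show "(partial i (\<phi> k) x - g x $ i)\<^sup>2 \<le> (norm (grad (\<phi> k) x - g x))\<^sup>2" for x
        unfolding power2_norm_vec using member_le_sum[of i UNIV "\<lambda>i. (partial i (\<phi> k) x - g x $ i)\<^sup>2"] by (simp add: grad_def)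
    qed (rule d)
  qed auto
  let ?D = "\<lambda>u g. deficit (\<lambda>i. \<integral>x. (g x $ i)\<^sup>2 \<partial>muA \<alpha>) (\<integral>x. (u x)\<^sup>2 \<partial>muA \<alpha>)
    (\<integral>x. u x \<partial>muA \<alpha>) (\<lambda>i. \<integral>x. x $ i * u x \<partial>muA \<alpha>) (\<lambda>i. \<integral>x. g x $ i \<partial>muA \<alpha>) (\<lambda>i. \<integral>x. x $ i \<partial>muA \<alpha>)"
  have "0 \<le> ?D (\<phi> k) (grad (\<phi> k))" for k
    using Nstar_deficit_nonneg[OF \<phi>[of k]] by (simp add: grad_def integral_muA[OF \<alpha>])
  moreover have "(\<lambda>k. ?D (\<phi> k) (grad (\<phi> k))) \<longlonglongrightarrow> ?D u g"
  proof -
    have "(\<lambda>k. \<integral>x. \<phi> k x \<partial>muA \<alpha>) \<longlonglongrightarrow> (\<integral>x. u x \<partial>muA \<alpha>)"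
      using L2_tendsto_mult(1)[of \<phi> "muA \<alpha>" u "\<lambda>_. 1"] \<phi>2 u2 lim_u by simp
    moreover have "(\<lambda>k. \<integral>x. x $ i * \<phi> k x \<partial>muA \<alpha>) \<longlonglongrightarrow> (\<integral>x. x $ i * u x \<partial>muA \<alpha>)" for i
      using L2_tendsto_mult(1)[of \<phi> "muA \<alpha>" u "\<lambda>x. x $ i"] \<phi>2 u2 lim_u integrable_muA_nth[of i]
      by (simp add: mult.commute)
    moreover have "(\<lambda>k. \<integral>x. (\<phi> k x)\<^sup>2 \<partial>muA \<alpha>) \<longlonglongrightarrow> (\<integral>x. (u x)\<^sup>2 \<partial>muA \<alpha>)"
      using L2_tendsto_mult(2)[of \<phi> "muA \<alpha>" u "\<lambda>_. 1"] \<phi>2 u2 lim_u by simp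
    moreover have "(\<lambda>k. \<integral>x. partial i (\<phi> k) x \<partial>muA \<alpha>) \<longlonglongrightarrow> (\<integral>x. g x $ i \<partial>muA \<alpha>)" for i
      using L2_tendsto_mult(1)[of "\<lambda>k. partial i (\<phi> k)" "muA \<alpha>" "\<lambda>x. g x $ i" "\<lambda>_. 1"] p2 g2i lim_gi by simp
    moreover have "(\<lambda>k. \<integral>x. (partial i (\<phi> k) x)\<^sup>2 \<partial>muA \<alpha>) \<longlonglongrightarrow> (\<integral>x. (g x $ i)\<^sup>2 \<partial>muA \<alpha>)" for i
      using L2_tendsto_mult(2)[of "\<lambda>k. partial i (\<phi> k)" "muA \<alpha>" "\<lambda>x. g x $ i" "\<lambda>_. 1"] p2 g2i lim_gi by simp
    ultimately show ?thesis
      unfolding deficit_def by (auto simp: grad_def intro!: tendsto_intros)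
  qed
  ultimately have "0 \<le> ?D u g" by (intro LIMSEQ_le_const) auto
  then show ?thesis using lhs_minus_rhs[OF u gi u2 g2i] by simp
qed

end

subsection \<open>The equality case\<close>

text \<open>\<open>flat 0 (k - |x|\<^sup>2)\<close> serves as a smooth cutoff: it has compact support and tends to 1 as
  \<open>k \<rightarrow> \<infinity>\<close> with bounded derivative, so no plateau function is needed. The negative powers are
  there to make the class of polynomials in \<open>x\<close> and \<open>flat m (k - |x|\<^sup>2)\<close> closed under partial
  derivatives.\<close>

definition flat :: "nat \<Rightarrow> real \<Rightarrow> real" where
  "flat m s = (if s > 0 then exp (- 1 / s) / s ^ m else 0)"

lemma flat_nonneg: "0 \<le> flat m s"
  by (simp add: flat_def)

lemma flat_tendsto_0: "(flat m \<longlongrightarrow> 0) (at 0)"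
proof -
  have "((\<lambda>s::real. exp (- 1 / s) / s ^ m) \<longlongrightarrow> 0) (at_right 0)" by real_asymp
  moreover have "\<forall>\<^sub>F s in at_right 0. exp (- 1 / s) / s ^ m = flat m s"
    by (auto simp: eventually_at_right_field flat_def intro: exI[of _ 1])
  ultimately have "(flat m \<longlongrightarrow> 0) (at_right 0)" by (rule Lim_transform_eventually)
  moreover have "\<forall>\<^sub>F s in at_left 0. 0 = flat m s"
    by (auto simp: eventually_at_left_field flat_def intro: exI[of _ "-1"])
  then have "(flat m \<longlongrightarrow> 0) (at_left 0)" by (rule Lim_transform_eventually[OF tendsto_const])
  ultimately show ?thesis by (simp add: filterlim_split_at)
qed

lemma DERIV_flat: "(flat m has_real_derivative (flat (m + 2) s - real m * flat (m + 1) s)) (at s)"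
proof (cases s "0 :: real" rule: linorder_cases)
  case less
  have "((\<lambda>_. 0) has_real_derivative 0) (at s)" by simp
  moreover have "\<forall>\<^sub>F t in nhds s. flat m t = 0"
    using eventually_nhds_in_open[of "{..<0}" s] less by (auto elim!: eventually_mono simp: flat_def)
  ultimately have "(flat m has_real_derivative 0) (at s)" by (subst DERIV_cong_ev[OF refl _ refl]) auto
  then show ?thesis using less by (simp add: flat_def)
next
  case equal
  \<comment> \<open>Division by t raises the negative power by one, so the difference quotient at 0
    is the next function of the family. At t = 0 both sides are 0, the left one by the convention
    for division by zero.\<close>
  have "(\<lambda>t. (flat m t - flat m 0) / (t - 0)) = flat (m + 1)"
    by (auto simp: flat_def fun_eq_iff)
  then show ?thesis
    using flat_tendsto_0[of "m + 1"] unfolding equal has_field_derivative_iff by (simp add: flat_def)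
next
  case greater
  have "((\<lambda>t. exp (- 1 / t) / t ^ m) has_real_derivative (flat (m + 2) s - real m * flat (m + 1) s)) (at s)"
  proof (rule DERIV_cong[OF DERIV_divide])
    show "((\<lambda>t. exp (- 1 / t)) has_real_derivative exp (- 1 / s) / s\<^sup>2) (at s)"
      using greater by (auto intro!: derivative_eq_intros simp: power2_eq_square)
    show "((\<lambda>t. t ^ m) has_real_derivative real m * s ^ (m - 1)) (at s)"
      using DERIV_pow[of m s UNIV] by simp
    show "(exp (- 1 / s) / s\<^sup>2 * s ^ m - exp (- 1 / s) * (real m * s ^ (m - 1))) / (s ^ m * s ^ m)
        = flat (m + 2) s - real m * flat (m + 1) s"
      using greater by (cases m) (simp_all add: flat_def field_simps power2_eq_square)
  qed (use greater in simp)
  moreover have "\<forall>\<^sub>F t in nhds s. flat m t = exp (- 1 / t) / t ^ m"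
    using eventually_nhds_in_open[of "{0<..}" s] greater by (auto elim!: eventually_mono simp: flat_def)
  ultimately show ?thesis by (subst DERIV_cong_ev[OF refl _ refl]) auto
qed

inductive cutoff_poly :: "real \<Rightarrow> (real^'n::finite \<Rightarrow> real) \<Rightarrow> bool" for r where
  const: "cutoff_poly r (\<lambda>_. c)"
| nth: "cutoff_poly r (\<lambda>x. x $ i)"
| flat: "cutoff_poly r (\<lambda>x. flat m (r - x \<bullet> x))"
| add: "cutoff_poly r f \<Longrightarrow> cutoff_poly r g \<Longrightarrow> cutoff_poly r (\<lambda>x. f x + g x)"
| mult: "cutoff_poly r f \<Longrightarrow> cutoff_poly r g \<Longrightarrow> cutoff_poly r (\<lambda>x. f x * g x)"

lemma has_derivative_flat_norm:
  fixes x :: "'a::real_inner"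
  shows "((\<lambda>x. flat m (r - x \<bullet> x)) has_derivative
    (\<lambda>h. (flat (m + 2) (r - x \<bullet> x) - real m * flat (m + 1) (r - x \<bullet> x)) * (- 2 * (x \<bullet> h)))) (at x)"
proof -
  have "((\<lambda>x. r - x \<bullet> x) has_derivative (\<lambda>h. - 2 * (x \<bullet> h))) (at x)"
    by (auto intro!: derivative_eq_intros simp: inner_commute)
  from has_derivative_compose[OF this DERIV_flat[unfolded has_field_derivative_def]] show ?thesis
    by simp
qed

lemma cutoff_poly_deriv:
  assumes "cutoff_poly r f"
  obtains f' where "\<And>x. (f has_derivative f' x) (at x)" "\<And>i. cutoff_poly r (\<lambda>x. f' x (axis i 1))"
proof -
  have "\<exists>f'. (\<forall>x. (f has_derivative f' x) (at x)) \<and> (\<forall>i. cutoff_poly r (\<lambda>x. f' x (axis i 1)))"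
    using assms
  proof induction
    case (const c)
    show ?case by (intro exI[of _ "\<lambda>_ _. 0"]) (auto intro: cutoff_poly.const)
  next
    case (nth i)
    show ?case by (intro exI[of _ "\<lambda>_ h. h $ i"]) (auto intro: cutoff_poly.const bounded_linear_imp_has_derivative bounded_linear_vec_nth)
  next
    case (flat m)
    have "cutoff_poly r (\<lambda>x. (flat (m + 2) (r - x \<bullet> x) + (- real m) * flat (m + 1) (r - x \<bullet> x)) * (- 2 * x $ i))" for i
      by (intro cutoff_poly.intros)
    then show ?case
      by (intro exI[of _ "\<lambda>x h. (flat (m + 2) (r - x \<bullet> x) - real m * flat (m + 1) (r - x \<bullet> x)) * (- 2 * (x \<bullet> h))"])
        (use has_derivative_flat_norm[of m r] in \<open>auto simp: inner_axis\<close>)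
  next
    case (add f g)
    then obtain f' g' where "\<And>x. (f has_derivative f' x) (at x)" "\<And>i. cutoff_poly r (\<lambda>x. f' x (axis i 1))"
      "\<And>x. (g has_derivative g' x) (at x)" "\<And>i. cutoff_poly r (\<lambda>x. g' x (axis i 1))" by blast
    then show ?case
      by (intro exI[of _ "\<lambda>x h. f' x h + g' x h"]) (auto intro!: derivative_eq_intros intro: cutoff_poly.add)
  next
    case (mult f g)
    then obtain f' g' where *: "\<And>x. (f has_derivative f' x) (at x)" "\<And>i. cutoff_poly r (\<lambda>x. f' x (axis i 1))"
      "\<And>x. (g has_derivative g' x) (at x)" "\<And>i. cutoff_poly r (\<lambda>x. g' x (axis i 1))" by blast
    show ?case
    proof (intro exI[of _ "\<lambda>x h. f x * g' x h + f' x h * g x"] conjI allI)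
      show "((\<lambda>x. f x * g x) has_derivative (\<lambda>h. f x * g' x h + f' x h * g x)) (at x)" for x
        by (rule has_derivative_mult[OF *(1,3)])
      show "cutoff_poly r (\<lambda>x. f x * g' x (axis i 1) + f' x (axis i 1) * g x)" for i
        by (intro cutoff_poly.add cutoff_poly.mult mult.hyps *)
    qed
  qed
  then show ?thesis using that by blast
qed

lemma cutoff_poly_smooth:
  fixes f :: "real^'n::finite \<Rightarrow> real"
  assumes "cutoff_poly r f" shows "smooth f"
proof -
  have "Ck k f" if "cutoff_poly r f" for k and f :: "real^'n \<Rightarrow> real"
    using that
  proof (induction k arbitrary: f)
    case 0
    obtain f' where "\<And>x. (f has_derivative f' x) (at x)" using cutoff_poly_deriv[OF 0] by metis
    then show ?case
      unfolding Ck.simps by (meson has_derivative_continuous continuous_at_imp_continuous_on)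
  next
    case (Suc k)
    obtain f' where f': "\<And>x. (f has_derivative f' x) (at x)" "\<And>i. cutoff_poly r (\<lambda>x. f' x (axis i 1))"
      using cutoff_poly_deriv[OF Suc.prems] by metis
    then have "partial i f = (\<lambda>x. f' x (axis i 1))" for i
      using partial_eq by blast
    then have "Ck k (partial i f)" for i using Suc.IH f'(2) by simp
    then show ?case using f'(1) by (auto simp: differentiable_def)
  qed
  then show ?thesis using assms by (simp add: smooth_def)
qed

definition cutoff_square :: "'n::finite \<Rightarrow> nat \<Rightarrow> real^'n \<Rightarrow> real" where
  "cutoff_square i k x = (x $ i)\<^sup>2 * flat 0 (real k - x \<bullet> x)"

lemma partial_cutoff_square:
  "partial j (cutoff_square i k) x = (if j = i then 2 * x $ i * flat 0 (real k - x \<bullet> x) else 0)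
     - 2 * (x $ i)\<^sup>2 * x $ j * flat 2 (real k - x \<bullet> x)"
proof -
  have "((\<lambda>x::real^'a. (x $ i)\<^sup>2) has_derivative (\<lambda>h. 2 * x $ i * h $ i)) (at x)"
    by (auto intro!: derivative_eq_intros bounded_linear_imp_has_derivative bounded_linear_vec_nth)
  from has_derivative_mult[OF this has_derivative_flat_norm[of 0 "real k" x]]
  have "(cutoff_square i k has_derivative
     (\<lambda>h. (x $ i)\<^sup>2 * (flat 2 (real k - x \<bullet> x) * (- 2 * (x \<bullet> h))) + 2 * x $ i * h $ i * flat 0 (real k - x \<bullet> x))) (at x)"
    by (simp add: cutoff_square_def[abs_def] del: add_2_eq_Suc')
  moreover have "axis j (1::real) $ i = (if j = i then 1 else 0)" by (simp add: axis_def)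
  ultimately show ?thesis using partial_eq by (fastforce simp: inner_axis)
qed

text \<open>A radial cutoff has a partial derivative in direction j proportional to x_j, so it
  vanishes on the face x_j = 0. The factor x_i^2 adds a further term only for j = i, which is no
  face direction because \<alpha> i = 0.\<close>

lemma cutoff_square_Nstar:
  assumes "\<alpha> i = 0" shows "cutoff_square i k \<in> Nstar \<alpha>"
proof -
  have "cutoff_poly (real k) (\<lambda>x. x $ i * x $ i * flat 0 (real k - x \<bullet> x))"
    by (intro cutoff_poly.intros)
  then have "smooth (cutoff_square i k)"
    using cutoff_poly_smooth by (simp add: cutoff_square_def[abs_def] power2_eq_square)
  moreover have "bounded {x. cutoff_square i k x \<noteq> 0}"
  proof (rule boundedI)
    fix x assume "x \<in> {x. cutoff_square i k x \<noteq> 0}"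
    then have "(norm x)\<^sup>2 < real k"
      by (auto simp: cutoff_square_def flat_def power2_norm_eq_inner split: if_splits)
    also have "\<dots> \<le> (real k + 1)\<^sup>2" by (simp add: power2_eq_square algebra_simps)
    finally show "norm x \<le> real k + 1" by (rule power2_le_imp_le[OF less_imp_le]) simp
  qed
  moreover have "partial j (cutoff_square i k) x = 0" if "\<alpha> j > 0" "x $ j = 0" for j x
    using that assms by (auto simp: partial_cutoff_square)
  ultimately show ?thesis by (auto simp: Nstar_def)
qed

lemma flat_0_le_1: "flat 0 s \<le> 1"
  by (simp add: flat_def)

text \<open>The quadratic Taylor term of exp(1/s) alone is half of 1/s^2. The bound is uniform in
  the cutoff radius, as dominated convergence of the gradients requires.\<close>

lemma flat_2_le_2: "flat 2 s \<le> 2"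
proof (cases "s > 0")
  case True
  have "1 + 1 / s + (1 / s)\<^sup>2 / 2 \<le> exp (1 / s)"
    using True by (intro exp_lower_Taylor_quadratic) simp
  moreover have "0 < 1 / s" using True by simp
  ultimately have "(1 / s)\<^sup>2 \<le> 2 * exp (1 / s)" by linarith
  then show ?thesis using True
    by (simp add: flat_def exp_minus field_simps)
qed (simp add: flat_def)

lemma flat_tendsto_at_top: "(flat 0 \<longlongrightarrow> 1) at_top" "(flat 2 \<longlongrightarrow> 0) at_top"
proof -
  have l: "((\<lambda>s::real. exp (- 1 / s) / s ^ 0) \<longlongrightarrow> 1) at_top" "((\<lambda>s::real. exp (- 1 / s) / s ^ 2) \<longlongrightarrow> 0) at_top"
    by real_asymp+
  have ev: "\<forall>\<^sub>F s in at_top. exp (- 1 / s) / s ^ m = flat m s" for m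
    using eventually_gt_at_top[of 0] by eventually_elim (simp add: flat_def)
  show "(flat 0 \<longlongrightarrow> 1) at_top" "(flat 2 \<longlongrightarrow> 0) at_top"
    by (rule Lim_transform_eventually[OF l(1) ev] Lim_transform_eventually[OF l(2) ev])+
qed

lemma flat_seq: "(\<lambda>k. flat 0 (real k - c)) \<longlonglongrightarrow> 1" "(\<lambda>k. flat 2 (real k - c)) \<longlonglongrightarrow> 0"
proof -
  have "filterlim (\<lambda>k. real k - c) at_top sequentially" by real_asymp
  then show "(\<lambda>k. flat 0 (real k - c)) \<longlonglongrightarrow> 1" "(\<lambda>k. flat 2 (real k - c)) \<longlonglongrightarrow> 0"
    by (auto intro: filterlim_compose[OF flat_tendsto_at_top(1)] filterlim_compose[OF flat_tendsto_at_top(2)])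
qed

definition grad_square :: "'n::finite \<Rightarrow> real^'n \<Rightarrow> real^'n" where
  "grad_square i x = (\<chi> j. if j = i then 2 * x $ i else 0)"

context weight
begin

lemma integrable_nth_powers: "integrable (mu \<alpha>) (\<lambda>x. (x $ i) ^ p * (x $ j) ^ q)"
proof -
  \<comment> \<open>Two conditional factors, so that i = j is covered as well: the exponents then
    add up.\<close>
  let ?h = "\<lambda>k t. (if k = i then t ^ p else 1) * (if k = j then t ^ q else 1) :: real"
  have "integrable (nu (\<alpha> k)) (?h k)" for k
  proof -
    have "?h k = (\<lambda>t. t ^ ((if k = i then p else 0) + (if k = j then q else 0)))"
      by (auto simp: fun_eq_iff power_add)
    then show ?thesis using integrable_nu_power[OF \<alpha>'] by metis
  qed
  then have "integrable (mu \<alpha>) (\<lambda>x. \<Prod>k\<in>UNIV. ?h k (x $ k))"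
    by (rule integrable_mu_prod[OF \<alpha>])
  then show ?thesis by (simp add: prod.distrib prod.delta)
qed

lemma integrable_nth_power: "integrable (mu \<alpha>) (\<lambda>x. (x $ i) ^ p)"
  using integrable_nth_powers[of i p i 0] by simp

text \<open>The last identity says that x_i^2 has covariance 0 with every coordinate, by oddness for
  j = i and by independence otherwise. The moment vector of x_i^2 is therefore 0.\<close>

lemma square_moments:
  assumes i: "\<alpha> i = 0"
  shows "(\<integral>x. (x $ i)\<^sup>2 \<partial>mu \<alpha>) = 1" "(\<integral>x. (x $ i) ^ 4 \<partial>mu \<alpha>) = 3"
    and "(\<integral>x. x $ j * (x $ i)\<^sup>2 \<partial>mu \<alpha>) = (\<integral>x. x $ j \<partial>mu \<alpha>)"
proof -
  show 2: "(\<integral>x. (x $ i)\<^sup>2 \<partial>mu \<alpha>) = 1" "(\<integral>x. (x $ i) ^ 4 \<partial>mu \<alpha>) = 3"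
    using integral_mu_nth[OF \<alpha>, of "\<lambda>t. t\<^sup>2" i] integral_mu_nth[OF \<alpha>, of "\<lambda>t. t ^ 4" i] i by (simp_all add: nu_0_moments)
  show "(\<integral>x. x $ j * (x $ i)\<^sup>2 \<partial>mu \<alpha>) = (\<integral>x. x $ j \<partial>mu \<alpha>)"
  proof (cases "j = i")
    case True
    have "(\<integral>x. (x $ i) ^ 3 \<partial>mu \<alpha>) = 0"
      using integral_mu_nth[OF \<alpha>, of "\<lambda>t. t ^ 3" i] i by (simp add: nu_0_moments)
    then show ?thesis using True integral_nth_eq_0[OF i] by (simp add: power2_eq_square power3_eq_cube mult.assoc)
  next
    case False
    have "(\<integral>x. (x $ i)\<^sup>2 * x $ j \<partial>mu \<alpha>) = (\<integral>t. t\<^sup>2 \<partial>nu (\<alpha> i)) * (\<integral>x. x $ j \<partial>mu \<alpha>)"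
      using False integral_nth_mult[of i j "\<lambda>t. t\<^sup>2"] integrable_nth_powers[of i 2 j 1] by simp
    then show ?thesis by (simp add: i nu_0_moments mult.commute)
  qed
qed

text \<open>The cutoff functions converge to x_i^2 pointwise together with their gradients, and
  polynomials dominate the squared errors uniformly in k.\<close>

lemma square_XA:
  assumes i: "\<alpha> i = 0"
  shows "((\<lambda>x. (x $ i)\<^sup>2), grad_square i) \<in> XA \<alpha>"
proof -
  have mg [measurable]: "grad_square i \<in> borel_measurable borel"
    unfolding grad_square_def[abs_def] by (rule measurable_vec_lambda) measurable
  have s: "smooth (cutoff_square i k)" for k
    using cutoff_square_Nstar[of \<alpha> i k] i by (simp add: Nstar_def)
  have [measurable]: "cutoff_square i k \<in> borel_measurable borel" for k
    by (intro borel_measurable_continuous_onI smooth_continuous s)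
  have mgr [measurable]: "grad (cutoff_square i k) \<in> borel_measurable borel" for k
    unfolding grad_def[abs_def]
    by (intro measurable_vec_lambda borel_measurable_continuous_onI smooth_partial_continuous s)
  have u2: "integrable (mu \<alpha>) (\<lambda>x. ((x $ i)\<^sup>2)\<^sup>2)"
    using integrable_nth_power[of i 4] by simp
  have ng: "(norm (grad_square i x))\<^sup>2 = 4 * (x $ i)\<^sup>2" for x
    by (simp add: power2_norm_vec grad_square_def if_distrib[of "\<lambda>t. t\<^sup>2"] power_mult_distrib sum.delta cong: if_cong)
  have lim_u: "(\<lambda>k. \<integral>x. (cutoff_square i k x - (x $ i)\<^sup>2)\<^sup>2 \<partial>mu \<alpha>) \<longlonglongrightarrow> (\<integral>x. 0 \<partial>mu \<alpha>)"
  proof (rule integral_dominated_convergence[where w="\<lambda>x. (x $ i) ^ 4"])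
    show "integrable (mu \<alpha>) (\<lambda>x. (x $ i) ^ 4)" by (rule integrable_nth_power)
    show "AE x in mu \<alpha>. (\<lambda>k. (cutoff_square i k x - (x $ i)\<^sup>2)\<^sup>2) \<longlonglongrightarrow> 0"
    proof (rule AE_I2)
      fix x :: "real^'n"
      have "(\<lambda>k. ((x $ i)\<^sup>2 * flat 0 (real k - x \<bullet> x) - (x $ i)\<^sup>2)\<^sup>2) \<longlonglongrightarrow> ((x $ i)\<^sup>2 * 1 - (x $ i)\<^sup>2)\<^sup>2"
        by (intro tendsto_intros flat_seq)
      then show "(\<lambda>k. (cutoff_square i k x - (x $ i)\<^sup>2)\<^sup>2) \<longlonglongrightarrow> 0" by (simp add: cutoff_square_def)
    qed
    show "AE x in mu \<alpha>. norm ((cutoff_square i k x - (x $ i)\<^sup>2)\<^sup>2) \<le> (x $ i) ^ 4" for k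
    proof (rule AE_I2)
      fix x :: "real^'n"
      have "(flat 0 (real k - x \<bullet> x) - 1)\<^sup>2 \<le> 1"
        using flat_nonneg[of 0 "real k - x \<bullet> x"] flat_0_le_1[of "real k - x \<bullet> x"] by (simp add: abs_square_le_1)
      then have "(x $ i) ^ 4 * (flat 0 (real k - x \<bullet> x) - 1)\<^sup>2 \<le> (x $ i) ^ 4 * 1" by (intro mult_left_mono) auto
      moreover have "(cutoff_square i k x - (x $ i)\<^sup>2)\<^sup>2 = (x $ i) ^ 4 * (flat 0 (real k - x \<bullet> x) - 1)\<^sup>2"
        by (simp add: cutoff_square_def power2_eq_square power4_eq_xxxx algebra_simps)
      ultimately show "norm ((cutoff_square i k x - (x $ i)\<^sup>2)\<^sup>2) \<le> (x $ i) ^ 4" by simp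
    qed
  qed measurable
  have diff: "(norm (grad (cutoff_square i k) x - grad_square i x))\<^sup>2
      = (\<Sum>j\<in>UNIV. ((if j = i then 2 * x $ i * (flat 0 (real k - x \<bullet> x) - 1) else 0)
          - 2 * (x $ i)\<^sup>2 * x $ j * flat 2 (real k - x \<bullet> x))\<^sup>2)" for k x
    unfolding power2_norm_vec
    by (rule sum.cong) (auto simp: grad_def grad_square_def partial_cutoff_square algebra_simps)
  have lim_g: "(\<lambda>k. \<integral>x. (norm (grad (cutoff_square i k) x - grad_square i x))\<^sup>2 \<partial>mu \<alpha>) \<longlonglongrightarrow> (\<integral>x. 0 \<partial>mu \<alpha>)"
  \<comment> \<open>From (a - b)^2 \<le> 2 a^2 + 2 b^2 with a^2 \<le> 4 x_i^2 and b^2 \<le> 16 x_i^4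
    x_j^2, the latter because \<open>flat 2\<close> is at most 2.\<close>
  proof (rule integral_dominated_convergence[where w="\<lambda>x. \<Sum>j\<in>UNIV. 8 * (x $ i)\<^sup>2 + 32 * ((x $ i) ^ 4 * (x $ j)\<^sup>2)"])
    show "integrable (mu \<alpha>) (\<lambda>x. \<Sum>j\<in>UNIV. 8 * (x $ i)\<^sup>2 + 32 * ((x $ i) ^ 4 * (x $ j)\<^sup>2))"
      using integrable_nth_power[of i 2] integrable_nth_powers[of i 4 _ 2]
      by (intro Bochner_Integration.integrable_sum Bochner_Integration.integrable_add integrable_mult_right)
    show "AE x in mu \<alpha>. (\<lambda>k. (norm (grad (cutoff_square i k) x - grad_square i x))\<^sup>2) \<longlonglongrightarrow> 0"
    proof (rule AE_I2)
      fix x :: "real^'n"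
      have a: "(\<lambda>k. if j = i then 2 * x $ i * (flat 0 (real k - x \<bullet> x) - 1) else 0) \<longlonglongrightarrow> 0" for j
        by (cases "j = i") (auto intro!: tendsto_eq_intros flat_seq)
      have "(\<lambda>k. \<Sum>j\<in>UNIV. ((if j = i then 2 * x $ i * (flat 0 (real k - x \<bullet> x) - 1) else 0)
          - 2 * (x $ i)\<^sup>2 * x $ j * flat 2 (real k - x \<bullet> x))\<^sup>2)
        \<longlonglongrightarrow> (\<Sum>j\<in>UNIV. (0 - 2 * (x $ i)\<^sup>2 * x $ j * 0)\<^sup>2)"
        by (intro tendsto_sum tendsto_power tendsto_diff tendsto_mult tendsto_const a flat_seq)
      then show "(\<lambda>k. (norm (grad (cutoff_square i k) x - grad_square i x))\<^sup>2) \<longlonglongrightarrow> 0"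
        unfolding diff by simp
    qed
    show "AE x in mu \<alpha>. norm ((norm (grad (cutoff_square i k) x - grad_square i x))\<^sup>2)
        \<le> (\<Sum>j\<in>UNIV. 8 * (x $ i)\<^sup>2 + 32 * ((x $ i) ^ 4 * (x $ j)\<^sup>2))" for k
    proof (rule AE_I2)
      fix x :: "real^'n"
      let ?s = "real k - x \<bullet> x"
      have "((if j = i then 2 * x $ i * (flat 0 ?s - 1) else 0) - 2 * (x $ i)\<^sup>2 * x $ j * flat 2 ?s)\<^sup>2
         \<le> 8 * (x $ i)\<^sup>2 + 32 * ((x $ i) ^ 4 * (x $ j)\<^sup>2)" for j
      proof -
        define a where "a = (if j = i then 2 * x $ i * (flat 0 ?s - 1) else 0)"
        define b where "b = 2 * (x $ i)\<^sup>2 * x $ j * flat 2 ?s"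
        have "(flat 0 ?s - 1)\<^sup>2 \<le> 1"
          using flat_nonneg[of 0 ?s] flat_0_le_1[of ?s] by (simp add: abs_square_le_1)
        then have "4 * (x $ i)\<^sup>2 * (flat 0 ?s - 1)\<^sup>2 \<le> 4 * (x $ i)\<^sup>2 * 1" by (intro mult_left_mono) auto
        then have a: "a\<^sup>2 \<le> 4 * (x $ i)\<^sup>2" by (simp add: a_def power_mult_distrib)
        have "(flat 2 ?s)\<^sup>2 \<le> 2\<^sup>2" by (intro power_mono flat_2_le_2 flat_nonneg)
        then have "4 * ((x $ i) ^ 4 * (x $ j)\<^sup>2) * (flat 2 ?s)\<^sup>2 \<le> 4 * ((x $ i) ^ 4 * (x $ j)\<^sup>2) * 2\<^sup>2"
          by (intro mult_left_mono) auto
        then have b: "b\<^sup>2 \<le> 16 * ((x $ i) ^ 4 * (x $ j)\<^sup>2)" by (simp add: b_def power_mult_distrib)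
        have "0 \<le> (a + b)\<^sup>2" by simp
        then have "(a - b)\<^sup>2 \<le> 2 * a\<^sup>2 + 2 * b\<^sup>2" unfolding power2_sum power2_diff by linarith
        then show ?thesis using a b unfolding a_def[symmetric] b_def[symmetric] by linarith
      qed
      then show "norm ((norm (grad (cutoff_square i k) x - grad_square i x))\<^sup>2)
        \<le> (\<Sum>j\<in>UNIV. 8 * (x $ i)\<^sup>2 + 32 * ((x $ i) ^ 4 * (x $ j)\<^sup>2))"
        unfolding diff by (simp add: sum_nonneg) (rule sum_mono)
    qed
  qed measurable
  show ?thesis
    unfolding XA_def
  proof (intro CollectI case_prodI conjI exI[of _ "cutoff_square i"] allI)
    show "(\<lambda>x. (x $ i)\<^sup>2) \<in> borel_measurable (muA \<alpha>)" "grad_square i \<in> borel_measurable (muA \<alpha>)"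
      using measurable_compose[OF measurable_muA_id mg] by (auto intro!: measurable_muA)
    show "integrable (muA \<alpha>) (\<lambda>x. ((x $ i)\<^sup>2)\<^sup>2)"
      using u2 by (subst integrable_muA[OF \<alpha>]) measurable
    show "integrable (muA \<alpha>) (\<lambda>x. (norm (grad_square i x))\<^sup>2)"
      unfolding ng using integrable_nth_power[of i 2] by (subst integrable_muA[OF \<alpha>]) auto
    show "cutoff_square i k \<in> Nstar \<alpha>" for k using i by (rule cutoff_square_Nstar)
    show "(\<lambda>k. \<integral>x. (cutoff_square i k x - (x $ i)\<^sup>2)\<^sup>2 \<partial>muA \<alpha>) \<longlonglongrightarrow> 0"
      using lim_u by (subst integral_muA[OF \<alpha>]) auto
    show "(\<lambda>k. \<integral>x. (norm (grad (cutoff_square i k) x - grad_square i x))\<^sup>2 \<partial>muA \<alpha>) \<longlonglongrightarrow> 0"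
      using lim_g by (subst integral_muA[OF \<alpha>]) auto
  qed
qed

text \<open>The energy is 4, the variance is 3 - 1 = 2 and the moment vector is 0, so the deficit is
  4 - 2 * 2 = 0.\<close>

lemma square_equality:
  assumes i: "\<alpha> i = 0"
  shows "lhsA \<alpha> (\<lambda>x. (x $ i)\<^sup>2) (grad_square i) = rhsA \<alpha> (\<lambda>x. (x $ i)\<^sup>2) (grad_square i)"
proof -
  have g: "grad_square i x $ j = (if j = i then 2 * x $ i else 0)" for x j
    by (simp add: grad_square_def)
  have mg: "(\<lambda>x. grad_square i x $ j) \<in> borel_measurable borel" for j
    unfolding g by measurable
  have g2: "(\<lambda>x. (grad_square i x $ j)\<^sup>2) = (\<lambda>x. if j = i then 4 * (x $ i)\<^sup>2 else 0)" for j
    by (auto simp: g power_mult_distrib)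
  have "2 * (lhsA \<alpha> (\<lambda>x. (x $ i)\<^sup>2) (grad_square i) - rhsA \<alpha> (\<lambda>x. (x $ i)\<^sup>2) (grad_square i))
    = deficit (\<lambda>j. \<integral>x. (grad_square i x $ j)\<^sup>2 \<partial>muA \<alpha>) (\<integral>x. ((x $ i)\<^sup>2)\<^sup>2 \<partial>muA \<alpha>)
    (\<integral>x. (x $ i)\<^sup>2 \<partial>muA \<alpha>) (\<lambda>j. \<integral>x. x $ j * (x $ i)\<^sup>2 \<partial>muA \<alpha>) (\<lambda>j. \<integral>x. grad_square i x $ j \<partial>muA \<alpha>) (\<lambda>j. \<integral>x. x $ j \<partial>muA \<alpha>)"
  proof (rule lhs_minus_rhs)
    show "integrable (muA \<alpha>) (\<lambda>x. ((x $ i)\<^sup>2)\<^sup>2)"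
      using integrable_nth_power[of i 4] by (subst integrable_muA[OF \<alpha>]) auto
    show "integrable (muA \<alpha>) (\<lambda>x. (grad_square i x $ j)\<^sup>2)" for j
      unfolding g2 using integrable_nth_power[of i 2] by (cases "j = i"; subst integrable_muA[OF \<alpha>]) auto
  qed (auto intro!: measurable_muA mg)
  also have "\<dots> = deficit (\<lambda>j. if j = i then 4 else 0) 3 1 (\<lambda>j. \<integral>x. x $ j \<partial>mu \<alpha>) (\<lambda>j. \<integral>x. grad_square i x $ j \<partial>mu \<alpha>) (\<lambda>j. \<integral>x. x $ j \<partial>mu \<alpha>)"
  proof -
    have "(\<integral>x. (grad_square i x $ j)\<^sup>2 \<partial>muA \<alpha>) = (if j = i then 4 else 0)" for j
      unfolding g2 using square_moments(1)[OF i] by (cases "j = i") (simp_all add: integral_muA[OF \<alpha>])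
    moreover have "(\<integral>x. ((x $ i)\<^sup>2)\<^sup>2 \<partial>muA \<alpha>) = 3"
      using square_moments(2)[OF i] by (simp add: integral_muA[OF \<alpha>])
    ultimately show ?thesis
      using square_moments(1,3)[OF i] mg by (simp add: integral_muA[OF \<alpha>])
  qed
  also have "\<dots> = 0" by (simp add: deficit_def)
  finally show ?thesis by simp
qed

text \<open>Pairing with x_i^2 - 1 separates the two sides: every affine function is orthogonal to
  it, whereas x_i^2 gives 3 - 1 = 2.\<close>

lemma square_not_affine:
  assumes i: "\<alpha> i = 0"
  shows "\<not> (AE x in muA \<alpha>. (x $ i)\<^sup>2 = a + b \<bullet> x)"
proof
  assume ae: "AE x in muA \<alpha>. (x $ i)\<^sup>2 = a + b \<bullet> x"
  note I = integrable_nth_power[of i 2] integrable_nth_power[of i 4] integrable_nth_powers[of _ 1 i 2] integrable_nth_power[of _ 1]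
  have "(\<integral>x. ((x $ i)\<^sup>2 - 1) * (x $ i)\<^sup>2 \<partial>muA \<alpha>) = (\<integral>x. ((x $ i)\<^sup>2 - 1) * (a + b \<bullet> x) \<partial>muA \<alpha>)"
    by (rule integral_cong_AE) (use ae in \<open>auto intro!: measurable_muA\<close>)
  then have "(\<integral>x. ((x $ i)\<^sup>2 - 1) * (x $ i)\<^sup>2 \<partial>mu \<alpha>) = (\<integral>x. ((x $ i)\<^sup>2 - 1) * (a + b \<bullet> x) \<partial>mu \<alpha>)"
    by (simp add: integral_muA[OF \<alpha>])
  moreover have "(\<integral>x. ((x $ i)\<^sup>2 - 1) * (x $ i)\<^sup>2 \<partial>mu \<alpha>) = (\<integral>x. (x $ i) ^ 4 - (x $ i)\<^sup>2 \<partial>mu \<alpha>)"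
    by (simp add: algebra_simps power2_eq_square power4_eq_xxxx)
  moreover have "((x $ i)\<^sup>2 - 1) * (a + b \<bullet> x) = a * (x $ i)\<^sup>2 - a + (\<Sum>j\<in>UNIV. b $ j * (x $ j * (x $ i)\<^sup>2 - x $ j))" for x
    by (simp add: inner_vec_def algebra_simps sum_distrib_left sum_subtractf)
  ultimately show False
    using I square_moments[OF i] M.prob_space by simp
qed

end

theorem theorem1p3:
  fixes \<alpha> :: "'n::finite \<Rightarrow> real"
  assumes "\<forall>i. \<alpha> i \<ge> 0"
  shows "(\<forall>(u, g) \<in> XA \<alpha>. lhsA \<alpha> u g \<ge> rhsA \<alpha> u g) \<and>
         ((\<exists>i. \<alpha> i = 0) \<longrightarrow>
            (\<exists>(u, g) \<in> XA \<alpha>. lhsA \<alpha> u g = rhsA \<alpha> u g \<and>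
               \<not> (\<exists>a b. AE x in muA \<alpha>. u x = a + b \<bullet> x)))"
proof -
  interpret weight \<alpha> by standard (rule assms)
  have "\<exists>(u, g) \<in> XA \<alpha>. lhsA \<alpha> u g = rhsA \<alpha> u g \<and> \<not> (\<exists>a b. AE x in muA \<alpha>. u x = a + b \<bullet> x)"
    if "\<alpha> i = 0" for i
    using square_XA[OF that] square_equality[OF that] square_not_affine[OF that] by blast
  then show ?thesis using XA_inequality by blast
qed

end
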